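(* Let $[a,b]\subset\mathbb{R}$ be a compact interval, let $m\geq1$, $r\geq2$, $n\geq0$ be integers, let $0<\alpha\leq1$, and let $\varepsilon_0>0$. For each $\varepsilon\in[0,\varepsilon_0)$ let $A_{r-j}(\cdot,\varepsilon)\in(C^{n,\alpha})^{m\times m}$ for $j=1,\dots,r$, let $f(\cdot,\varepsilon)\in(C^{n,\alpha})^{m}$, let $c(\varepsilon)\in\mathbb{C}^{rm}$, and let $B(\varepsilon):(C^{n+r,\alpha})^{m}\to\mathbb{C}^{rm}$ be a continuous linear operator (no regularity in $\varepsilon$ is assumed). Consider the parameter-dependent boundary-value problem $$L(\varepsilon)y(t,\varepsilon)\equiv y^{(r)}(t,\varepsilon)+\sum_{j=1}^{r}A_{r-j}(t,\varepsilon)y^{(r-j)}(t,\varepsilon)=f(t,\varepsilon),\quad a\leq t\leq b,\qquad B(\varepsilon)y(\cdot,\varepsilon)=c(\varepsilon),$$ with unknown $y(\cdot,\varepsilon)\in(C^{n+r,\alpha})^{m}$. Then the solution to this problem depends continuously on the parameter $\varepsilon$ at $\varepsilon=0$ (in the sense defined in the context) if and only if the following three conditions hold: (0) the homogeneous problem $L(0)y=0$ on $[a,b]$, $B(0)y=0$, has only the trivial solution $y=0$ in $(C^{n+r,\alpha})^{m}$; (I) $A_{r-j}(\cdot,\varepsilon)\to A_{r-j}(\cdot,0)$ in $(C^{n,\alpha})^{m\times m}$ as $\varepsilon\to0+$, for each $j\in\{1,\dots,r\}$; (II) $B(\varepsilon)y\to B(0)y$ in $\mathbb{C}^{rm}$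 as $\varepsilon\to0+$, for every $y\in(C^{n+r,\alpha})^{m}$.
   Context: $C^{n,\alpha}$ denotes the complex Hölder space of all $n$ times continuously differentiable functions $x:[a,b]\to\mathbb{C}$ with $\|x\|'_{n,\alpha}:=\sup_{a\leq t_1<t_2\leq b}|x^{(n)}(t_2)-x^{(n)}(t_1)|/|t_2-t_1|^{\alpha}<\infty$, normed by $\|x\|_{n,\alpha}:=\sum_{j=0}^{n}\max_{[a,b]}|x^{(j)}|+\|x\|'_{n,\alpha}$. $(C^{n,\alpha})^{m}$ and $(C^{n,\alpha})^{m\times m}$ are the spaces of $m$-column vector-valued and $m\times m$ matrix-valued functions on $[a,b]$ with entries in $C^{n,\alpha}$, normed by the sum of the norms of the entries. Definition: the solution to the problem depends continuously on $\varepsilon$ at $\varepsilon=0$ if ( * ) there is $\varepsilon_1\in(0,\varepsilon_0)$ such that for every $\varepsilon\in[0,\varepsilon_1)$ and arbitrary $f(\cdot,\varepsilon)\in(C^{n,\alpha})^{m}$, $c(\varepsilon)\in\mathbb{C}^{rm}$ the problem has a unique solution $y(\cdot,\varepsilon)\in(C^{n+r,\alpha})^{m}$; and ( ** ) whenever $f(\cdot,\varepsilon)\to f(\cdot,0)$ in $(C^{n,\alpha})^{m}$ and $c(\varepsilon)\to c(0)$ in $\mathbb{C}^{rm}$ as $\varepsilon\to0+$, it follows that $y(\cdot,\varepsilon)\to y(\cdot,0)$ in $(C^{n+r,\alpha})^{m}$ as $\varepsilon\to0+$. *)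

theory Defs
  imports "HOL-Analysis.Analysis"
begin

text \<open>Scalar functions on [a,b] are modelled as complex-valued functions on the reals
that vanish outside [a,b] (canonical representatives). Vector / matrix valued functions
are indexed by natural numbers, entries with indices out of range being 0.
Vectors of C^N are functions nat => complex vanishing at indices >= N.\<close>

fun dern :: "real \<Rightarrow> real \<Rightarrow> nat \<Rightarrow> (real \<Rightarrow> complex) \<Rightarrow> real \<Rightarrow> complex" where
  "dern a b 0 x = x"
| "dern a b (Suc k) x = (\<lambda>t. vector_derivative (dern a b k x) (at t within {a..b}))"

definition hoelder_semi :: "nat \<Rightarrow> real \<Rightarrow> real \<Rightarrow> real \<Rightarrow> (real \<Rightarrow> complex) \<Rightarrow> real" where
  "hoelder_semi n \<alpha> a b x =
     Sup {cmod (dern a b n x t2 - dern a b n x t1) / \<bar>t2 - t1\<bar> powr \<alpha> | t1 t2. a \<le> t1 \<and> t1 < t2 \<and> t2 \<le> b}"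

definition Hoelder :: "nat \<Rightarrow> real \<Rightarrow> real \<Rightarrow> real \<Rightarrow> (real \<Rightarrow> complex) set" where
  "Hoelder n \<alpha> a b = {x.
     (\<forall>t. t \<notin> {a..b} \<longrightarrow> x t = 0) \<and>
     (\<forall>k\<le>n. continuous_on {a..b} (dern a b k x)) \<and>
     (\<forall>k<n. \<forall>t\<in>{a..b}. (dern a b k x has_vector_derivative dern a b (Suc k) x t) (at t within {a..b})) \<and>
     bdd_above {cmod (dern a b n x t2 - dern a b n x t1) / \<bar>t2 - t1\<bar> powr \<alpha> | t1 t2. a \<le> t1 \<and> t1 < t2 \<and> t2 \<le> b}}"

definition hoelder_norm :: "nat \<Rightarrow> real \<Rightarrow> real \<Rightarrow> real \<Rightarrow> (real \<Rightarrow> complex) \<Rightarrow> real" where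
  "hoelder_norm n \<alpha> a b x =
     (\<Sum>j\<le>n. Sup ((\<lambda>t. cmod (dern a b j x t)) ` {a..b})) + hoelder_semi n \<alpha> a b x"

definition VHoelder :: "nat \<Rightarrow> nat \<Rightarrow> real \<Rightarrow> real \<Rightarrow> real \<Rightarrow> (nat \<Rightarrow> real \<Rightarrow> complex) set" where
  "VHoelder m n \<alpha> a b = {y. (\<forall>i<m. y i \<in> Hoelder n \<alpha> a b) \<and> (\<forall>i\<ge>m. y i = (\<lambda>t. 0))}"

definition vnorm :: "nat \<Rightarrow> nat \<Rightarrow> real \<Rightarrow> real \<Rightarrow> real \<Rightarrow> (nat \<Rightarrow> real \<Rightarrow> complex) \<Rightarrow> real" where
  "vnorm m n \<alpha> a b y = (\<Sum>i<m. hoelder_norm n \<alpha> a b (y i))"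

definition MHoelder :: "nat \<Rightarrow> nat \<Rightarrow> real \<Rightarrow> real \<Rightarrow> real \<Rightarrow> (nat \<Rightarrow> nat \<Rightarrow> real \<Rightarrow> complex) set" where
  "MHoelder m n \<alpha> a b = {M. (\<forall>i<m. \<forall>l<m. M i l \<in> Hoelder n \<alpha> a b) \<and>
       (\<forall>i l. (m \<le> i \<or> m \<le> l) \<longrightarrow> M i l = (\<lambda>t. 0))}"

definition mnorm :: "nat \<Rightarrow> nat \<Rightarrow> real \<Rightarrow> real \<Rightarrow> real \<Rightarrow> (nat \<Rightarrow> nat \<Rightarrow> real \<Rightarrow> complex) \<Rightarrow> real" where
  "mnorm m n \<alpha> a b M = (\<Sum>i<m. \<Sum>l<m. hoelder_norm n \<alpha> a b (M i l))"

definition cvec :: "nat \<Rightarrow> (nat \<Rightarrow> complex) set" where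
  "cvec N = {v. \<forall>i\<ge>N. v i = 0}"

definition cnorm :: "nat \<Rightarrow> (nat \<Rightarrow> complex) \<Rightarrow> real" where
  "cnorm N v = (\<Sum>i<N. cmod (v i))"

definition cont_lin_op :: "nat \<Rightarrow> nat \<Rightarrow> real \<Rightarrow> real \<Rightarrow> real \<Rightarrow> nat
    \<Rightarrow> ((nat \<Rightarrow> real \<Rightarrow> complex) \<Rightarrow> (nat \<Rightarrow> complex)) \<Rightarrow> bool" where
  "cont_lin_op m k \<alpha> a b N T \<longleftrightarrow>
     (\<forall>y\<in>VHoelder m k \<alpha> a b. T y \<in> cvec N) \<and>
     (\<forall>y\<in>VHoelder m k \<alpha> a b. \<forall>z\<in>VHoelder m k \<alpha> a b. \<forall>s t::complex.
         T (\<lambda>i u. s * y i u + t * z i u) = (\<lambda>i. s * T y i + t * T z i)) \<and>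
     (\<forall>y\<in>VHoelder m k \<alpha> a b. \<forall>e>0. \<exists>d>0. \<forall>z\<in>VHoelder m k \<alpha> a b.
         vnorm m k \<alpha> a b (\<lambda>i u. z i u - y i u) < d \<longrightarrow> cnorm N (\<lambda>i. T z i - T y i) < e)"

definition Lop :: "real \<Rightarrow> real \<Rightarrow> nat \<Rightarrow> nat
    \<Rightarrow> (nat \<Rightarrow> real \<Rightarrow> nat \<Rightarrow> nat \<Rightarrow> real \<Rightarrow> complex) \<Rightarrow> real
    \<Rightarrow> (nat \<Rightarrow> real \<Rightarrow> complex) \<Rightarrow> (nat \<Rightarrow> real \<Rightarrow> complex)" where
  "Lop a b m r A \<epsilon> y = (\<lambda>i t. if i < m \<and> t \<in> {a..b} then
      dern a b r (y i) t + (\<Sum>j\<in>{1..r}. \<Sum>l<m. A (r - j) \<epsilon> i l t * dern a b (r - j) (y l) t)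
    else 0)"

definition cont_dep :: "real \<Rightarrow> real \<Rightarrow> nat \<Rightarrow> nat \<Rightarrow> nat \<Rightarrow> real \<Rightarrow> real
    \<Rightarrow> (nat \<Rightarrow> real \<Rightarrow> nat \<Rightarrow> nat \<Rightarrow> real \<Rightarrow> complex)
    \<Rightarrow> (real \<Rightarrow> (nat \<Rightarrow> real \<Rightarrow> complex) \<Rightarrow> (nat \<Rightarrow> complex)) \<Rightarrow> bool" where
  "cont_dep a b m r n \<alpha> \<epsilon>0 A B \<longleftrightarrow>
    (\<exists>\<epsilon>1. 0 < \<epsilon>1 \<and> \<epsilon>1 < \<epsilon>0 \<and>
      (\<forall>\<epsilon>\<in>{0..<\<epsilon>1}. \<forall>f\<in>VHoelder m n \<alpha> a b. \<forall>c\<in>cvec (r * m).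
         \<exists>!y. y \<in> VHoelder m (n + r) \<alpha> a b \<and> Lop a b m r A \<epsilon> y = f \<and> B \<epsilon> y = c) \<and>
      (\<forall>f c y. (\<forall>\<epsilon>\<in>{0..<\<epsilon>1}. f \<epsilon> \<in> VHoelder m n \<alpha> a b \<and> c \<epsilon> \<in> cvec (r * m) \<and>
                  y \<epsilon> \<in> VHoelder m (n + r) \<alpha> a b \<and>
                  Lop a b m r A \<epsilon> (y \<epsilon>) = f \<epsilon> \<and> B \<epsilon> (y \<epsilon>) = c \<epsilon>) \<longrightarrow>
         ((\<lambda>\<epsilon>. vnorm m n \<alpha> a b (\<lambda>i t. f \<epsilon> i t - f 0 i t)) \<longlongrightarrow> 0) (at_right 0) \<longrightarrow>
         ((\<lambda>\<epsilon>. cnorm (r * m) (\<lambda>i. c \<epsilon> i - c 0 i)) \<longlongrightarrow> 0) (at_right 0) \<longrightarrow>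
         ((\<lambda>\<epsilon>. vnorm m (n + r) \<alpha> a b (\<lambda>i t. y \<epsilon> i t - y 0 i t)) \<longlongrightarrow> 0) (at_right 0)))"

end

theory Submission
  imports Defs "HOL-Library.Function_Algebras" "Jordan_Normal_Form.Determinant"
begin

text \<open>
  Integrating \<open>r\<close> times turns the initial-value problem for \<open>L(\<epsilon>)\<close> into a Volterra equation for the
  highest derivative. Some power of the Volterra operator is a contraction: it contracts an exponentially
  weighted sup norm, and it gains one derivative, so that the decay of its powers carries over to the
  Hoelder norms. Hence the initial-value problem is well posed, \<open>ker L(\<epsilon>)\<close> has dimension \<open>rm\<close>, and the
  boundary-value problem is uniquely solvable iff its kernel is trivial.

  If (0), (I) and (II) hold, write \<open>y = u + v\<close>, where \<open>u\<close> has zero initial data and \<open>v \<in> ker L(0)\<close>. The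
  operators \<open>B(\<epsilon>)\<close> are uniformly bounded by the Banach-Steinhaus theorem and converge on the
  finite-dimensional \<open>ker L(0)\<close>, and \<open>L(\<epsilon>)\<close> converges in operator norm. This gives an a priori estimate
  uniform in \<open>\<epsilon>\<close>.

  Conversely, let \<open>y(\<epsilon>)\<close> solve the problem with the data \<open>L(0)z\<close>, \<open>B(0)z\<close>, so that \<open>y(\<epsilon>) \<rightarrow> z\<close>. Then
  \<open>L(\<epsilon>)z - L(0)z = L(\<epsilon>)(z - y(\<epsilon>))\<close> is small relative to \<open>1 + \<parallel>L(\<epsilon>) - L(0)\<parallel>\<close>, and letting \<open>z\<close> run through
  the monomials bounds the coefficients of \<open>L(\<epsilon>) - L(0)\<close> one after the other; absorption yields (I).
  With the data \<open>L(\<epsilon>)z\<close>, \<open>B(0)z\<close> instead, \<open>z - y(\<epsilon>)\<close> lies in \<open>ker L(\<epsilon>)\<close>, and its coordinates in the basis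
  dual to \<open>B(\<epsilon>)\<close> are \<open>B(\<epsilon>)z - B(0)z\<close>; these bases converge as well, which yields (II).
\<close>

section \<open>Normed spaces of functions\<close>

class complex_vector = ab_group_add +
  fixes scaleC :: "complex \<Rightarrow> 'a \<Rightarrow> 'a" (infixr "*\<^sub>C" 75)
  assumes scaleC_add_right: "c *\<^sub>C (x + y) = c *\<^sub>C x + c *\<^sub>C y"
    and scaleC_add_left: "(c + d) *\<^sub>C x = c *\<^sub>C x + d *\<^sub>C x"
    and scaleC_scaleC: "c *\<^sub>C d *\<^sub>C x = (c * d) *\<^sub>C x"
    and scaleC_one: "1 *\<^sub>C x = x"

interpretation complex_vector: vector_space "scaleC :: complex \<Rightarrow> 'a \<Rightarrow> 'a::complex_vector"
  by standard (simp_all add: scaleC_add_right scaleC_add_left scaleC_scaleC scaleC_one)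

instantiation complex :: complex_vector
begin

definition "c *\<^sub>C x = c * x" for c x :: complex

instance by standard (simp_all add: scaleC_complex_def algebra_simps)

end

instantiation "fun" :: (type, complex_vector) complex_vector
begin

definition "c *\<^sub>C f = (\<lambda>x. c *\<^sub>C f x)"

instance
  by standard (simp_all add: scaleC_fun_def fun_eq_iff scaleC_add_right scaleC_add_left
      scaleC_scaleC scaleC_one)

end

lemma scaleC_fun_apply [simp]: "(c *\<^sub>C f) x = c *\<^sub>C f x"
  by (simp add: scaleC_fun_def)

lemma sum_fun_apply: "(\<Sum>s\<in>S. f s) x = (\<Sum>s\<in>S. f s x)"
  by (induction S rule: infinite_finite_induct) auto

locale normed_subspace =
  fixes V :: "'a::complex_vector set" and nrm :: "'a \<Rightarrow> real"
  assumes zero_mem: "0 \<in> V"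
    and add_mem: "x \<in> V \<Longrightarrow> y \<in> V \<Longrightarrow> x + y \<in> V"
    and scaleC_mem: "x \<in> V \<Longrightarrow> c *\<^sub>C x \<in> V"
    and nrm_add_le: "x \<in> V \<Longrightarrow> y \<in> V \<Longrightarrow> nrm (x + y) \<le> nrm x + nrm y"
    and nrm_scaleC_le: "x \<in> V \<Longrightarrow> nrm (c *\<^sub>C x) \<le> cmod c * nrm x"
    and nrm_zeroD: "x \<in> V \<Longrightarrow> nrm x = 0 \<Longrightarrow> x = 0"
begin

lemma uminus_mem: "x \<in> V \<Longrightarrow> - x \<in> V"
  using scaleC_mem[of x "-1"] by simp

lemma diff_mem: "x \<in> V \<Longrightarrow> y \<in> V \<Longrightarrow> x - y \<in> V"
  using add_mem[of x "- y"] uminus_mem by simp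

lemma sum_mem: "(\<And>s. s \<in> S \<Longrightarrow> x s \<in> V) \<Longrightarrow> (\<Sum>s\<in>S. x s) \<in> V"
  by (induction S rule: infinite_finite_induct) (auto simp: zero_mem add_mem)

lemma nrm_zero: "nrm 0 = 0"
  using nrm_scaleC_le[OF zero_mem, of 0] nrm_add_le[OF zero_mem zero_mem] by simp

lemma nrm_uminus: "x \<in> V \<Longrightarrow> nrm (- x) = nrm x"
  using nrm_scaleC_le[of x "-1"] nrm_scaleC_le[of "- x" "-1"] uminus_mem[of x] by simp

lemma nrm_nonneg: "x \<in> V \<Longrightarrow> 0 \<le> nrm x"
  using nrm_add_le[of x "- x"] by (simp add: uminus_mem nrm_uminus nrm_zero)

lemma nrm_scaleC:
  assumes "x \<in> V"
  shows "nrm (c *\<^sub>C x) = cmod c * nrm x"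
proof (cases "c = 0")
  case False
  have "nrm x \<le> inverse (cmod c) * nrm (c *\<^sub>C x)"
    using nrm_scaleC_le[OF scaleC_mem[OF assms, of c], of "inverse c"] False
    by (simp add: scaleC_scaleC scaleC_one norm_inverse)
  then show ?thesis
    using nrm_scaleC_le[OF assms, of c] False by (simp add: field_simps)
qed (simp add: nrm_zero)

lemma nrm_diff_le: "x \<in> V \<Longrightarrow> y \<in> V \<Longrightarrow> nrm (x - y) \<le> nrm x + nrm y"
  using nrm_add_le[of x "- y"] by (simp add: uminus_mem nrm_uminus)

lemma nrm_minus_commute: "x \<in> V \<Longrightarrow> y \<in> V \<Longrightarrow> nrm (x - y) = nrm (y - x)"
  using nrm_uminus[of "x - y"] by (simp add: diff_mem)

lemma nrm_le_add_diff: "x \<in> V \<Longrightarrow> y \<in> V \<Longrightarrow> nrm x \<le> nrm y + nrm (x - y)"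
  using nrm_add_le[of y "x - y"] by (simp add: diff_mem)

lemma nrm_sum_le:
  "(\<And>s. s \<in> S \<Longrightarrow> x s \<in> V) \<Longrightarrow> nrm (\<Sum>s\<in>S. x s) \<le> (\<Sum>s\<in>S. nrm (x s))"
proof (induction S rule: infinite_finite_induct)
  case (insert s S)
  then show ?case
    using nrm_add_le[of "x s" "\<Sum>s\<in>S. x s"] sum_mem[of S x] by simp
qed (simp_all add: nrm_zero)

end

locale linear_operator = dom: normed_subspace V p + cod: normed_subspace W q
  for V :: "'a::complex_vector set" and p and W :: "'b::complex_vector set" and q +
  fixes T :: "'a \<Rightarrow> 'b"
  assumes maps: "x \<in> V \<Longrightarrow> T x \<in> W"
    and add: "x \<in> V \<Longrightarrow> y \<in> V \<Longrightarrow> T (x + y) = T x + T y"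
    and scaleC: "x \<in> V \<Longrightarrow> T (c *\<^sub>C x) = c *\<^sub>C T x"
begin

lemma zero: "T 0 = 0"
  using scaleC[OF dom.zero_mem, of 0] by simp

lemma diff: "x \<in> V \<Longrightarrow> y \<in> V \<Longrightarrow> T (x - y) = T x - T y"
  using add[of x "- y"] scaleC[of y "-1"] dom.uminus_mem[of y] by simp

lemma sum: "(\<And>s. s \<in> S \<Longrightarrow> x s \<in> V) \<Longrightarrow> T (\<Sum>s\<in>S. x s) = (\<Sum>s\<in>S. T (x s))"
proof (induction S rule: infinite_finite_induct)
  case (insert s S)
  then show ?case using add[of "x s" "\<Sum>s\<in>S. x s"] dom.sum_mem[of S x] by simp
qed (simp_all add: zero)

lemma bound_of_bound_on_ball:
  assumes "0 < d" and ball: "\<And>x. x \<in> V \<Longrightarrow> p x < d \<Longrightarrow> q (T x) \<le> c" and x: "x \<in> V"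
  shows "q (T x) \<le> 2 * c / d * p x"
proof (cases "p x = 0")
  case True
  then show ?thesis using dom.nrm_zeroD[OF x] by (simp add: zero cod.nrm_zero)
next
  case False
  then have pos: "0 < p x" using dom.nrm_nonneg[OF x] by simp
  define t where "t = d / (2 * p x)"
  have t: "0 < t" "t * p x = d / 2" using pos \<open>0 < d\<close> by (auto simp: t_def)
  have "q (T (complex_of_real t *\<^sub>C x)) \<le> c"
    using t \<open>0 < d\<close> x by (intro ball dom.scaleC_mem) (simp_all add: dom.nrm_scaleC)
  then have "t * q (T x) \<le> c" using t x by (simp add: scaleC cod.nrm_scaleC maps)
  then show ?thesis using pos \<open>0 < d\<close> by (simp add: t_def field_simps)
qed

end

locale bounded_operator = linear_operator +
  assumes bounded: "\<exists>c. \<forall>x\<in>V. q (T x) \<le> c * p x"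
begin

lemma nonneg_bound: obtains c where "0 \<le> c" "\<And>x. x \<in> V \<Longrightarrow> q (T x) \<le> c * p x"
proof -
  obtain c where c: "\<And>x. x \<in> V \<Longrightarrow> q (T x) \<le> c * p x" using bounded by blast
  show thesis
  proof
    show "q (T x) \<le> \<bar>c\<bar> * p x" if "x \<in> V" for x
      using c[OF that] mult_right_mono[OF abs_ge_self dom.nrm_nonneg[OF that], of c] by linarith
  qed simp
qed

end

lemma bounded_operatorI:
  assumes "normed_subspace V p" "normed_subspace W q"
    and "\<And>x. x \<in> V \<Longrightarrow> T x \<in> W" "\<And>x. x \<in> V \<Longrightarrow> q (T x) \<le> c * p x"
    and "\<And>x y. x \<in> V \<Longrightarrow> y \<in> V \<Longrightarrow> T (x + y) = T x + T y"
    and "\<And>x c. x \<in> V \<Longrightarrow> T (c *\<^sub>C x) = c *\<^sub>C T x"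
  shows "bounded_operator V p W q T"
  using assms
  by (auto simp: bounded_operator_def linear_operator_def linear_operator_axioms_def
      bounded_operator_axioms_def)

lemma bounded_operator_comp:
  assumes T: "bounded_operator V p W q T" and S: "bounded_operator W q U r S"
  shows "bounded_operator V p U r (S \<circ> T)"
proof -
  interpret T: bounded_operator V p W q T by fact
  interpret S: bounded_operator W q U r S by fact
  obtain c where c: "\<And>x. x \<in> V \<Longrightarrow> q (T x) \<le> c * p x" using T.bounded by blast
  obtain d where d: "0 \<le> d" "\<And>x. x \<in> W \<Longrightarrow> r (S x) \<le> d * q x" using S.nonneg_bound by blast
  show ?thesis
  proof (rule bounded_operatorI)
    show "r ((S \<circ> T) x) \<le> d * c * p x" if "x \<in> V" for x
      using order_trans[OF d(2)[OF T.maps[OF that]] mult_left_mono[OF c[OF that] d(1)]]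
      by (simp add: mult.assoc)
  qed (use T.maps S.maps in \<open>auto simp: T.add S.add T.scaleC S.scaleC
        intro: T.dom.normed_subspace_axioms S.cod.normed_subspace_axioms\<close>)
qed

lemma bounded_operator_add:
  assumes T: "bounded_operator V p W q T" and S: "bounded_operator V p W q S"
  shows "bounded_operator V p W q (\<lambda>x. T x + S x)"
proof -
  interpret T: bounded_operator V p W q T by fact
  interpret S: bounded_operator V p W q S by fact
  obtain c d where "\<And>x. x \<in> V \<Longrightarrow> q (T x) \<le> c * p x" "\<And>x. x \<in> V \<Longrightarrow> q (S x) \<le> d * p x"
    using T.bounded S.bounded by blast
  then have bound: "q (T x + S x) \<le> (c + d) * p x" if "x \<in> V" for x
    using T.cod.nrm_add_le[OF T.maps S.maps, OF that that] that by (fastforce simp: distrib_right)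
  show ?thesis
    by (rule bounded_operatorI[OF T.dom.normed_subspace_axioms T.cod.normed_subspace_axioms _ bound])
       (auto simp: T.add S.add T.scaleC S.scaleC T.maps S.maps T.cod.add_mem scaleC_add_right)
qed

lemma bounded_operator_zero:
  assumes "normed_subspace V p" "normed_subspace W q"
  shows "bounded_operator V p W q (\<lambda>x. 0)"
proof -
  interpret cod: normed_subspace W q by fact
  show ?thesis
    by (rule bounded_operatorI[OF assms, where c = 0]) (auto simp: cod.zero_mem cod.nrm_zero)
qed

lemma bounded_operator_sum:
  assumes "normed_subspace V p" "normed_subspace W q"
    and "\<And>s. s \<in> S \<Longrightarrow> bounded_operator V p W q (T s)"
  shows "bounded_operator V p W q (\<lambda>x. \<Sum>s\<in>S. T s x)"
  using assms(3)
  by (induction S rule: infinite_finite_induct)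
     (auto simp: bounded_operator_zero assms(1,2) intro: bounded_operator_add)

lemma bounded_operator_id:
  assumes "normed_subspace V p"
  shows "bounded_operator V p V p id"
  by (rule bounded_operatorI[OF assms assms, where c = 1]) auto

lemma bounded_operator_uminus:
  assumes "bounded_operator V p W q T"
  shows "bounded_operator V p W q (\<lambda>x. - T x)"
proof -
  interpret bounded_operator V p W q T by fact
  obtain c where c: "\<And>x. x \<in> V \<Longrightarrow> q (T x) \<le> c * p x" using bounded by blast
  show ?thesis
    by (rule bounded_operatorI[OF dom.normed_subspace_axioms cod.normed_subspace_axioms, where c = c])
       (auto simp: maps add scaleC c cod.uminus_mem cod.nrm_uminus)
qed

lemma bounded_operator_funpow:
  assumes "bounded_operator V p V p T"
  shows "bounded_operator V p V p (T ^^ k)"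
proof (induction k)
  case 0
  interpret bounded_operator V p V p T by fact
  show ?case using bounded_operator_id[OF dom.normed_subspace_axioms] by (simp add: id_def)
next
  case (Suc k)
  then show ?case unfolding funpow.simps by (rule bounded_operator_comp[OF _ assms])
qed

section \<open>Complete spaces\<close>

context normed_subspace
begin

text \<open>Off \<open>V\<close> the value of \<open>nrm\<close> is junk, but a metric is symmetric and nonnegative everywhere.\<close>

definition dist_on :: "'a \<Rightarrow> 'a \<Rightarrow> real" where
  "dist_on x y = (if x \<in> V \<and> y \<in> V then nrm (x - y) else 0)"

sublocale metric: Metric_space V dist_on
proof
  show "dist_on x y = 0 \<longleftrightarrow> x = y" if "x \<in> V" "y \<in> V" for x y
    using that nrm_zeroD[of "x - y"] by (auto simp: dist_on_def diff_mem nrm_zero)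
  show "dist_on x z \<le> dist_on x y + dist_on y z" if "x \<in> V" "y \<in> V" "z \<in> V" for x y z
    using that nrm_add_le[of "x - y" "y - z"] by (simp add: dist_on_def diff_mem)
qed (auto simp: dist_on_def diff_mem nrm_nonneg nrm_minus_commute)

end

locale banach_subspace = normed_subspace +
  assumes complete: "(\<And>k. x k \<in> V) \<Longrightarrow> (\<And>e. 0 < e \<Longrightarrow> \<exists>M. \<forall>k\<ge>M. \<forall>l\<ge>M. nrm (x k - x l) < e) \<Longrightarrow>
    \<exists>w\<in>V. (\<lambda>k. nrm (x k - w)) \<longlonglongrightarrow> 0"
begin

lemma metric_mcomplete: "metric.mcomplete"
  unfolding metric.mcomplete_def
proof (intro allI impI)
  fix x :: "nat \<Rightarrow> 'a"
  assume Cauchy: "metric.MCauchy x"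
  then have x: "x k \<in> V" for k by (auto simp: metric.MCauchy_def)
  have "\<exists>w\<in>V. (\<lambda>k. nrm (x k - w)) \<longlonglongrightarrow> 0"
    using Cauchy x by (intro complete) (auto simp: metric.MCauchy_def dist_on_def)
  then show "\<exists>w. limitin metric.mtopology x w sequentially"
    using x by (auto simp: metric.limitin_metric_dist_null dist_on_def)
qed

lemma fixed_point_of_power_contraction:
  assumes f: "\<And>x. x \<in> V \<Longrightarrow> f x \<in> V" and "\<kappa> < 1"
    and contraction: "\<And>x y. x \<in> V \<Longrightarrow> y \<in> V \<Longrightarrow> nrm ((f ^^ k) x - (f ^^ k) y) \<le> \<kappa> * nrm (x - y)"
  shows "\<exists>x\<in>V. f x = x"
proof -
  have fk: "(f ^^ k) x \<in> V" if "x \<in> V" for x using that by (induction k) (auto simp: f)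
  obtain x where x: "x \<in> V" "(f ^^ k) x = x"
    using metric.Banach_fixedpoint_thm[OF metric_mcomplete, of "f ^^ k" \<kappa>] zero_mem \<open>\<kappa> < 1\<close> fk contraction
    by (auto simp: dist_on_def)
  \<comment> \<open>The fixed point of the contraction is unique, and \<open>f x\<close> is another one.\<close>
  have "(f ^^ k) (f x) = f x" using x by (metis funpow_swap1)
  then have "nrm (f x - x) \<le> \<kappa> * nrm (f x - x)" using contraction[of "f x" x] x f by simp
  then have "(1 - \<kappa>) * nrm (f x - x) \<le> 0" by (simp add: algebra_simps)
  then have "nrm (f x - x) = 0"
    using \<open>\<kappa> < 1\<close> nrm_nonneg[of "f x - x"] x f by (simp add: diff_mem mult_le_0_iff)
  then show ?thesis using nrm_zeroD[of "f x - x"] x f by (auto simp: diff_mem)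
qed

lemma identity_minus_surj:
  assumes "bounded_operator V nrm V nrm K" and "\<kappa> < 1"
    and contraction: "\<And>x. x \<in> V \<Longrightarrow> nrm ((K ^^ k) x) \<le> \<kappa> * nrm x" and g: "g \<in> V"
  shows "\<exists>x\<in>V. x - K x = g"
proof -
  interpret K: bounded_operator V nrm V nrm K by fact
  define f where "f x = g + K x" for x
  have f: "f x \<in> V" if "x \<in> V" for x using that g by (simp add: f_def add_mem K.maps)
  have f_pow: "(f ^^ j) x \<in> V" if "x \<in> V" for j x using that by (induction j) (auto simp: f)
  have "(f ^^ j) x - (f ^^ j) y = (K ^^ j) (x - y)" if "x \<in> V" "y \<in> V" for j x y
  proof (induction j)
    case (Suc j)
    have "(f ^^ Suc j) x - (f ^^ Suc j) y = K ((f ^^ j) x - (f ^^ j) y)"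
      using that f_pow by (simp add: f_def K.diff)
    then show ?case by (simp add: Suc.IH)
  qed simp
  then obtain x where "x \<in> V" "f x = x"
    using fixed_point_of_power_contraction[of f \<kappa> k] f \<open>\<kappa> < 1\<close> contraction diff_mem by metis
  then show ?thesis by (metis f_def add_diff_cancel_right')
qed

lemma identity_minus_bounded_below:
  assumes "bounded_operator V nrm V nrm K" and "\<kappa> < 1"
    and contraction: "\<And>x. x \<in> V \<Longrightarrow> nrm ((K ^^ k) x) \<le> \<kappa> * nrm x"
  shows "\<exists>c. \<forall>x\<in>V. nrm x \<le> c * nrm (x - K x)"
proof -
  interpret K: bounded_operator V nrm V nrm K by fact
  interpret K_pow: bounded_operator V nrm V nrm "K ^^ j" for j
    by (rule bounded_operator_funpow[OF assms(1)])
  have "\<forall>j. \<exists>c. \<forall>x\<in>V. nrm ((K ^^ j) x) \<le> c * nrm x" using K_pow.bounded by blast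
  then obtain c where c: "\<And>j x. x \<in> V \<Longrightarrow> nrm ((K ^^ j) x) \<le> c j * nrm x" by metis
  have "nrm x \<le> (\<Sum>j<k. c j) / (1 - \<kappa>) * nrm (x - K x)" if x: "x \<in> V" for x
  proof -
    have y: "x - K x \<in> V" using x by (simp add: diff_mem K.maps)
    have "(\<Sum>j<i. (K ^^ j) (x - K x)) = x - (K ^^ i) x" for i
      using x by (induction i) (auto simp: K_pow.diff K.maps funpow_swap1)
    then have "x = (\<Sum>j<k. (K ^^ j) (x - K x)) + (K ^^ k) x" by simp
    then have "nrm x \<le> nrm (\<Sum>j<k. (K ^^ j) (x - K x)) + nrm ((K ^^ k) x)"
      using nrm_add_le[OF sum_mem K_pow.maps] K_pow.maps y x by metis
    also have "nrm (\<Sum>j<k. (K ^^ j) (x - K x)) \<le> (\<Sum>j<k. c j * nrm (x - K x))"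
      by (intro order_trans[OF nrm_sum_le sum_mono] K_pow.maps c y)
    also have "\<dots> = (\<Sum>j<k. c j) * nrm (x - K x)" by (rule sum_distrib_right[symmetric])
    finally show ?thesis using contraction[OF x] \<open>\<kappa> < 1\<close> by (simp add: field_simps)
  qed
  then show ?thesis by blast
qed

end

lemma (in bounded_operator) closedin_sublevel:
  "closedin dom.metric.mtopology {x \<in> V. q (T x) \<le> c}"
  unfolding dom.metric.closedin_metric
proof (intro conjI allI impI)
  obtain b where b: "0 \<le> b" "\<And>x. x \<in> V \<Longrightarrow> q (T x) \<le> b * p x" using nonneg_bound by blast
  fix x assume "x \<in> V - {x \<in> V. q (T x) \<le> c}"
  then have x: "x \<in> V" "c < q (T x)" by auto
  let ?r = "(q (T x) - c) / (b + 1)"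
  have "c < q (T y)" if y: "y \<in> V" "p (x - y) < ?r" for y
  proof -
    have "q (T x) \<le> q (T y) + q (T (x - y))"
      using cod.nrm_le_add_diff[of "T x" "T y"] x y by (simp add: maps diff)
    moreover have "q (T (x - y)) \<le> (b + 1) * p (x - y)"
      using b(2)[of "x - y"] dom.nrm_nonneg[of "x - y"] x y by (simp add: dom.diff_mem distrib_right)
    moreover have "(b + 1) * p (x - y) < q (T x) - c" using y(2) b(1) by (simp add: field_simps)
    ultimately show ?thesis by linarith
  qed
  moreover have "0 < ?r" using x b(1) by simp
  ultimately show "\<exists>r>0. disjnt {x \<in> V. q (T x) \<le> c} (dom.metric.mball x r)"
    by (intro exI[of _ ?r]) (force simp: disjnt_iff dom.dist_on_def)
qed auto

lemma (in banach_subspace) closed_cover_contains_ball: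
  fixes F :: "nat \<Rightarrow> 'a set"
  assumes closed: "\<And>k. closedin metric.mtopology (F k)" and cover: "\<Union>(range F) = V"
  obtains k x r where "x \<in> V" "0 < r" "\<And>y. y \<in> V \<Longrightarrow> nrm y < r \<Longrightarrow> x + y \<in> F k"
proof -
  have "\<exists>k. metric.mtopology interior_of F k \<noteq> {}"
  proof (rule ccontr)
    assume "\<not> ?thesis"
    then have "metric.mtopology interior_of \<Union>(range F) = {}"
      using closed by (intro metric.metric_Baire_category_alt[OF metric_mcomplete]) auto
    then show False using zero_mem cover by (metis empty_iff interior_of_topspace metric.topspace_mtopology)
  qed
  then obtain k x r where x: "x \<in> V" "0 < r" "metric.mball x r \<subseteq> F k"
    by (auto simp: metric.in_interior_of_mball)
  have "x + y \<in> F k" if "y \<in> V" "nrm y < r" for y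
    using that x by (intro subsetD[OF x(3)]) (simp add: dist_on_def add_mem nrm_uminus)
  with x(1,2) show thesis by (rule that)
qed

lemma (in banach_subspace) uniform_boundedness:
  assumes T: "\<And>i. i \<in> I \<Longrightarrow> bounded_operator V nrm W q (T i)"
    and pointwise: "\<And>x. x \<in> V \<Longrightarrow> \<exists>c. \<forall>i\<in>I. q (T i x) \<le> c"
  shows "\<exists>c. \<forall>i\<in>I. \<forall>x\<in>V. q (T i x) \<le> c * nrm x"
proof (cases "I = {}")
  case False
  define F where "F k = (\<Inter>i\<in>I. {x \<in> V. q (T i x) \<le> real k})" for k
  have closed: "closedin metric.mtopology (F k)" for k
    unfolding F_def using False bounded_operator.closedin_sublevel[OF T] by (intro closedin_INT) auto
  have "\<exists>k. x \<in> F k" if x: "x \<in> V" for x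
  proof -
    obtain c where c: "\<forall>i\<in>I. q (T i x) \<le> c" using pointwise[OF x] by blast
    obtain k where "c \<le> real k" using real_arch_simple by blast
    then have "x \<in> F k" using c x order_trans unfolding F_def by blast
    then show ?thesis ..
  qed
  moreover have "F k \<subseteq> V" for k using False unfolding F_def by blast
  ultimately have cover: "\<Union>(range F) = V" by blast
  obtain k x0 r where x0: "x0 \<in> V" "0 < r" and ball: "\<And>y. y \<in> V \<Longrightarrow> nrm y < r \<Longrightarrow> x0 + y \<in> F k"
    by (rule closed_cover_contains_ball[OF closed cover]) iprover
  have "q (T i x) \<le> 2 * (2 * real k) / r * nrm x" if i: "i \<in> I" and x: "x \<in> V" for i x
  proof -
    interpret T: bounded_operator V nrm W q "T i" using T[OF i] .
    show ?thesis
    proof (rule T.bound_of_bound_on_ball[OF x0(2) _ x])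
      fix y assume y: "y \<in> V" "nrm y < r"
      have "q (T i (x0 + y)) \<le> real k" "q (T i x0) \<le> real k"
        using ball[OF y] ball[of 0] zero_mem x0(2) i by (auto simp: F_def nrm_zero)
      then show "q (T i y) \<le> 2 * real k"
        using T.cod.nrm_diff_le[of "T i (x0 + y)" "T i x0"] T.add[OF x0(1) y(1)]
          T.maps[OF x0(1)] T.maps[OF add_mem[OF x0(1) y(1)]] by simp
    qed
  qed
  then show ?thesis by blast
qed simp

lemma filterlim_at_right_of_inverse_bound:
  assumes "\<And>k. \<eta> k \<in> {a<..<a + 1 / real (Suc k)}"
  shows "filterlim \<eta> (at_right a) sequentially"
proof -
  have "\<eta> \<longlonglongrightarrow> a"
  proof (rule tendsto_sandwich[OF _ _ tendsto_const])
    show "(\<lambda>k. a + 1 / real (Suc k)) \<longlonglongrightarrow> a"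
      using tendsto_add[OF tendsto_const LIMSEQ_Suc[OF lim_1_over_n], of a] by simp
  qed (use assms in \<open>auto intro!: always_eventually simp: less_imp_le\<close>)
  then show ?thesis using assms by (auto simp: filterlim_at intro!: always_eventually)
qed

lemma bounded_of_eventually_bounded:
  fixes f :: "nat \<Rightarrow> 'a::linorder"
  assumes "\<forall>\<^sub>F k in sequentially. f k \<le> c"
  shows "\<exists>c. \<forall>k. f k \<le> c"
proof -
  obtain K where K: "\<And>k. K \<le> k \<Longrightarrow> f k \<le> c" using assms by (auto simp: eventually_sequentially)
  have "f k \<le> Max (insert c (f ` {..<K}))" for k
    using K[of k] by (cases "k < K") (auto simp: Max_ge_iff)
  then show ?thesis by blast
qed

lemma (in banach_subspace) eventually_uniformly_bounded:
  fixes T :: "real \<Rightarrow> 'a \<Rightarrow> 'b::complex_vector"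
  assumes T: "\<forall>\<^sub>F \<epsilon> in at_right a. bounded_operator V nrm W q (T \<epsilon>)"
    and pointwise: "\<And>x. x \<in> V \<Longrightarrow> \<exists>c. \<forall>\<^sub>F \<epsilon> in at_right a. q (T \<epsilon> x) \<le> c"
  shows "\<exists>c. \<forall>\<^sub>F \<epsilon> in at_right a. \<forall>x\<in>V. q (T \<epsilon> x) \<le> c * nrm x"
proof (rule ccontr)
  assume unbounded: "\<not> ?thesis"
  have "\<exists>\<epsilon>. \<epsilon> \<in> {a<..<a + 1 / real (Suc k)} \<and> bounded_operator V nrm W q (T \<epsilon>) \<and>
      (\<exists>x\<in>V. real k * nrm x < q (T \<epsilon> x))" for k
  proof -
    have "\<exists>\<^sub>F \<epsilon> in at_right a. \<exists>x\<in>V. real k * nrm x < q (T \<epsilon> x)"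
      using unbounded by (auto simp: frequently_def not_less)
    moreover have "\<forall>\<^sub>F \<epsilon> in at_right a. \<epsilon> \<in> {a<..<a + 1 / real (Suc k)}"
      by (intro eventually_at_right_real) simp
    ultimately have "\<exists>\<^sub>F \<epsilon> in at_right a.
        (\<epsilon> \<in> {a<..<a + 1 / real (Suc k)} \<and> bounded_operator V nrm W q (T \<epsilon>)) \<and>
        (\<exists>x\<in>V. real k * nrm x < q (T \<epsilon> x))"
      by (intro frequently_eventually_conj[OF _ eventually_conj[OF _ T]])
    then show ?thesis using frequently_ex by fast
  qed
  then obtain \<eta> x where \<eta>: "\<And>k. \<eta> k \<in> {a<..<a + 1 / real (Suc k)}" "\<And>k. bounded_operator V nrm W q (T (\<eta> k))"
    and x: "\<And>k. x k \<in> V" "\<And>k. real k * nrm (x k) < q (T (\<eta> k) (x k))" by metis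
  note \<eta>_lim = filterlim_at_right_of_inverse_bound[OF \<eta>(1)]
  have "\<exists>c. \<forall>k\<in>UNIV. \<forall>x\<in>V. q (T (\<eta> k) x) \<le> c * nrm x"
    using \<eta>(2)
  proof (rule uniform_boundedness)
    fix x assume "x \<in> V"
    then obtain c where "\<forall>\<^sub>F k in sequentially. q (T (\<eta> k) x) \<le> c"
      using pointwise eventually_compose_filterlim[OF _ \<eta>_lim] by blast
    then show "\<exists>c. \<forall>k\<in>UNIV. q (T (\<eta> k) x) \<le> c" using bounded_of_eventually_bounded by simp
  qed
  then obtain c where c: "\<And>k x. x \<in> V \<Longrightarrow> q (T (\<eta> k) x) \<le> c * nrm x" by auto
  obtain k where "c \<le> real k" using real_arch_simple by blast
  then have "c * nrm (x k) \<le> real k * nrm (x k)" using nrm_nonneg[OF x(1)] by (rule mult_right_mono)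
  then show False using x(2)[of k] c[OF x(1), of k k] by linarith
qed

section \<open>Tuples and systems of linear equations\<close>

definition tuples :: "nat \<Rightarrow> 'a::zero set \<Rightarrow> (nat \<Rightarrow> 'a) set" where
  "tuples m V = {y. (\<forall>i<m. y i \<in> V) \<and> (\<forall>i\<ge>m. y i = 0)}"

definition tuple_norm :: "nat \<Rightarrow> ('a \<Rightarrow> real) \<Rightarrow> (nat \<Rightarrow> 'a) \<Rightarrow> real" where
  "tuple_norm m p y = (\<Sum>i<m. p (y i))"

lemma tuplesI: "(\<And>i. i < m \<Longrightarrow> y i \<in> V) \<Longrightarrow> (\<And>i. m \<le> i \<Longrightarrow> y i = 0) \<Longrightarrow> y \<in> tuples m V"
  by (simp add: tuples_def)

lemma tuples_beyond: "y \<in> tuples m V \<Longrightarrow> m \<le> i \<Longrightarrow> y i = 0"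
  by (simp add: tuples_def)

context normed_subspace
begin

lemma tuples_component: "y \<in> tuples m V \<Longrightarrow> y i \<in> V"
  by (cases "i < m") (auto simp: tuples_def zero_mem)

lemma nrm_component_le:
  assumes "y \<in> tuples m V"
  shows "nrm (y i) \<le> tuple_norm m nrm y"
proof -
  have "0 \<le> nrm (y j)" for j using assms by (intro nrm_nonneg tuples_component)
  then show ?thesis unfolding tuple_norm_def
    using member_le_sum[of i "{..<m}" "\<lambda>i. nrm (y i)"] tuples_beyond[OF assms, of i]
    by (cases "i < m") (auto simp: nrm_zero intro: sum_nonneg)
qed

lemma normed_subspace_tuples: "normed_subspace (tuples m V) (tuple_norm m nrm)"
proof
  fix x y :: "nat \<Rightarrow> 'a" and c
  assume x: "x \<in> tuples m V"
  show "c *\<^sub>C x \<in> tuples m V" using x by (simp add: tuples_def scaleC_mem)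
  show "tuple_norm m nrm (c *\<^sub>C x) \<le> cmod c * tuple_norm m nrm x"
    using x by (simp add: tuple_norm_def nrm_scaleC tuples_component sum_distrib_left)
  show "x = 0" if "tuple_norm m nrm x = 0"
  proof
    show "x i = 0 i" for i
      using nrm_component_le[OF x, of i] nrm_nonneg[OF tuples_component[OF x]] that
      by (auto intro: nrm_zeroD tuples_component[OF x] antisym)
  qed
  assume y: "y \<in> tuples m V"
  show "x + y \<in> tuples m V" using x y by (simp add: tuples_def add_mem)
  show "tuple_norm m nrm (x + y) \<le> tuple_norm m nrm x + tuple_norm m nrm y"
    unfolding tuple_norm_def sum.distrib[symmetric] plus_fun_apply
    using x y by (intro sum_mono nrm_add_le tuples_component)
qed (simp add: tuples_def zero_mem)

end

lemma (in banach_subspace) banach_subspace_tuples: "banach_subspace (tuples m V) (tuple_norm m nrm)"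
proof -
  interpret tuples: normed_subspace "tuples m V" "tuple_norm m nrm" by (rule normed_subspace_tuples)
  show ?thesis
  proof
    fix x :: "nat \<Rightarrow> nat \<Rightarrow> 'a"
    assume x: "\<And>k. x k \<in> tuples m V"
      and Cauchy: "\<And>e. 0 < e \<Longrightarrow> \<exists>M. \<forall>k\<ge>M. \<forall>l\<ge>M. tuple_norm m nrm (x k - x l) < e"
    have "\<exists>w\<in>V. (\<lambda>k. nrm (x k i - w)) \<longlonglongrightarrow> 0" for i
    proof (rule complete)
      show "x k i \<in> V" for k using x by (rule tuples_component)
      have le: "nrm (x k i - x l i) \<le> tuple_norm m nrm (x k - x l)" for k l
        using nrm_component_le[OF tuples.diff_mem[OF x x], of k l i] by simp
      show "\<exists>M. \<forall>k\<ge>M. \<forall>l\<ge>M. nrm (x k i - x l i) < e" if "0 < e" for e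
        using Cauchy[OF that] le_less_trans[OF le] by blast
    qed
    then obtain w where w: "\<And>i. w i \<in> V" "\<And>i. (\<lambda>k. nrm (x k i - w i)) \<longlonglongrightarrow> 0" by metis
    define w' where "w' i = (if i < m then w i else 0)" for i
    have "w' \<in> tuples m V" using w by (simp add: tuples_def w'_def)
    moreover have "(\<lambda>k. tuple_norm m nrm (x k - w')) \<longlonglongrightarrow> (\<Sum>i<m. 0)"
      unfolding tuple_norm_def by (intro tendsto_sum) (use w in \<open>auto simp: w'_def\<close>)
    ultimately show "\<exists>w\<in>tuples m V. (\<lambda>k. tuple_norm m nrm (x k - w)) \<longlonglongrightarrow> 0" by auto
  qed
qed

lemma bounded_operator_tuples:
  assumes "bounded_operator V p W q T"
  shows "bounded_operator (tuples m V) (tuple_norm m p) (tuples m W) (tuple_norm m q) ((\<circ>) T)"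
proof -
  interpret bounded_operator V p W q T by fact
  obtain c where c: "\<And>x. x \<in> V \<Longrightarrow> q (T x) \<le> c * p x" using bounded by blast
  note component = dom.tuples_component
  show ?thesis
  proof (rule bounded_operatorI[OF dom.normed_subspace_tuples cod.normed_subspace_tuples])
    show "tuple_norm m q (T \<circ> y) \<le> c * tuple_norm m p y" if "y \<in> tuples m V" for y
      unfolding tuple_norm_def sum_distrib_left o_apply using that by (intro sum_mono c component)
  qed (auto simp: tuples_def zero maps fun_eq_iff add[OF component component] scaleC[OF component])
qed

interpretation complex_plane: normed_subspace UNIV cmod
  by standard (auto simp: scaleC_complex_def norm_triangle_ineq norm_mult)

lemma cvec_eq_tuples: "cvec N = tuples N UNIV"
  by (simp add: cvec_def tuples_def)

lemma cnorm_eq_tuple_norm: "cnorm N = tuple_norm N cmod"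
  by (simp add: cnorm_def tuple_norm_def fun_eq_iff)

interpretation cvec: normed_subspace "cvec N" "cnorm N"
  unfolding cvec_eq_tuples cnorm_eq_tuple_norm by (rule complex_plane.normed_subspace_tuples)

definition std_basis :: "nat \<Rightarrow> nat \<Rightarrow> complex" where
  "std_basis s = (\<lambda>i. if i = s then 1 else 0)"

lemma std_basis_mem: "s < N \<Longrightarrow> std_basis s \<in> cvec N"
  by (simp add: std_basis_def cvec_def)

definition lincomb :: "nat \<Rightarrow> (nat \<Rightarrow> 'a::complex_vector) \<Rightarrow> (nat \<Rightarrow> complex) \<Rightarrow> 'a" where
  "lincomb N P c = (\<Sum>s<N. c s *\<^sub>C P s)"

lemma lincomb_std_basis: "c \<in> cvec N \<Longrightarrow> lincomb N std_basis c = c"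
  by (auto simp: lincomb_def fun_eq_iff sum_fun_apply scaleC_complex_def std_basis_def cvec_def
      if_distrib[of "\<lambda>x. _ * x"] cong: if_cong)

lemma lincomb_cong: "(\<And>s. s < N \<Longrightarrow> P s = Q s) \<Longrightarrow> lincomb N P c = lincomb N Q c"
  by (simp add: lincomb_def)

lemma lincomb_zero: "lincomb N (\<lambda>s. 0) c = 0"
  by (simp add: lincomb_def)

lemma lincomb_diff: "lincomb N P c - lincomb N Q c = lincomb N (\<lambda>s. P s - Q s) c"
  by (simp add: lincomb_def complex_vector.scale_right_diff_distrib sum_subtractf)

lemma (in linear_operator) lincomb:
  "(\<And>s. s < N \<Longrightarrow> P s \<in> V) \<Longrightarrow> T (lincomb N P c) = lincomb N (\<lambda>s. T (P s)) c"
  unfolding lincomb_def by (subst sum) (auto simp: scaleC dom.scaleC_mem)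

lemma (in normed_subspace) lincomb_mem: "(\<And>s. s < N \<Longrightarrow> P s \<in> V) \<Longrightarrow> lincomb N P c \<in> V"
  unfolding lincomb_def by (intro sum_mem scaleC_mem) auto

lemma (in normed_subspace) nrm_lincomb_le:
  assumes P: "\<And>s. s < N \<Longrightarrow> P s \<in> V" and c: "c \<in> cvec N"
  shows "nrm (lincomb N P c) \<le> cnorm N c * (\<Sum>s<N. nrm (P s))"
proof -
  have "nrm (lincomb N P c) \<le> (\<Sum>s<N. nrm (c s *\<^sub>C P s))"
    unfolding lincomb_def by (intro nrm_sum_le scaleC_mem P) auto
  also have "\<dots> = (\<Sum>s<N. cmod (c s) * nrm (P s))" using P by (simp add: nrm_scaleC)
  also have "\<dots> \<le> (\<Sum>s<N. cnorm N c * nrm (P s))"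
    using P c complex_plane.nrm_component_le[of c N]
    by (intro sum_mono mult_right_mono nrm_nonneg) (auto simp: cvec_eq_tuples cnorm_eq_tuple_norm)
  finally show ?thesis by (simp add: sum_distrib_left)
qed

lemma (in normed_subspace) bounded_operator_lincomb:
  assumes P: "\<And>s. s < N \<Longrightarrow> P s \<in> V"
  shows "bounded_operator (cvec N) (cnorm N) V nrm (lincomb N P)"
proof (rule bounded_operatorI[OF cvec.normed_subspace_axioms normed_subspace_axioms])
  show "nrm (lincomb N P c) \<le> (\<Sum>s<N. nrm (P s)) * cnorm N c" if "c \<in> cvec N" for c
    using nrm_lincomb_le[OF P that] by (simp add: mult.commute)
qed (simp_all add: P lincomb_mem, simp_all add: lincomb_def scaleC_complex_def scaleC_add_left sum.distrib
    complex_vector.scale_sum_right)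

lemma lincomb_near_std_basis_bounded_below:
  assumes P: "\<And>s. s < N \<Longrightarrow> P s \<in> cvec N" and c: "c \<in> cvec N"
    and near: "(\<Sum>s<N. cnorm N (P s - std_basis s)) \<le> 1 / 2"
  shows "cnorm N c \<le> 2 * cnorm N (lincomb N P c)"
proof -
  have "cnorm N c \<le> cnorm N (lincomb N P c) + cnorm N (c - lincomb N P c)"
    using cvec.nrm_le_add_diff[OF c cvec.lincomb_mem[OF P]] .
  also have "c - lincomb N P c = lincomb N (\<lambda>s. std_basis s - P s) c"
    using lincomb_std_basis[OF c] lincomb_diff[of N std_basis c P] by simp
  also have "cnorm N (lincomb N (\<lambda>s. std_basis s - P s) c) \<le> cnorm N c * (\<Sum>s<N. cnorm N (std_basis s - P s))"
    by (intro cvec.nrm_lincomb_le cvec.diff_mem std_basis_mem P c)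
  also have "(\<Sum>s<N. cnorm N (std_basis s - P s)) = (\<Sum>s<N. cnorm N (P s - std_basis s))"
    by (intro sum.cong cvec.nrm_minus_commute std_basis_mem P) auto
  also have "cnorm N c * \<dots> \<le> cnorm N c * (1 / 2)" by (intro mult_left_mono near cvec.nrm_nonneg c)
  finally show ?thesis by simp
qed

lemma injective_cvec_endomorphism_surj:
  assumes "linear_operator (cvec N) (cnorm N) (cvec N) (cnorm N) T"
    and inj: "\<And>x. x \<in> cvec N \<Longrightarrow> T x = 0 \<Longrightarrow> x = 0" and c: "c \<in> cvec N"
  shows "\<exists>x\<in>cvec N. T x = c"
proof -
  interpret T: linear_operator "cvec N" "cnorm N" "cvec N" "cnorm N" T by fact
  define A where "A = Matrix.mat N N (\<lambda>(i, s). T (std_basis s) i)"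
  define to_cvec where "to_cvec w = (\<lambda>s. if s < N then vec_index w s else 0)" for w :: "complex Matrix.vec"
  have A: "A \<in> carrier_mat N N" by (simp add: A_def)
  have to_cvec: "to_cvec w \<in> cvec N" for w by (simp add: to_cvec_def cvec_def)
  have T_to_cvec: "T (to_cvec w) = to_cvec (A *\<^sub>v w)" if w: "w \<in> carrier_vec N" for w
  proof
    fix i
    have "T (to_cvec w) = lincomb N (\<lambda>s. T (std_basis s)) (to_cvec w)"
      using T.lincomb[of N std_basis "to_cvec w"] std_basis_mem by (simp add: lincomb_std_basis[OF to_cvec])
    moreover have "T (to_cvec w) i = 0" if "N \<le> i" using T.maps[OF to_cvec] that by (simp add: cvec_def)
    ultimately show "T (to_cvec w) i = to_cvec (A *\<^sub>v w) i"
      using w by (cases "i < N")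
        (auto simp: lincomb_def to_cvec_def A_def sum_fun_apply scaleC_complex_def scalar_prod_def
          mult.commute lessThan_atLeast0)
  qed
  have "Determinant.det A \<noteq> 0"
  proof
    assume "Determinant.det A = 0"
    then obtain w where w: "w \<in> carrier_vec N" "w \<noteq> 0\<^sub>v N" "A *\<^sub>v w = 0\<^sub>v N"
      using det_0_iff_vec_prod_zero_field[OF A] by blast
    then have "T (to_cvec w) = 0" by (auto simp: T_to_cvec) (auto simp: to_cvec_def fun_eq_iff)
    then have "to_cvec w = 0" by (rule inj[OF to_cvec])
    from fun_cong[OF this] have "vec_index w i = 0" if "i < N" for i
      using that unfolding to_cvec_def by (metis zero_fun_apply)
    then have "w = 0\<^sub>v N" using w(1) by (intro eq_vecI) auto
    then show False using w(2) by simp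
  qed
  then obtain A' where A': "A' \<in> carrier_mat N N" "A * A' = 1\<^sub>m N"
    using det_non_zero_imp_unit[OF A] by (auto simp: Units_def ring_mat_def)
  define w where "w = A' *\<^sub>v Matrix.vec N c"
  have "A *\<^sub>v w = Matrix.vec N c"
    using A A' by (simp add: w_def assoc_mult_mat_vec[symmetric, of _ N N _ N])
  then have "T (to_cvec w) = c"
    using A' c by (subst T_to_cvec) (auto simp: w_def to_cvec_def cvec_def fun_eq_iff)
  then show ?thesis using to_cvec by blast
qed

section \<open>Boundary-value problems for operators with a solvable initial-value problem\<close>

text \<open>\<open>\<Lambda>\<close> assigns to a function its initial data.\<close>

locale initial_value_operator = L: bounded_operator V p W q L +
    \<Lambda>: linear_operator V p "cvec N" "cnorm N" \<Lambda>
  for V :: "'a::complex_vector set" and p and W :: "'b::complex_vector set" and q and L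
    and N :: nat and \<Lambda> :: "'a \<Rightarrow> nat \<Rightarrow> complex" +
  fixes z :: "nat \<Rightarrow> 'a"
  assumes z_mem: "s < N \<Longrightarrow> z s \<in> V"
    and initial_data_z: "s < N \<Longrightarrow> \<Lambda> (z s) = std_basis s"
    and zero_data_solvable: "f \<in> W \<Longrightarrow> \<exists>u\<in>V. L u = f \<and> \<Lambda> u = 0"
    and zero_data_stable: "\<exists>c. \<forall>u\<in>V. \<Lambda> u = 0 \<longrightarrow> p u \<le> c * q (L u)"
begin

lemma zero_data_nonneg_bound:
  obtains c where "0 \<le> c" "\<And>u. u \<in> V \<Longrightarrow> \<Lambda> u = 0 \<Longrightarrow> p u \<le> c * q (L u)"
proof -
  obtain c where c: "\<And>u. u \<in> V \<Longrightarrow> \<Lambda> u = 0 \<Longrightarrow> p u \<le> c * q (L u)" using zero_data_stable by blast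
  show thesis
  proof
    show "p u \<le> \<bar>c\<bar> * q (L u)" if "u \<in> V" "\<Lambda> u = 0" for u
      using c[OF that] mult_right_mono[OF abs_ge_self L.cod.nrm_nonneg[OF L.maps[OF that(1)]], of c]
      by linarith
  qed simp
qed

lemma fundamental_system:
  obtains P where "\<And>s. s < N \<Longrightarrow> P s \<in> V" "\<And>s. s < N \<Longrightarrow> L (P s) = 0" "\<And>s. s < N \<Longrightarrow> \<Lambda> (P s) = std_basis s"
proof -
  have "\<exists>y\<in>V. L y = 0 \<and> \<Lambda> y = std_basis s" if s: "s < N" for s
  proof -
    obtain u where "u \<in> V" "L u = L (z s)" "\<Lambda> u = 0"
      using zero_data_solvable[OF L.maps[OF z_mem[OF s]]] by blast
    then show ?thesis
      using z_mem[OF s] initial_data_z[OF s]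
      by (intro bexI[of _ "z s - u"]) (auto simp: L.diff \<Lambda>.diff L.dom.diff_mem)
  qed
  then show thesis using that by metis
qed

theorem fredholm_alternative:
  assumes B: "bounded_operator V p (cvec N) (cnorm N) B"
    and trivial_kernel: "\<And>y. y \<in> V \<Longrightarrow> L y = 0 \<Longrightarrow> B y = 0 \<Longrightarrow> y = 0"
    and f: "f \<in> W" and c: "c \<in> cvec N"
  shows "\<exists>!y. y \<in> V \<and> L y = f \<and> B y = c"
proof (rule ex_ex1I)
  interpret B: bounded_operator V p "cvec N" "cnorm N" B by fact
  obtain P where P: "\<And>s. s < N \<Longrightarrow> P s \<in> V" "\<And>s. s < N \<Longrightarrow> L (P s) = 0" "\<And>s. s < N \<Longrightarrow> \<Lambda> (P s) = std_basis s"
    using fundamental_system by blast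
  have lincomb_mem: "lincomb N P d \<in> V" for d by (intro L.dom.lincomb_mem P)
  have L_lincomb: "L (lincomb N P d) = 0" for d
    using P lincomb_cong[of N "\<lambda>s. L (P s)" "\<lambda>s. 0"] by (simp add: L.lincomb lincomb_zero)
  have \<Lambda>_lincomb: "\<Lambda> (lincomb N P d) = d" if "d \<in> cvec N" for d
    using P lincomb_std_basis[OF that] lincomb_cong[of N "\<lambda>s. \<Lambda> (P s)" std_basis] by (simp add: \<Lambda>.lincomb)
  interpret boundary: bounded_operator "cvec N" "cnorm N" "cvec N" "cnorm N" "B \<circ> lincomb N P"
    by (rule bounded_operator_comp[OF L.dom.bounded_operator_lincomb B]) (rule P)
  obtain u where u: "u \<in> V" "L u = f" "\<Lambda> u = 0" using zero_data_solvable[OF f] by blast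
  have "\<exists>d\<in>cvec N. (B \<circ> lincomb N P) d = c - B u"
  proof (rule injective_cvec_endomorphism_surj[OF boundary.linear_operator_axioms])
    show "d = 0" if d: "d \<in> cvec N" "(B \<circ> lincomb N P) d = 0" for d
      using trivial_kernel[OF lincomb_mem L_lincomb, of d] \<Lambda>_lincomb[OF d(1)] d(2) \<Lambda>.zero by simp
  qed (intro cvec.diff_mem c B.maps u)
  then obtain d where "B (lincomb N P d) = c - B u" by auto
  then show "\<exists>y. y \<in> V \<and> L y = f \<and> B y = c"
    using u lincomb_mem[of d] L_lincomb[of d]
    by (intro exI[of _ "u + lincomb N P d"]) (simp add: L.dom.add_mem L.add B.add)
  fix y y' assume "y \<in> V \<and> L y = f \<and> B y = c" "y' \<in> V \<and> L y' = f \<and> B y' = c"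
  then show "y = y'" using trivial_kernel[of "y - y'"] by (simp add: L.diff B.diff L.dom.diff_mem)
qed

end

lemma tendsto_zero_by_absorption:
  fixes f g h :: "'c \<Rightarrow> real"
  assumes le: "\<forall>\<^sub>F x in F. 0 \<le> f x \<and> f x \<le> g x + h x * f x"
    and g: "(g \<longlongrightarrow> 0) F" and h: "(h \<longlongrightarrow> 0) F"
  shows "(f \<longlongrightarrow> 0) F"
proof (rule Lim_null_comparison)
  show "((\<lambda>x. 2 * g x) \<longlongrightarrow> 0) F" using tendsto_mult_right_zero[OF g] .
  have "\<forall>\<^sub>F x in F. h x < 1 / 2" using order_tendstoD(2)[OF h, of "1 / 2"] by simp
  then show "\<forall>\<^sub>F x in F. norm (f x) \<le> 2 * g x"
    using le
  proof eventually_elim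
    case (elim x)
    then have "h x * f x \<le> 1 / 2 * f x" by (intro mult_right_mono) auto
    then show ?case using elim by simp
  qed
qed

text \<open>In the application \<open>\<delta> \<epsilon>\<close> is, up to a constant factor, the distance of the coefficients of \<open>L \<epsilon>\<close>
  from those of \<open>L 0\<close>, and the last assumption says that they can be read off the functions \<open>z\<close>.\<close>

locale parametric_boundary_problem = V: banach_subspace V p + W: normed_subspace W q
  for V :: "'a::complex_vector set" and p and W :: "'b::complex_vector set" and q +
  fixes \<epsilon>0 :: real and N :: nat and L :: "real \<Rightarrow> 'a \<Rightarrow> 'b" and B :: "real \<Rightarrow> 'a \<Rightarrow> nat \<Rightarrow> complex"
    and \<Lambda> :: "'a \<Rightarrow> nat \<Rightarrow> complex" and z :: "nat \<Rightarrow> 'a" and \<delta> :: "real \<Rightarrow> real"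
  assumes \<epsilon>0_pos: "0 < \<epsilon>0"
    and initial_value: "\<epsilon> \<in> {0..<\<epsilon>0} \<Longrightarrow> initial_value_operator V p W q (L \<epsilon>) N \<Lambda> z"
    and boundary: "\<epsilon> \<in> {0..<\<epsilon>0} \<Longrightarrow> bounded_operator V p (cvec N) (cnorm N) (B \<epsilon>)"
    and \<delta>_nonneg: "\<epsilon> \<in> {0..<\<epsilon>0} \<Longrightarrow> 0 \<le> \<delta> \<epsilon>"
    and L_perturbation: "\<epsilon> \<in> {0..<\<epsilon>0} \<Longrightarrow> y \<in> V \<Longrightarrow> q (L \<epsilon> y - L 0 y) \<le> \<delta> \<epsilon> * p y"
    and \<delta>_le_test_functions: "\<exists>c. \<forall>\<epsilon>\<in>{0..<\<epsilon>0}. \<delta> \<epsilon> \<le> c * (\<Sum>s<N. q (L \<epsilon> (z s) - L 0 (z s)))"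
begin

abbreviation "solves \<epsilon> f c y \<equiv> y \<in> V \<and> L \<epsilon> y = f \<and> B \<epsilon> y = c"

definition trivial_kernel :: "real \<Rightarrow> bool" where
  "trivial_kernel \<epsilon> \<longleftrightarrow> (\<forall>y\<in>V. L \<epsilon> y = 0 \<and> B \<epsilon> y = 0 \<longrightarrow> y = 0)"

lemma trivial_kernelD: "trivial_kernel \<epsilon> \<Longrightarrow> y \<in> V \<Longrightarrow> L \<epsilon> y = 0 \<Longrightarrow> B \<epsilon> y = 0 \<Longrightarrow> y = 0"
  by (simp add: trivial_kernel_def)

definition uniquely_solvable :: "real \<Rightarrow> bool" where
  "uniquely_solvable \<epsilon> \<longleftrightarrow> (\<forall>f\<in>W. \<forall>c\<in>cvec N. \<exists>!y. solves \<epsilon> f c y)"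

definition boundary_strongly_continuous :: bool where
  "boundary_strongly_continuous \<longleftrightarrow> (\<forall>y\<in>V. ((\<lambda>\<epsilon>. cnorm N (B \<epsilon> y - B 0 y)) \<longlongrightarrow> 0) (at_right 0))"

definition continuous_dependence :: bool where
  "continuous_dependence \<longleftrightarrow> (\<exists>\<epsilon>1. 0 < \<epsilon>1 \<and> \<epsilon>1 < \<epsilon>0 \<and> (\<forall>\<epsilon>\<in>{0..<\<epsilon>1}. uniquely_solvable \<epsilon>) \<and>
    (\<forall>f c y. (\<forall>\<epsilon>\<in>{0..<\<epsilon>1}. f \<epsilon> \<in> W \<and> c \<epsilon> \<in> cvec N \<and> solves \<epsilon> (f \<epsilon>) (c \<epsilon>) (y \<epsilon>)) \<longrightarrow>
       ((\<lambda>\<epsilon>. q (f \<epsilon> - f 0)) \<longlongrightarrow> 0) (at_right 0) \<longrightarrow>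
       ((\<lambda>\<epsilon>. cnorm N (c \<epsilon> - c 0)) \<longlongrightarrow> 0) (at_right 0) \<longrightarrow>
       ((\<lambda>\<epsilon>. p (y \<epsilon> - y 0)) \<longlongrightarrow> 0) (at_right 0)))"

lemma zero_admissible: "0 \<in> {0..<\<epsilon>0}"
  using \<epsilon>0_pos by simp

lemma eventually_admissible: "\<forall>\<^sub>F \<epsilon> in at_right 0. \<epsilon> \<in> {0..<\<epsilon>0}"
  using eventually_at_right_real[OF \<epsilon>0_pos] by eventually_elim auto

lemma L_operator: "\<epsilon> \<in> {0..<\<epsilon>0} \<Longrightarrow> bounded_operator V p W q (L \<epsilon>)"
  using initial_value by (simp add: initial_value_operator_def)

lemma L_mem: "\<epsilon> \<in> {0..<\<epsilon>0} \<Longrightarrow> y \<in> V \<Longrightarrow> L \<epsilon> y \<in> W"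
  by (rule linear_operator.maps[OF bounded_operator.axioms(1)[OF L_operator]])

lemma B_mem: "\<epsilon> \<in> {0..<\<epsilon>0} \<Longrightarrow> y \<in> V \<Longrightarrow> B \<epsilon> y \<in> cvec N"
  by (rule linear_operator.maps[OF bounded_operator.axioms(1)[OF boundary]])

lemma uniquely_solvable_iff:
  assumes \<epsilon>: "\<epsilon> \<in> {0..<\<epsilon>0}"
  shows "uniquely_solvable \<epsilon> \<longleftrightarrow> trivial_kernel \<epsilon>"
proof
  interpret L: bounded_operator V p W q "L \<epsilon>" by (rule L_operator[OF \<epsilon>])
  interpret B: bounded_operator V p "cvec N" "cnorm N" "B \<epsilon>" by (rule boundary[OF \<epsilon>])
  show "trivial_kernel \<epsilon>" if "uniquely_solvable \<epsilon>"
  proof -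
    have "\<exists>!y. solves \<epsilon> 0 0 y"
      using that W.zero_mem cvec.zero_mem by (simp add: uniquely_solvable_def)
    then show ?thesis using V.zero_mem L.zero B.zero unfolding trivial_kernel_def by metis
  qed
  show "uniquely_solvable \<epsilon>" if "trivial_kernel \<epsilon>"
    using initial_value_operator.fredholm_alternative[OF initial_value[OF \<epsilon>] boundary[OF \<epsilon>]] that
    by (simp add: uniquely_solvable_def trivial_kernel_def)
qed

lemma boundary_tendsto:
  "boundary_strongly_continuous \<Longrightarrow> y \<in> V \<Longrightarrow> ((\<lambda>\<epsilon>. cnorm N (B \<epsilon> y - B 0 y)) \<longlongrightarrow> 0) (at_right 0)"
  by (simp add: boundary_strongly_continuous_def)

lemma boundary_uniformly_bounded:
  assumes "boundary_strongly_continuous"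
  obtains \<beta> where "0 \<le> \<beta>" "\<forall>\<^sub>F \<epsilon> in at_right 0. \<forall>y\<in>V. cnorm N (B \<epsilon> y) \<le> \<beta> * p y"
proof -
  have "\<exists>c. \<forall>\<^sub>F \<epsilon> in at_right 0. \<forall>y\<in>V. cnorm N (B \<epsilon> y) \<le> c * p y"
  proof (rule V.eventually_uniformly_bounded[where W = "cvec N"])
    show "\<forall>\<^sub>F \<epsilon> in at_right 0. bounded_operator V p (cvec N) (cnorm N) (B \<epsilon>)"
      using eventually_admissible by eventually_elim (rule boundary)
    fix y assume y: "y \<in> V"
    have "\<forall>\<^sub>F \<epsilon> in at_right 0. cnorm N (B \<epsilon> y - B 0 y) < 1"
      by (rule order_tendstoD[OF boundary_tendsto[OF assms y]]) simp
    then have "\<forall>\<^sub>F \<epsilon> in at_right 0. cnorm N (B \<epsilon> y) \<le> cnorm N (B 0 y) + 1"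
      using eventually_admissible
    proof eventually_elim
      case (elim \<epsilon>)
      then show ?case
        using cvec.nrm_le_add_diff[OF B_mem[OF elim(2) y] B_mem[OF zero_admissible y]] by linarith
    qed
    then show "\<exists>c. \<forall>\<^sub>F \<epsilon> in at_right 0. cnorm N (B \<epsilon> y) \<le> c" ..
  qed
  then obtain c where c: "\<forall>\<^sub>F \<epsilon> in at_right 0. \<forall>y\<in>V. cnorm N (B \<epsilon> y) \<le> c * p y" ..
  have "c * p y \<le> \<bar>c\<bar> * p y" if "y \<in> V" for y
    by (intro mult_right_mono V.nrm_nonneg that) simp
  then have "\<forall>\<^sub>F \<epsilon> in at_right 0. \<forall>y\<in>V. cnorm N (B \<epsilon> y) \<le> \<bar>c\<bar> * p y"
    using c by (auto elim!: eventually_mono intro: order_trans)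
  then show thesis using that[of "\<bar>c\<bar>"] by simp
qed

lemma L_tendsto:
  assumes \<delta>: "(\<delta> \<longlongrightarrow> 0) (at_right 0)" and y: "y \<in> V"
  shows "((\<lambda>\<epsilon>. q (L \<epsilon> y - L 0 y)) \<longlongrightarrow> 0) (at_right 0)"
proof (rule Lim_null_comparison)
  show "((\<lambda>\<epsilon>. \<delta> \<epsilon> * p y) \<longlongrightarrow> 0) (at_right 0)" by (rule tendsto_mult_left_zero[OF \<delta>])
  show "\<forall>\<^sub>F \<epsilon> in at_right 0. norm (q (L \<epsilon> y - L 0 y)) \<le> \<delta> \<epsilon> * p y"
    using eventually_admissible
    by eventually_elim
      (use L_perturbation L_mem[OF _ y] L_mem[OF zero_admissible y] W.nrm_nonneg W.diff_mem y in simp)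
qed

definition dual_system :: "real \<Rightarrow> (nat \<Rightarrow> 'a) \<Rightarrow> bool" where
  "dual_system \<epsilon> Z \<longleftrightarrow> (\<forall>s<N. solves \<epsilon> 0 (std_basis s) (Z s))"

lemma dual_systemD:
  assumes "dual_system \<epsilon> Z" "s < N"
  shows "Z s \<in> V" "L \<epsilon> (Z s) = 0" "B \<epsilon> (Z s) = std_basis s"
  using assms by (auto simp: dual_system_def)

lemma dual_system_exists:
  assumes "\<epsilon> \<in> {0..<\<epsilon>0}" "trivial_kernel \<epsilon>"
  obtains Z where "dual_system \<epsilon> Z"
proof -
  have "uniquely_solvable \<epsilon>" using assms by (simp add: uniquely_solvable_iff)
  then have "\<exists>y. solves \<epsilon> 0 (std_basis s) y" if "s < N" for s
    using W.zero_mem std_basis_mem[OF that] unfolding uniquely_solvable_def by blast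
  then show thesis using that unfolding dual_system_def by metis
qed

lemma boundary_lincomb_dual_system:
  assumes \<epsilon>: "\<epsilon> \<in> {0..<\<epsilon>0}" and Z: "dual_system \<epsilon> Z" and d: "d \<in> cvec N"
  shows "B \<epsilon> (lincomb N Z d) = d"
proof -
  interpret B: bounded_operator V p "cvec N" "cnorm N" "B \<epsilon>" by (rule boundary[OF \<epsilon>])
  show ?thesis
    using B.lincomb[of N Z d] dual_systemD[OF Z] lincomb_cong[of N "\<lambda>s. B \<epsilon> (Z s)" std_basis]
    by (simp add: lincomb_std_basis[OF d])
qed

lemma homogeneous_solution_eq_lincomb_dual_system:
  assumes \<epsilon>: "\<epsilon> \<in> {0..<\<epsilon>0}" and kernel: "trivial_kernel \<epsilon>" and Z: "dual_system \<epsilon> Z"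
    and v: "v \<in> V" "L \<epsilon> v = 0"
  shows "v = lincomb N Z (B \<epsilon> v)"
proof -
  interpret L: bounded_operator V p W q "L \<epsilon>" by (rule L_operator[OF \<epsilon>])
  interpret B: bounded_operator V p "cvec N" "cnorm N" "B \<epsilon>" by (rule boundary[OF \<epsilon>])
  let ?w = "lincomb N Z (B \<epsilon> v)"
  have w: "?w \<in> V" using dual_systemD(1)[OF Z] by (rule V.lincomb_mem)
  have "L \<epsilon> ?w = 0"
    using L.lincomb[of N Z] dual_systemD[OF Z] lincomb_cong[of N "\<lambda>s. L \<epsilon> (Z s)" "\<lambda>s. 0"]
    by (simp add: lincomb_zero)
  moreover have "B \<epsilon> ?w = B \<epsilon> v" by (rule boundary_lincomb_dual_system[OF \<epsilon> Z B.maps[OF v(1)]])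
  ultimately have "v - ?w = 0"
    using v w by (intro trivial_kernelD[OF kernel]) (simp_all add: L.diff B.diff V.diff_mem)
  then show ?thesis by simp
qed

text \<open>Writing \<open>y = u + v\<close>, where \<open>u\<close> has zero initial data and \<open>L 0 v = 0\<close>, the part \<open>v\<close> is a
  combination of the dual system \<open>Z\<close>, and \<open>B \<epsilon> (Z s)\<close> is close to the s-th standard basis vector.\<close>

lemma norm_le_unperturbed_data:
  assumes \<epsilon>: "\<epsilon> \<in> {0..<\<epsilon>0}" and kernel: "trivial_kernel 0" and dual: "dual_system 0 Z"
    and near: "(\<Sum>s<N. cnorm N (B \<epsilon> (Z s) - std_basis s)) \<le> 1 / 2"
    and C: "0 \<le> C" "\<And>u. u \<in> V \<Longrightarrow> \<Lambda> u = 0 \<Longrightarrow> p u \<le> C * q (L 0 u)"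
    and \<beta>: "0 \<le> \<beta>" "\<And>y. y \<in> V \<Longrightarrow> cnorm N (B \<epsilon> y) \<le> \<beta> * p y" and y: "y \<in> V"
  defines "\<zeta> \<equiv> \<Sum>s<N. p (Z s)"
  shows "p y \<le> (C + 2 * \<zeta> * (1 + \<beta> * C)) * (q (L 0 y) + cnorm N (B \<epsilon> y))"
proof -
  interpret L: initial_value_operator V p W q "L 0" N \<Lambda> z by (rule initial_value[OF zero_admissible])
  interpret B: bounded_operator V p "cvec N" "cnorm N" "B \<epsilon>" by (rule boundary[OF \<epsilon>])
  note Z = dual_systemD(1)[OF dual]
  have \<zeta>: "0 \<le> \<zeta>" unfolding \<zeta>_def by (intro sum_nonneg V.nrm_nonneg Z) auto
  obtain u where u: "u \<in> V" "L 0 u = L 0 y" "\<Lambda> u = 0" using L.zero_data_solvable[OF L.L.maps[OF y]] by blast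
  have p_u: "p u \<le> C * q (L 0 y)" using C(2)[OF u(1,3)] u(2) by simp
  define d where "d = B 0 (y - u)"
  have yu: "y - u \<in> V" using y u by (simp add: V.diff_mem)
  have d: "d \<in> cvec N" unfolding d_def by (rule B_mem[OF zero_admissible yu])
  have decomposition: "y - u = lincomb N Z d"
    unfolding d_def using y u
    by (intro homogeneous_solution_eq_lincomb_dual_system[OF zero_admissible kernel dual yu])
      (simp add: L.L.diff)
  have "cnorm N d \<le> 2 * cnorm N (lincomb N (\<lambda>s. B \<epsilon> (Z s)) d)"
    using near by (intro lincomb_near_std_basis_bounded_below d B.maps Z) auto
  also have "lincomb N (\<lambda>s. B \<epsilon> (Z s)) d = B \<epsilon> y - B \<epsilon> u"
    using decomposition B.lincomb[of N Z d] B.diff[OF y u(1)] Z by simp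
  also have "cnorm N \<dots> \<le> cnorm N (B \<epsilon> y) + \<beta> * C * q (L 0 y)"
    using cvec.nrm_diff_le[OF B.maps[OF y] B.maps[OF u(1)]] \<beta>(2)[OF u(1)] mult_left_mono[OF p_u \<beta>(1)]
    by (simp add: mult.assoc)
  finally have d_le: "cnorm N d \<le> 2 * (cnorm N (B \<epsilon> y) + \<beta> * C * q (L 0 y))" by simp
  have "p y \<le> p u + p (lincomb N Z d)" using V.nrm_le_add_diff[OF y u(1)] decomposition by simp
  also have "\<dots> \<le> C * q (L 0 y) + cnorm N d * \<zeta>"
    unfolding \<zeta>_def by (intro add_mono p_u V.nrm_lincomb_le Z d)
  also have "\<dots> \<le> C * q (L 0 y) + 2 * (cnorm N (B \<epsilon> y) + \<beta> * C * q (L 0 y)) * \<zeta>"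
    by (intro add_left_mono mult_right_mono d_le \<zeta>)
  also have "\<dots> \<le> (C + 2 * \<zeta> * (1 + \<beta> * C)) * (q (L 0 y) + cnorm N (B \<epsilon> y))"
  proof -
    have "0 \<le> C * cnorm N (B \<epsilon> y) + 2 * \<zeta> * (q (L 0 y) + \<beta> * C * cnorm N (B \<epsilon> y))"
      using C(1) \<beta>(1) \<zeta> y by (simp add: W.nrm_nonneg L.L.maps cvec.nrm_nonneg B.maps)
    then show ?thesis by (simp add: algebra_simps)
  qed
  finally show ?thesis .
qed

lemma estimate_with_unperturbed_operator:
  assumes kernel: "trivial_kernel 0" and strong: "boundary_strongly_continuous"
  shows "\<exists>c\<ge>0. \<forall>\<^sub>F \<epsilon> in at_right 0. \<forall>y\<in>V. p y \<le> c * (q (L 0 y) + cnorm N (B \<epsilon> y))"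
proof -
  obtain C where C: "0 \<le> C" "\<And>u. u \<in> V \<Longrightarrow> \<Lambda> u = 0 \<Longrightarrow> p u \<le> C * q (L 0 u)"
    using initial_value_operator.zero_data_nonneg_bound[OF initial_value[OF zero_admissible]] by blast
  obtain \<beta> where \<beta>: "0 \<le> \<beta>" "\<forall>\<^sub>F \<epsilon> in at_right 0. \<forall>y\<in>V. cnorm N (B \<epsilon> y) \<le> \<beta> * p y"
    using boundary_uniformly_bounded[OF strong] by blast
  obtain Z where dual: "dual_system 0 Z" using dual_system_exists[OF zero_admissible kernel] by blast
  note Z = dual_systemD[OF dual]
  have "((\<lambda>\<epsilon>. \<Sum>s<N. cnorm N (B \<epsilon> (Z s) - B 0 (Z s))) \<longlongrightarrow> (\<Sum>s<N. 0)) (at_right 0)"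
    by (intro tendsto_sum boundary_tendsto[OF strong] Z) simp
  then have "\<forall>\<^sub>F \<epsilon> in at_right 0. (\<Sum>s<N. cnorm N (B \<epsilon> (Z s) - std_basis s)) < 1 / 2"
    using Z(3) by (intro order_tendstoD(2)) auto
  then have "\<forall>\<^sub>F \<epsilon> in at_right 0. \<forall>y\<in>V.
      p y \<le> (C + 2 * (\<Sum>s<N. p (Z s)) * (1 + \<beta> * C)) * (q (L 0 y) + cnorm N (B \<epsilon> y))"
    using eventually_admissible \<beta>(2)
  proof eventually_elim
    case (elim \<epsilon>)
    then show ?case by (intro ballI norm_le_unperturbed_data[OF _ kernel dual _ C \<beta>(1)]) auto
  qed
  moreover have "0 \<le> (\<Sum>s<N. p (Z s))" by (intro sum_nonneg V.nrm_nonneg Z) simp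
  ultimately show ?thesis
    using C(1) \<beta>(1) by (intro exI[of _ "C + 2 * (\<Sum>s<N. p (Z s)) * (1 + \<beta> * C)"]) simp
qed

lemma uniform_estimate:
  assumes "trivial_kernel 0" "boundary_strongly_continuous" and \<delta>: "(\<delta> \<longlongrightarrow> 0) (at_right 0)"
  shows "\<exists>c\<ge>0. \<forall>\<^sub>F \<epsilon> in at_right 0. \<forall>y\<in>V. p y \<le> c * (q (L \<epsilon> y) + cnorm N (B \<epsilon> y))"
proof -
  obtain c where c: "0 \<le> c" "\<forall>\<^sub>F \<epsilon> in at_right 0. \<forall>y\<in>V. p y \<le> c * (q (L 0 y) + cnorm N (B \<epsilon> y))"
    using estimate_with_unperturbed_operator[OF assms(1,2)] by blast
  have "\<forall>\<^sub>F \<epsilon> in at_right 0. c * \<delta> \<epsilon> < 1 / 2"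
    using tendsto_mult_right_zero[OF \<delta>] by (rule order_tendstoD) simp
  then have "\<forall>\<^sub>F \<epsilon> in at_right 0. \<forall>y\<in>V. p y \<le> 2 * c * (q (L \<epsilon> y) + cnorm N (B \<epsilon> y))"
    using eventually_admissible c(2)
  proof (eventually_elim, intro ballI)
    fix \<epsilon> y
    assume small: "c * \<delta> \<epsilon> < 1 / 2" and \<epsilon>: "\<epsilon> \<in> {0..<\<epsilon>0}"
      and est: "\<forall>y\<in>V. p y \<le> c * (q (L 0 y) + cnorm N (B \<epsilon> y))" and y: "y \<in> V"
    note L_y = L_mem[OF \<epsilon> y] and L0_y = L_mem[OF zero_admissible y]
    have "q (L 0 y) \<le> q (L \<epsilon> y) + \<delta> \<epsilon> * p y"
      using W.nrm_le_add_diff[OF L0_y L_y] W.nrm_minus_commute[OF L0_y L_y] L_perturbation[OF \<epsilon> y] by linarith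
    then have "c * (q (L 0 y) + cnorm N (B \<epsilon> y)) \<le> c * (q (L \<epsilon> y) + \<delta> \<epsilon> * p y + cnorm N (B \<epsilon> y))"
      using c(1) by (intro mult_left_mono) auto
    then have "p y \<le> c * (q (L \<epsilon> y) + cnorm N (B \<epsilon> y)) + (c * \<delta> \<epsilon>) * p y"
      using est[rule_format, OF y] by (simp add: algebra_simps)
    moreover have "(c * \<delta> \<epsilon>) * p y \<le> 1 / 2 * p y"
      using small by (intro mult_right_mono V.nrm_nonneg y) simp
    ultimately show "p y \<le> 2 * c * (q (L \<epsilon> y) + cnorm N (B \<epsilon> y))" by simp
  qed
  then show ?thesis using c(1) by (intro exI[of _ "2 * c"]) simp
qed

lemma solutions_converge:
  assumes estimate: "\<forall>\<^sub>F \<epsilon> in at_right 0. \<forall>y\<in>V. p y \<le> c * (q (L \<epsilon> y) + cnorm N (B \<epsilon> y))" and "0 \<le> c"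
    and \<delta>: "(\<delta> \<longlongrightarrow> 0) (at_right 0)" and strong: "boundary_strongly_continuous"
    and y: "\<forall>\<^sub>F \<epsilon> in at_right 0. y \<epsilon> \<in> V" and y0: "y0 \<in> V"
    and f: "((\<lambda>\<epsilon>. q (L \<epsilon> (y \<epsilon>) - L 0 y0)) \<longlongrightarrow> 0) (at_right 0)"
    and g: "((\<lambda>\<epsilon>. cnorm N (B \<epsilon> (y \<epsilon>) - B 0 y0)) \<longlongrightarrow> 0) (at_right 0)"
  shows "((\<lambda>\<epsilon>. p (y \<epsilon> - y0)) \<longlongrightarrow> 0) (at_right 0)"
proof (rule Lim_null_comparison)
  let ?b = "\<lambda>\<epsilon>. c * ((q (L \<epsilon> (y \<epsilon>) - L 0 y0) + q (L \<epsilon> y0 - L 0 y0)) +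
    (cnorm N (B \<epsilon> (y \<epsilon>) - B 0 y0) + cnorm N (B \<epsilon> y0 - B 0 y0)))"
  have "(?b \<longlongrightarrow> c * ((0 + 0) + (0 + 0))) (at_right 0)"
    by (intro tendsto_intros f g L_tendsto[OF \<delta> y0] boundary_tendsto[OF strong y0])
  then show "(?b \<longlongrightarrow> 0) (at_right 0)" by simp
  show "\<forall>\<^sub>F \<epsilon> in at_right 0. norm (p (y \<epsilon> - y0)) \<le> ?b \<epsilon>"
    using estimate y eventually_admissible
  proof eventually_elim
    case (elim \<epsilon>)
    note \<epsilon> = elim(3) and y_\<epsilon> = elim(2)
    interpret L: bounded_operator V p W q "L \<epsilon>" by (rule L_operator[OF \<epsilon>])
    interpret B: bounded_operator V p "cvec N" "cnorm N" "B \<epsilon>" by (rule boundary[OF \<epsilon>])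
    note L0_y0 = L_mem[OF zero_admissible y0] and B0_y0 = B_mem[OF zero_admissible y0]
    have "L \<epsilon> (y \<epsilon> - y0) = (L \<epsilon> (y \<epsilon>) - L 0 y0) - (L \<epsilon> y0 - L 0 y0)"
      using y_\<epsilon> y0 by (simp add: L.diff)
    then have "q (L \<epsilon> (y \<epsilon> - y0)) \<le> q (L \<epsilon> (y \<epsilon>) - L 0 y0) + q (L \<epsilon> y0 - L 0 y0)"
      using W.nrm_diff_le[OF W.diff_mem[OF L.maps[OF y_\<epsilon>] L0_y0] W.diff_mem[OF L.maps[OF y0] L0_y0]] by simp
    moreover have "B \<epsilon> (y \<epsilon> - y0) = (B \<epsilon> (y \<epsilon>) - B 0 y0) - (B \<epsilon> y0 - B 0 y0)"
      using y_\<epsilon> y0 by (simp add: B.diff)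
    then have "cnorm N (B \<epsilon> (y \<epsilon> - y0)) \<le> cnorm N (B \<epsilon> (y \<epsilon>) - B 0 y0) + cnorm N (B \<epsilon> y0 - B 0 y0)"
      using cvec.nrm_diff_le[OF cvec.diff_mem[OF B.maps[OF y_\<epsilon>] B0_y0] cvec.diff_mem[OF B.maps[OF y0] B0_y0]]
      by simp
    ultimately have "c * (q (L \<epsilon> (y \<epsilon> - y0)) + cnorm N (B \<epsilon> (y \<epsilon> - y0))) \<le> ?b \<epsilon>"
      using \<open>0 \<le> c\<close> by (intro mult_left_mono add_mono) auto
    then show ?case using elim(1) V.diff_mem[OF y_\<epsilon> y0] V.nrm_nonneg by force
  qed
qed

lemma continuous_dependenceI:
  assumes kernel: "trivial_kernel 0" and \<delta>: "(\<delta> \<longlongrightarrow> 0) (at_right 0)" and strong: "boundary_strongly_continuous"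
  shows "continuous_dependence"
proof -
  obtain c where c: "0 \<le> c" "\<forall>\<^sub>F \<epsilon> in at_right 0. \<forall>y\<in>V. p y \<le> c * (q (L \<epsilon> y) + cnorm N (B \<epsilon> y))"
    using uniform_estimate[OF kernel strong \<delta>] by blast
  from c(2) have "\<forall>\<^sub>F \<epsilon> in at_right 0. trivial_kernel \<epsilon>"
  proof eventually_elim
    case (elim \<epsilon>)
    then have "p y \<le> 0" if "y \<in> V" "L \<epsilon> y = 0" "B \<epsilon> y = 0" for y
      using that by (force simp: W.nrm_zero cvec.nrm_zero)
    then show ?case unfolding trivial_kernel_def using V.nrm_nonneg V.nrm_zeroD by (meson antisym)
  qed
  then obtain \<epsilon>2 where \<epsilon>2: "0 < \<epsilon>2" "\<And>\<epsilon>. 0 < \<epsilon> \<Longrightarrow> \<epsilon> < \<epsilon>2 \<Longrightarrow> trivial_kernel \<epsilon>"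
    by (auto simp: eventually_at_right_field)
  define \<epsilon>1 where "\<epsilon>1 = min (\<epsilon>0 / 2) \<epsilon>2"
  have \<epsilon>1: "0 < \<epsilon>1" "\<epsilon>1 < \<epsilon>0" using \<epsilon>0_pos \<epsilon>2 by (auto simp: \<epsilon>1_def)
  have "uniquely_solvable \<epsilon>" if "\<epsilon> \<in> {0..<\<epsilon>1}" for \<epsilon>
    using that kernel \<epsilon>2(2)[of \<epsilon>] \<epsilon>1 by (cases "\<epsilon> = 0") (auto simp: uniquely_solvable_iff \<epsilon>1_def)
  moreover have "((\<lambda>\<epsilon>. p (y \<epsilon> - y 0)) \<longlongrightarrow> 0) (at_right 0)"
    if y: "\<forall>\<epsilon>\<in>{0..<\<epsilon>1}. solves \<epsilon> (f \<epsilon>) (d \<epsilon>) (y \<epsilon>)"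
      and f: "((\<lambda>\<epsilon>. q (f \<epsilon> - f 0)) \<longlongrightarrow> 0) (at_right 0)"
      and d: "((\<lambda>\<epsilon>. cnorm N (d \<epsilon> - d 0)) \<longlongrightarrow> 0) (at_right 0)" for f d y
  proof (rule solutions_converge[OF c(2,1) \<delta> strong])
    have eq: "\<forall>\<^sub>F \<epsilon> in at_right 0. y \<epsilon> \<in> V \<and>
        f \<epsilon> - f 0 = L \<epsilon> (y \<epsilon>) - L 0 (y 0) \<and> d \<epsilon> - d 0 = B \<epsilon> (y \<epsilon>) - B 0 (y 0)"
      using eventually_at_right_real[OF \<epsilon>1(1)] by eventually_elim (use y \<epsilon>1 in auto)
    show "\<forall>\<^sub>F \<epsilon> in at_right 0. y \<epsilon> \<in> V" "y 0 \<in> V" using eq y \<epsilon>1 by (auto elim: eventually_mono)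
    show "((\<lambda>\<epsilon>. q (L \<epsilon> (y \<epsilon>) - L 0 (y 0))) \<longlongrightarrow> 0) (at_right 0)"
      by (rule Lim_transform_eventually[OF f]) (use eq in \<open>auto elim: eventually_mono\<close>)
    show "((\<lambda>\<epsilon>. cnorm N (B \<epsilon> (y \<epsilon>) - B 0 (y 0))) \<longlongrightarrow> 0) (at_right 0)"
      by (rule Lim_transform_eventually[OF d]) (use eq in \<open>auto elim: eventually_mono\<close>)
  qed
  ultimately show ?thesis unfolding continuous_dependence_def using \<epsilon>1 by blast
qed

lemma continuous_dependence_uniquely_solvable:
  assumes "continuous_dependence"
  shows "uniquely_solvable 0" "\<forall>\<^sub>F \<epsilon> in at_right 0. uniquely_solvable \<epsilon>"
proof -
  obtain \<epsilon>1 where \<epsilon>1: "0 < \<epsilon>1" "\<forall>\<epsilon>\<in>{0..<\<epsilon>1}. uniquely_solvable \<epsilon>"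
    using assms by (auto simp: continuous_dependence_def)
  then show "uniquely_solvable 0" by simp
  show "\<forall>\<^sub>F \<epsilon> in at_right 0. uniquely_solvable \<epsilon>"
    using eventually_at_right_real[OF \<epsilon>1(1)] by eventually_elim (use \<epsilon>1 in auto)
qed

text \<open>Only the limit \<open>\<epsilon> \<rightarrow> 0\<close> of the data matters, so that their values elsewhere may be changed.\<close>

lemma solutions_with_convergent_data:
  assumes "continuous_dependence" and x: "x \<in> V"
    and data: "\<forall>\<^sub>F \<epsilon> in at_right 0. f \<epsilon> \<in> W \<and> c \<epsilon> \<in> cvec N"
    and f: "((\<lambda>\<epsilon>. q (f \<epsilon> - L 0 x)) \<longlongrightarrow> 0) (at_right 0)"
    and c: "((\<lambda>\<epsilon>. cnorm N (c \<epsilon> - B 0 x)) \<longlongrightarrow> 0) (at_right 0)"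
  shows "\<exists>y. (\<forall>\<^sub>F \<epsilon> in at_right 0. solves \<epsilon> (f \<epsilon>) (c \<epsilon>) (y \<epsilon>)) \<and>
    ((\<lambda>\<epsilon>. p (y \<epsilon> - x)) \<longlongrightarrow> 0) (at_right 0)"
proof -
  obtain \<epsilon>1 where \<epsilon>1: "0 < \<epsilon>1" "\<epsilon>1 < \<epsilon>0" and solvable: "\<forall>\<epsilon>\<in>{0..<\<epsilon>1}. uniquely_solvable \<epsilon>"
    and convergence: "\<forall>f c y.
       (\<forall>\<epsilon>\<in>{0..<\<epsilon>1}. f \<epsilon> \<in> W \<and> c \<epsilon> \<in> cvec N \<and> solves \<epsilon> (f \<epsilon>) (c \<epsilon>) (y \<epsilon>)) \<longrightarrow>
       ((\<lambda>\<epsilon>. q (f \<epsilon> - f 0)) \<longlongrightarrow> 0) (at_right 0) \<longrightarrow>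
       ((\<lambda>\<epsilon>. cnorm N (c \<epsilon> - c 0)) \<longlongrightarrow> 0) (at_right 0) \<longrightarrow>
       ((\<lambda>\<epsilon>. p (y \<epsilon> - y 0)) \<longlongrightarrow> 0) (at_right 0)"
    using assms(1) unfolding continuous_dependence_def by (elim exE conjE) (rule that)
  define good where "good \<epsilon> \<longleftrightarrow> 0 < \<epsilon> \<and> f \<epsilon> \<in> W \<and> c \<epsilon> \<in> cvec N" for \<epsilon>
  define f' where "f' \<epsilon> = (if good \<epsilon> then f \<epsilon> else L 0 x)" for \<epsilon>
  define c' where "c' \<epsilon> = (if good \<epsilon> then c \<epsilon> else B 0 x)" for \<epsilon>
  have mem: "f' \<epsilon> \<in> W" "c' \<epsilon> \<in> cvec N" for \<epsilon>
    using L_mem[OF zero_admissible x] B_mem[OF zero_admissible x] by (auto simp: f'_def c'_def good_def)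
  have zero: "f' 0 = L 0 x" "c' 0 = B 0 x" by (auto simp: f'_def c'_def good_def)
  have "\<forall>\<^sub>F \<epsilon> in at_right 0. \<epsilon> \<in> {0..<\<epsilon>1} \<and> good \<epsilon>"
    using data eventually_at_right_real[OF \<epsilon>1(1)] by eventually_elim (auto simp: good_def)
  then have near: "\<forall>\<^sub>F \<epsilon> in at_right 0. \<epsilon> \<in> {0..<\<epsilon>1} \<and> f' \<epsilon> = f \<epsilon> \<and> c' \<epsilon> = c \<epsilon>"
    by eventually_elim (auto simp: f'_def c'_def)
  have "\<exists>y. solves \<epsilon> (f' \<epsilon>) (c' \<epsilon>) y" if "\<epsilon> \<in> {0..<\<epsilon>1}" for \<epsilon>
    using solvable that mem unfolding uniquely_solvable_def by blast
  then obtain y where y: "\<And>\<epsilon>. \<epsilon> \<in> {0..<\<epsilon>1} \<Longrightarrow> solves \<epsilon> (f' \<epsilon>) (c' \<epsilon>) (y \<epsilon>)" by metis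
  have "y 0 = x"
    using solvable[rule_format, of 0] y[of 0] \<epsilon>1 x mem[of 0] unfolding uniquely_solvable_def zero by fastforce
  have "((\<lambda>\<epsilon>. q (f' \<epsilon> - f' 0)) \<longlongrightarrow> 0) (at_right 0)"
    by (rule Lim_transform_eventually[OF f]) (use near in \<open>auto simp: zero elim: eventually_mono\<close>)
  moreover have "((\<lambda>\<epsilon>. cnorm N (c' \<epsilon> - c' 0)) \<longlongrightarrow> 0) (at_right 0)"
    by (rule Lim_transform_eventually[OF c]) (use near in \<open>auto simp: zero elim: eventually_mono\<close>)
  ultimately have "((\<lambda>\<epsilon>. p (y \<epsilon> - x)) \<longlongrightarrow> 0) (at_right 0)"
    using convergence[rule_format, of f' c' y] mem y \<open>y 0 = x\<close> by simp
  moreover have "\<forall>\<^sub>F \<epsilon> in at_right 0. solves \<epsilon> (f \<epsilon>) (c \<epsilon>) (y \<epsilon>)"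
    using near by eventually_elim (use y in auto)
  ultimately show ?thesis by blast
qed

lemma solution_family_with_fixed_data:
  assumes cd: "continuous_dependence" and x: "\<And>s. s < N \<Longrightarrow> x s \<in> V"
  obtains y where "\<forall>\<^sub>F \<epsilon> in at_right 0. \<forall>s<N. solves \<epsilon> (L 0 (x s)) (B 0 (x s)) (y s \<epsilon>)"
    "((\<lambda>\<epsilon>. \<Sum>s<N. p (y s \<epsilon> - x s)) \<longlongrightarrow> 0) (at_right 0)"
proof -
  have "\<exists>y. (\<forall>\<^sub>F \<epsilon> in at_right 0. solves \<epsilon> (L 0 (x s)) (B 0 (x s)) (y \<epsilon>)) \<and>
      ((\<lambda>\<epsilon>. p (y \<epsilon> - x s)) \<longlongrightarrow> 0) (at_right 0)" if "s < N" for s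
    using x[OF that] by (intro solutions_with_convergent_data[OF cd])
      (auto simp: L_mem B_mem zero_admissible W.nrm_zero cvec.nrm_zero \<epsilon>0_pos)
  then have "\<forall>s\<in>{..<N}. \<exists>y. (\<forall>\<^sub>F \<epsilon> in at_right 0. solves \<epsilon> (L 0 (x s)) (B 0 (x s)) (y \<epsilon>)) \<and>
      ((\<lambda>\<epsilon>. p (y \<epsilon> - x s)) \<longlongrightarrow> 0) (at_right 0)" by blast
  from bchoice[OF this] obtain y where
    y: "\<forall>s\<in>{..<N}. (\<forall>\<^sub>F \<epsilon> in at_right 0. solves \<epsilon> (L 0 (x s)) (B 0 (x s)) (y s \<epsilon>)) \<and>
      ((\<lambda>\<epsilon>. p (y s \<epsilon> - x s)) \<longlongrightarrow> 0) (at_right 0)" ..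
  have "((\<lambda>\<epsilon>. \<Sum>s<N. p (y s \<epsilon> - x s)) \<longlongrightarrow> (\<Sum>s<N. 0)) (at_right 0)"
    using y by (intro tendsto_sum) blast
  moreover have "\<forall>\<^sub>F \<epsilon> in at_right 0. \<forall>s\<in>{..<N}. solves \<epsilon> (L 0 (x s)) (B 0 (x s)) (y s \<epsilon>)"
    using y by (intro eventually_ball_finite) auto
  ultimately show thesis using that[of y] by (simp add: Ball_def)
qed

lemma continuous_dependence_imp_trivial_kernel: "continuous_dependence \<Longrightarrow> trivial_kernel 0"
  using continuous_dependence_uniquely_solvable uniquely_solvable_iff[OF zero_admissible] by simp

lemma perturbation_at_solution_le:
  assumes \<epsilon>: "\<epsilon> \<in> {0..<\<epsilon>0}" and C: "\<And>y. y \<in> V \<Longrightarrow> q (L 0 y) \<le> C * p y"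
    and x: "x \<in> V" and y: "y \<in> V" "L \<epsilon> y = L 0 x"
  shows "q (L \<epsilon> x - L 0 x) \<le> (C + \<delta> \<epsilon>) * p (y - x)"
proof -
  interpret L: bounded_operator V p W q "L \<epsilon>" by (rule L_operator[OF \<epsilon>])
  interpret L0: bounded_operator V p W q "L 0" by (rule L_operator[OF zero_admissible])
  have xy: "x - y \<in> V" using x y by (simp add: V.diff_mem)
  have "q (L \<epsilon> x - L 0 x) = q (L \<epsilon> (x - y))" using x y by (simp add: L.diff)
  also have "\<dots> \<le> q (L 0 (x - y)) + q (L \<epsilon> (x - y) - L 0 (x - y))"
    using xy by (intro W.nrm_le_add_diff L.maps L0.maps)
  also have "\<dots> \<le> C * p (x - y) + \<delta> \<epsilon> * p (x - y)"
    using xy by (intro add_mono C L_perturbation \<epsilon>)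
  finally show ?thesis using V.nrm_minus_commute[OF x y(1)] by (simp add: distrib_right)
qed

lemma continuous_dependence_imp_\<delta>_tendsto:
  assumes cd: "continuous_dependence"
  shows "(\<delta> \<longlongrightarrow> 0) (at_right 0)"
proof -
  interpret L: initial_value_operator V p W q "L 0" N \<Lambda> z by (rule initial_value[OF zero_admissible])
  obtain C where C: "0 \<le> C" "\<And>y. y \<in> V \<Longrightarrow> q (L 0 y) \<le> C * p y" using L.L.nonneg_bound by blast
  obtain c where c: "\<And>\<epsilon>. \<epsilon> \<in> {0..<\<epsilon>0} \<Longrightarrow> \<delta> \<epsilon> \<le> c * (\<Sum>s<N. q (L \<epsilon> (z s) - L 0 (z s)))"
    using \<delta>_le_test_functions by blast
  obtain y where y: "\<forall>\<^sub>F \<epsilon> in at_right 0. \<forall>s<N. solves \<epsilon> (L 0 (z s)) (B 0 (z s)) (y s \<epsilon>)"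
    and lim: "((\<lambda>\<epsilon>. \<Sum>s<N. p (y s \<epsilon> - z s)) \<longlongrightarrow> 0) (at_right 0)"
    by (rule solution_family_with_fixed_data[OF cd L.z_mem])
  define \<eta> where "\<eta> \<epsilon> = (\<Sum>s<N. p (y s \<epsilon> - z s))" for \<epsilon>
  have \<eta>: "(\<eta> \<longlongrightarrow> 0) (at_right 0)" using lim by (simp add: \<eta>_def[abs_def])
  from y have "\<forall>\<^sub>F \<epsilon> in at_right 0. 0 \<le> \<delta> \<epsilon> \<and> \<delta> \<epsilon> \<le> \<bar>c\<bar> * C * \<eta> \<epsilon> + (\<bar>c\<bar> * \<eta> \<epsilon>) * \<delta> \<epsilon>"
    using eventually_admissible
  proof eventually_elim
    case (elim \<epsilon>)
    have "(\<Sum>s<N. q (L \<epsilon> (z s) - L 0 (z s))) \<le> (\<Sum>s<N. (C + \<delta> \<epsilon>) * p (y s \<epsilon> - z s))"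
      using elim by (intro sum_mono perturbation_at_solution_le C L.z_mem) auto
    also have "\<dots> = (C + \<delta> \<epsilon>) * \<eta> \<epsilon>" by (simp add: \<eta>_def sum_distrib_left)
    finally have sum_le: "(\<Sum>s<N. q (L \<epsilon> (z s) - L 0 (z s))) \<le> (C + \<delta> \<epsilon>) * \<eta> \<epsilon>" .
    have "0 \<le> (\<Sum>s<N. q (L \<epsilon> (z s) - L 0 (z s)))"
      using L_mem[OF elim(2)] L_mem[OF zero_admissible] L.z_mem
      by (intro sum_nonneg W.nrm_nonneg W.diff_mem) auto
    then have "\<delta> \<epsilon> \<le> \<bar>c\<bar> * (\<Sum>s<N. q (L \<epsilon> (z s) - L 0 (z s)))"
      using c[OF elim(2)] mult_right_mono[OF abs_ge_self] order_trans by blast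
    also have "\<dots> \<le> \<bar>c\<bar> * ((C + \<delta> \<epsilon>) * \<eta> \<epsilon>)" by (intro mult_left_mono sum_le) simp
    finally show ?case using \<delta>_nonneg[OF elim(2)] by (simp add: algebra_simps)
  qed
  then show ?thesis
    by (rule tendsto_zero_by_absorption) (use tendsto_mult_right_zero[OF \<eta>] in auto)
qed

lemma boundary_perturbation_le:
  assumes \<epsilon>: "\<epsilon> \<in> {0..<\<epsilon>0}" and kernel: "trivial_kernel \<epsilon>" and Y: "dual_system \<epsilon> Y" and Z: "dual_system 0 Z"
    and \<beta>: "0 \<le> \<beta>" "\<And>y. y \<in> V \<Longrightarrow> cnorm N (B 0 y) \<le> \<beta> * p y"
    and x: "x \<in> V" and y: "y \<in> V" "L \<epsilon> y = L \<epsilon> x" "B \<epsilon> y = B 0 x"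
  defines "d \<equiv> B \<epsilon> x - B 0 x"
  shows "cnorm N d \<le> \<beta> * p (y - x) + (\<beta> * (\<Sum>s<N. p (Y s - Z s))) * cnorm N d"
proof -
  interpret L: bounded_operator V p W q "L \<epsilon>" by (rule L_operator[OF \<epsilon>])
  interpret B: bounded_operator V p "cvec N" "cnorm N" "B \<epsilon>" by (rule boundary[OF \<epsilon>])
  have xy: "x - y \<in> V" using x y by (simp add: V.diff_mem)
  have d_eq: "d = B \<epsilon> (x - y)" using x y by (simp add: d_def B.diff)
  then have d: "d \<in> cvec N" using B.maps[OF xy] by simp
  have xy_eq: "x - y = lincomb N Y d"
    unfolding d_eq using x y by (intro homogeneous_solution_eq_lincomb_dual_system[OF \<epsilon> kernel Y xy])
      (simp add: L.diff)
  note Y_mem = dual_systemD(1)[OF Y] and Z_mem = dual_systemD(1)[OF Z]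
  have lincomb_Z: "lincomb N Z d \<in> V" by (intro V.lincomb_mem Z_mem)
  have "p (lincomb N Z d) \<le> p (x - y) + p (lincomb N Y d - lincomb N Z d)"
    using V.nrm_le_add_diff[OF lincomb_Z xy] V.nrm_minus_commute[OF lincomb_Z xy] by (simp add: xy_eq)
  also have "\<dots> \<le> p (y - x) + cnorm N d * (\<Sum>s<N. p (Y s - Z s))"
    unfolding lincomb_diff using V.nrm_minus_commute[OF x y(1)]
    by (simp add: V.nrm_lincomb_le V.diff_mem Y_mem Z_mem d)
  finally have "\<beta> * p (lincomb N Z d) \<le> \<beta> * (p (y - x) + cnorm N d * (\<Sum>s<N. p (Y s - Z s)))"
    by (intro mult_left_mono \<beta>(1))
  then show ?thesis
    using \<beta>(2)[OF lincomb_Z] boundary_lincomb_dual_system[OF zero_admissible Z d] by (simp add: algebra_simps)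
qed

lemma continuous_dependence_imp_boundary_strongly_continuous:
  assumes cd: "continuous_dependence"
  shows "boundary_strongly_continuous"
  unfolding boundary_strongly_continuous_def
proof
  fix x assume x: "x \<in> V"
  interpret B: bounded_operator V p "cvec N" "cnorm N" "B 0" by (rule boundary[OF zero_admissible])
  have "\<forall>\<^sub>F \<epsilon> in at_right 0. L \<epsilon> x \<in> W \<and> B 0 x \<in> cvec N"
    using eventually_admissible by eventually_elim (simp add: L_mem B.maps x)
  moreover have "((\<lambda>\<epsilon>. q (L \<epsilon> x - L 0 x)) \<longlongrightarrow> 0) (at_right 0)"
    by (rule L_tendsto[OF continuous_dependence_imp_\<delta>_tendsto[OF cd] x])
  ultimately obtain y where
    y: "\<forall>\<^sub>F \<epsilon> in at_right 0. solves \<epsilon> (L \<epsilon> x) (B 0 x) (y \<epsilon>)"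
    and y_lim: "((\<lambda>\<epsilon>. p (y \<epsilon> - x)) \<longlongrightarrow> 0) (at_right 0)"
    using solutions_with_convergent_data[OF cd x, of "\<lambda>\<epsilon>. L \<epsilon> x" "\<lambda>\<epsilon>. B 0 x"] by (auto simp: cvec.nrm_zero)
  obtain Z where dual: "dual_system 0 Z"
    using dual_system_exists[OF zero_admissible continuous_dependence_imp_trivial_kernel[OF cd]] by blast
  note Z = dual_systemD[OF dual]
  obtain Y where Y: "\<forall>\<^sub>F \<epsilon> in at_right 0. \<forall>s<N. solves \<epsilon> (L 0 (Z s)) (B 0 (Z s)) (Y s \<epsilon>)"
    and Y_lim: "((\<lambda>\<epsilon>. \<Sum>s<N. p (Y s \<epsilon> - Z s)) \<longlongrightarrow> 0) (at_right 0)"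
    by (rule solution_family_with_fixed_data[OF cd Z(1)])
  from Y have dual_Y: "\<forall>\<^sub>F \<epsilon> in at_right 0. dual_system \<epsilon> (\<lambda>s. Y s \<epsilon>)"
    by eventually_elim (simp add: dual_system_def Z)
  obtain \<beta> where \<beta>: "0 \<le> \<beta>" "\<And>y. y \<in> V \<Longrightarrow> cnorm N (B 0 y) \<le> \<beta> * p y" using B.nonneg_bound by blast
  show "((\<lambda>\<epsilon>. cnorm N (B \<epsilon> x - B 0 x)) \<longlongrightarrow> 0) (at_right 0)"
  proof (rule tendsto_zero_by_absorption)
    show "\<forall>\<^sub>F \<epsilon> in at_right 0. 0 \<le> cnorm N (B \<epsilon> x - B 0 x) \<and> cnorm N (B \<epsilon> x - B 0 x) \<le>
        \<beta> * p (y \<epsilon> - x) + (\<beta> * (\<Sum>s<N. p (Y s \<epsilon> - Z s))) * cnorm N (B \<epsilon> x - B 0 x)"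
      using eventually_admissible continuous_dependence_uniquely_solvable(2)[OF cd] dual_Y y
    proof eventually_elim
      case (elim \<epsilon>)
      have "0 \<le> cnorm N (B \<epsilon> x - B 0 x)"
        using x elim(1) by (intro cvec.nrm_nonneg cvec.diff_mem B_mem zero_admissible)
      then show ?case
        using elim boundary_perturbation_le[OF elim(1) _ elim(3) dual \<beta> x]
        by (auto simp: uniquely_solvable_iff)
    qed
  qed (use tendsto_mult_right_zero[OF y_lim] tendsto_mult_right_zero[OF Y_lim] in auto)
qed

theorem continuous_dependence_iff:
  "continuous_dependence \<longleftrightarrow>
    trivial_kernel 0 \<and> (\<delta> \<longlongrightarrow> 0) (at_right 0) \<and> boundary_strongly_continuous"
  using continuous_dependenceI continuous_dependence_imp_trivial_kernel
    continuous_dependence_imp_\<delta>_tendsto continuous_dependence_imp_boundary_strongly_continuous by blast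

end

section \<open>Hoelder functions on an interval\<close>

lemma norm_lincomb_le:
  fixes x y :: "'c \<Rightarrow> complex"
  assumes "cmod (x t) \<le> X" "cmod (y t) \<le> Y"
  shows "cmod ((c *\<^sub>C x + d *\<^sub>C y) t) \<le> cmod c * X + cmod d * Y"
  using assms by (auto simp: norm_mult scaleC_complex_def
      intro!: order_trans[OF norm_triangle_ineq] add_mono mult_left_mono)

lemma norm_le_of_tendsto:
  fixes x :: "nat \<Rightarrow> 'c::real_normed_vector"
  assumes "x \<longlonglongrightarrow> w" "\<And>l. M \<le> l \<Longrightarrow> norm (u - x l) \<le> c"
  shows "norm (u - w) \<le> c"
  by (rule Lim_bounded[of "\<lambda>l. norm (u - x l)" _ M]) (use assms in \<open>auto intro!: tendsto_intros\<close>)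

locale hoelder_interval =
  fixes a b \<alpha> :: real
  assumes a_less_b: "a < b" and exponent_pos: "0 < \<alpha>" and exponent_le: "\<alpha> \<le> 1"
begin

abbreviation "H n \<equiv> Hoelder n \<alpha> a b"
abbreviation "hnorm n \<equiv> hoelder_norm n \<alpha> a b"

definition D :: "(real \<Rightarrow> complex) \<Rightarrow> real \<Rightarrow> complex" where
  "D x = (\<lambda>t. if t \<in> {a..b} then vector_derivative x (at t within {a..b}) else 0)"

definition supnorm :: "(real \<Rightarrow> complex) \<Rightarrow> real" where
  "supnorm x = Sup ((\<lambda>t. cmod (x t)) ` {a..b})"

definition quotients :: "(real \<Rightarrow> complex) \<Rightarrow> real set" where
  "quotients x = {cmod (x t2 - x t1) / \<bar>t2 - t1\<bar> powr \<alpha> | t1 t2. a \<le> t1 \<and> t1 < t2 \<and> t2 \<le> b}"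

definition seminorm :: "(real \<Rightarrow> complex) \<Rightarrow> real" where
  "seminorm x = Sup (quotients x)"

subsection \<open>Recursive description of the spaces\<close>

lemma dern_Suc: "t \<in> {a..b} \<Longrightarrow> dern a b (Suc k) x t = dern a b k (D x) t"
proof (induction k arbitrary: t)
  case (Suc k)
  have "dern a b (Suc (Suc k)) x t = vector_derivative (dern a b (Suc k) x) (at t within {a..b})" by simp
  also have "\<dots> = vector_derivative (dern a b k (D x)) (at t within {a..b})"
    by (rule vector_derivative_cong_eq) (use Suc in auto)
  finally show ?case by simp
qed (simp add: D_def)

lemma dern_eq_funpow: "t \<in> {a..b} \<Longrightarrow> dern a b k x t = (D ^^ k) x t"
proof (induction k arbitrary: x)
  case (Suc k)
  then show ?case by (metis dern_Suc funpow_Suc_right o_apply)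
qed simp

lemma D_outside: "t \<notin> {a..b} \<Longrightarrow> D x t = 0"
  by (auto simp: D_def)

lemma D_eqI:
  assumes "\<And>t. t \<notin> {a..b} \<Longrightarrow> d t = 0"
    and "\<And>t. t \<in> {a..b} \<Longrightarrow> (x has_vector_derivative d t) (at t within {a..b})"
  shows "D x = d"
proof
  fix t show "D x t = d t"
    using assms vector_derivative_within_closed_interval[OF a_less_b, of t x "d t"] by (auto simp: D_def)
qed

lemma continuous_on_of_vector_derivative:
  "(\<And>t. t \<in> {a..b} \<Longrightarrow> (x has_vector_derivative d t) (at t within {a..b})) \<Longrightarrow> continuous_on {a..b} x"
  using has_vector_derivative_continuous continuous_on_eq_continuous_within by blast

lemma quotients_cong:
  assumes "\<And>t. t \<in> {a..b} \<Longrightarrow> x t = y t"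
  shows "quotients x = quotients y"
proof -
  have "x t1 = y t1 \<and> x t2 = y t2" if "a \<le> t1" "t1 < t2" "t2 \<le> b" for t1 t2
    using assms that by auto
  then show ?thesis unfolding quotients_def by (intro Collect_cong) metis
qed

lemma quotients_dern_Suc: "quotients (dern a b (Suc n) x) = quotients (dern a b n (D x))"
  by (rule quotients_cong) (rule dern_Suc)

lemma Hoelder_0_iff:
  "x \<in> H 0 \<longleftrightarrow> (\<forall>t. t \<notin> {a..b} \<longrightarrow> x t = 0) \<and> continuous_on {a..b} x \<and> bdd_above (quotients x)"
  by (simp add: Hoelder_def quotients_def)

lemma Hoelder_Suc_iff:
  "x \<in> H (Suc n) \<longleftrightarrow> (\<forall>t. t \<notin> {a..b} \<longrightarrow> x t = 0) \<and>
     (\<forall>t\<in>{a..b}. (x has_vector_derivative D x t) (at t within {a..b})) \<and> D x \<in> H n"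
proof -
  have continuous: "continuous_on {a..b} (dern a b (Suc k) x) \<longleftrightarrow> continuous_on {a..b} (dern a b k (D x))" for k
    by (intro continuous_on_cong dern_Suc) auto
  have derivative: "(dern a b (Suc k) x has_vector_derivative dern a b (Suc (Suc k)) x t) (at t within {a..b})
      \<longleftrightarrow> (dern a b k (D x) has_vector_derivative dern a b (Suc k) (D x) t) (at t within {a..b})"
    if "t \<in> {a..b}" for k t
    unfolding dern_Suc[OF that, of "Suc k"] using has_vector_derivative_transform[OF that] dern_Suc by metis
  have all_le: "(\<forall>k\<le>Suc n. P k) \<longleftrightarrow> P 0 \<and> (\<forall>k\<le>n. P (Suc k))" for P :: "nat \<Rightarrow> bool"
    by (metis Suc_le_mono le0 not0_implies_Suc)
  have first: "dern a b (Suc 0) x t = D x t" if "t \<in> {a..b}" for t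
    using dern_Suc[OF that, of 0] by simp
  show ?thesis
    unfolding Hoelder_def mem_Collect_eq all_le All_less_Suc2 quotients_def[symmetric]
      quotients_dern_Suc continuous
    using D_outside[of _ x] derivative first continuous_on_of_vector_derivative[of x "D x"]
    by (auto simp del: dern.simps(2))
qed

lemma hnorm_0: "hnorm 0 x = supnorm x + seminorm x"
  by (simp add: hoelder_norm_def hoelder_semi_def supnorm_def seminorm_def quotients_def)

lemma hnorm_Suc: "hnorm (Suc n) x = supnorm x + hnorm n (D x)"
proof -
  have "(\<lambda>t. cmod (dern a b (Suc j) x t)) ` {a..b} = (\<lambda>t. cmod (dern a b j (D x) t)) ` {a..b}" for j
    by (intro image_cong refl arg_cong[where f=cmod] dern_Suc)
  then show ?thesis
    unfolding hoelder_norm_def hoelder_semi_def quotients_def[symmetric] quotients_dern_Suc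
      sum.atMost_Suc_shift
    by (simp add: supnorm_def)
qed

lemma Hoelder_outside: "x \<in> H n \<Longrightarrow> t \<notin> {a..b} \<Longrightarrow> x t = 0"
  by (simp add: Hoelder_def)

lemma Hoelder_continuous: "x \<in> H n \<Longrightarrow> continuous_on {a..b} x"
  unfolding Hoelder_def by (auto dest!: spec[of _ 0])

lemma Hoelder_Suc_deriv:
  "x \<in> H (Suc n) \<Longrightarrow> t \<in> {a..b} \<Longrightarrow> (x has_vector_derivative D x t) (at t within {a..b})"
  by (simp add: Hoelder_Suc_iff)

lemma Hoelder_D: "x \<in> H (Suc n) \<Longrightarrow> D x \<in> H n"
  by (simp add: Hoelder_Suc_iff)

lemma supnorm_upper:
  assumes "continuous_on {a..b} x" "t \<in> {a..b}"
  shows "cmod (x t) \<le> supnorm x"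
proof -
  have "compact ((\<lambda>t. cmod (x t)) ` {a..b})"
    by (intro compact_continuous_image continuous_intros assms) auto
  then show ?thesis unfolding supnorm_def
    by (intro cSup_upper) (use assms in \<open>auto intro: bounded_imp_bdd_above compact_imp_bounded\<close>)
qed

lemma supnorm_least:
  assumes "\<And>t. t \<in> {a..b} \<Longrightarrow> cmod (x t) \<le> C"
  shows "supnorm x \<le> C"
  unfolding supnorm_def by (rule cSup_least) (use a_less_b assms in auto)

lemma supnorm_nonneg: "continuous_on {a..b} x \<Longrightarrow> 0 \<le> supnorm x"
  using supnorm_upper[of x a] a_less_b norm_ge_zero[of "x a"] by (smt (verit) atLeastAtMost_iff)

lemma seminorm_upper:
  assumes "x \<in> H 0" "a \<le> s" "s < t" "t \<le> b"
  shows "cmod (x t - x s) \<le> seminorm x * (t - s) powr \<alpha>"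
proof -
  have "cmod (x t - x s) / \<bar>t - s\<bar> powr \<alpha> \<in> quotients x"
    unfolding quotients_def mem_Collect_eq by (rule exI[of _ s], rule exI[of _ t]) (use assms in simp)
  then have "cmod (x t - x s) / \<bar>t - s\<bar> powr \<alpha> \<le> seminorm x"
    unfolding seminorm_def using assms(1) by (intro cSup_upper) (auto simp: Hoelder_0_iff)
  then show ?thesis using assms by (simp add: pos_divide_le_eq)
qed

lemma seminorm_nonneg:
  assumes "x \<in> H 0"
  shows "0 \<le> seminorm x"
proof -
  have "0 \<le> seminorm x * (b - a) powr \<alpha>"
    using seminorm_upper[OF assms order_refl a_less_b order_refl] norm_ge_zero order_trans by blast
  then show ?thesis using a_less_b by (auto simp: zero_le_mult_iff)
qed

lemma continuous_on_of_hoelder_condition: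
  assumes "\<And>s t. a \<le> s \<Longrightarrow> s < t \<Longrightarrow> t \<le> b \<Longrightarrow> cmod (x t - x s) \<le> C * (t - s) powr \<alpha>"
  shows "continuous_on {a..b} x"
  unfolding continuous_on_def
proof
  fix t assume t: "t \<in> {a..b}"
  have "((\<lambda>s. C * \<bar>s - t\<bar> powr \<alpha>) \<longlongrightarrow> C * \<bar>t - t\<bar> powr \<alpha>) (at t within {a..b})"
    using exponent_pos by (intro tendsto_intros tendsto_powr') auto
  then have lim: "((\<lambda>s. C * \<bar>s - t\<bar> powr \<alpha>) \<longlongrightarrow> 0) (at t within {a..b})" by simp
  have "norm (x s - x t) \<le> C * \<bar>s - t\<bar> powr \<alpha>" if "s \<in> {a..b}" for s
    using assms[of s t] assms[of t s] that t
    by (cases s t rule: linorder_cases) (auto simp: norm_minus_commute)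
  then have "\<forall>\<^sub>F s in at t within {a..b}. norm (x s - x t) \<le> C * \<bar>s - t\<bar> powr \<alpha>"
    by (simp add: eventually_at_filter)
  then have "((\<lambda>s. x s - x t) \<longlongrightarrow> 0) (at t within {a..b})" by (rule Lim_null_comparison[OF _ lim])
  then show "(x \<longlongrightarrow> x t) (at t within {a..b})" by (simp add: LIM_zero_iff)
qed

lemma Hoelder_0I:
  assumes outside: "\<And>t. t \<notin> {a..b} \<Longrightarrow> x t = 0"
    and bound: "\<And>t. t \<in> {a..b} \<Longrightarrow> cmod (x t) \<le> C1"
    and hoelder: "\<And>s t. a \<le> s \<Longrightarrow> s < t \<Longrightarrow> t \<le> b \<Longrightarrow> cmod (x t - x s) \<le> C2 * (t - s) powr \<alpha>"
  shows "x \<in> H 0" "hnorm 0 x \<le> C1 + C2"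
proof -
  have le: "r \<le> C2" if "r \<in> quotients x" for r
    using that hoelder unfolding quotients_def by (force simp: pos_divide_le_eq)
  then have "bdd_above (quotients x)" by (rule bdd_aboveI)
  then show "x \<in> H 0"
    using outside continuous_on_of_hoelder_condition[OF hoelder] by (simp add: Hoelder_0_iff)
  have "quotients x \<noteq> {}" using a_less_b by (auto simp: quotients_def)
  then have "seminorm x \<le> C2" unfolding seminorm_def using le by (rule cSup_least)
  moreover have "supnorm x \<le> C1" using bound by (rule supnorm_least)
  ultimately show "hnorm 0 x \<le> C1 + C2" by (simp add: hnorm_0)
qed

lemma Hoelder_SucI:
  assumes outside: "\<And>t. t \<notin> {a..b} \<Longrightarrow> x t = 0"
    and deriv: "\<And>t. t \<in> {a..b} \<Longrightarrow> (x has_vector_derivative d t) (at t within {a..b})"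
    and d: "d \<in> H n" "hnorm n d \<le> C2"
    and bound: "\<And>t. t \<in> {a..b} \<Longrightarrow> cmod (x t) \<le> C1"
  shows "x \<in> H (Suc n)" "hnorm (Suc n) x \<le> C1 + C2"
proof -
  have "D x = d" using deriv Hoelder_outside[OF d(1)] by (intro D_eqI) auto
  moreover have "supnorm x \<le> C1" using bound by (rule supnorm_least)
  ultimately show "x \<in> H (Suc n)" "hnorm (Suc n) x \<le> C1 + C2"
    using outside deriv d by (auto simp: Hoelder_Suc_iff hnorm_Suc)
qed

subsection \<open>The spaces are complete normed algebras\<close>

lemma norm_le_hnorm: "x \<in> H n \<Longrightarrow> cmod (x t) \<le> hnorm n x"
proof (induction n arbitrary: x)
  case 0
  then show ?case
    using supnorm_upper[OF Hoelder_continuous, of x 0 t] supnorm_nonneg[OF Hoelder_continuous, of x 0]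
      Hoelder_outside[of x 0 t] seminorm_nonneg[of x] by (cases "t \<in> {a..b}") (auto simp: hnorm_0)
next
  case (Suc n)
  have "0 \<le> hnorm n (D x)" using Suc.IH[OF Hoelder_D[OF Suc.prems]] norm_ge_zero order_trans by blast
  then show ?case
    using supnorm_upper[OF Hoelder_continuous[OF Suc.prems], of t]
      supnorm_nonneg[OF Hoelder_continuous[OF Suc.prems]] Hoelder_outside[OF Suc.prems, of t]
    by (cases "t \<in> {a..b}") (auto simp: hnorm_Suc)
qed

lemma Hoelder_zero: "0 \<in> H n"
proof (induction n)
  case 0
  show "0 \<in> H 0" by (rule Hoelder_0I(1)[of 0 0 0]) simp_all
next
  case (Suc n)
  have deriv: "(0 has_vector_derivative 0 t) (at t within {a..b})" for t
    using has_vector_derivative_const[of 0] by (simp add: zero_fun_def)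
  show "0 \<in> H (Suc n)" by (rule Hoelder_SucI(1)[OF _ deriv Suc order_refl, of 0]) simp_all
qed

lemma Hoelder_0_lincomb:
  assumes x: "x \<in> H 0" and y: "y \<in> H 0"
  shows "c *\<^sub>C x + d *\<^sub>C y \<in> H 0 \<and> hnorm 0 (c *\<^sub>C x + d *\<^sub>C y) \<le> cmod c * hnorm 0 x + cmod d * hnorm 0 y"
proof -
  have bound: "cmod ((c *\<^sub>C x + d *\<^sub>C y) t) \<le> cmod c * supnorm x + cmod d * supnorm y" if "t \<in> {a..b}" for t
    using that x y by (intro norm_lincomb_le supnorm_upper Hoelder_continuous)
  have hoelder: "cmod ((c *\<^sub>C x + d *\<^sub>C y) t - (c *\<^sub>C x + d *\<^sub>C y) s) \<le>
      (cmod c * seminorm x + cmod d * seminorm y) * (t - s) powr \<alpha>" if "a \<le> s" "s < t" "t \<le> b" for s t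
  proof -
    have "cmod ((c *\<^sub>C x + d *\<^sub>C y) t - (c *\<^sub>C x + d *\<^sub>C y) s) =
        cmod ((c *\<^sub>C (\<lambda>u. x u - x s) + d *\<^sub>C (\<lambda>u. y u - y s)) t)"
      by (simp add: scaleC_complex_def algebra_simps)
    also have "\<dots> \<le> cmod c * (seminorm x * (t - s) powr \<alpha>) + cmod d * (seminorm y * (t - s) powr \<alpha>)"
      using that x y by (intro norm_lincomb_le seminorm_upper)
    finally show ?thesis by (simp add: algebra_simps)
  qed
  have outside: "(c *\<^sub>C x + d *\<^sub>C y) t = 0" if "t \<notin> {a..b}" for t
    using Hoelder_outside[OF x that] Hoelder_outside[OF y that] by simp
  show ?thesis
    using Hoelder_0I[of "c *\<^sub>C x + d *\<^sub>C y", OF outside bound hoelder] by (simp add: hnorm_0 algebra_simps)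
qed

lemma Hoelder_lincomb:
  assumes "x \<in> H n" "y \<in> H n"
  shows "c *\<^sub>C x + d *\<^sub>C y \<in> H n \<and> hnorm n (c *\<^sub>C x + d *\<^sub>C y) \<le> cmod c * hnorm n x + cmod d * hnorm n y"
  using assms
proof (induction n arbitrary: x y)
  case 0
  then show ?case by (rule Hoelder_0_lincomb)
next
  case (Suc n)
  note x = Suc.prems(1) and y = Suc.prems(2)
  note IH = Suc.IH[OF Hoelder_D[OF x] Hoelder_D[OF y]]
  have bound: "cmod ((c *\<^sub>C x + d *\<^sub>C y) t) \<le> cmod c * supnorm x + cmod d * supnorm y" if "t \<in> {a..b}" for t
    using that x y by (intro norm_lincomb_le supnorm_upper Hoelder_continuous)
  have deriv: "(c *\<^sub>C x + d *\<^sub>C y has_vector_derivative (c *\<^sub>C D x + d *\<^sub>C D y) t) (at t within {a..b})"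
    if "t \<in> {a..b}" for t
    unfolding plus_fun_def scaleC_fun_def scaleC_complex_def
    by (intro derivative_intros Hoelder_Suc_deriv[OF x] Hoelder_Suc_deriv[OF y] that)
  have outside: "(c *\<^sub>C x + d *\<^sub>C y) t = 0" if "t \<notin> {a..b}" for t
    using Hoelder_outside[OF x that] Hoelder_outside[OF y that] by simp
  show "c *\<^sub>C x + d *\<^sub>C y \<in> H (Suc n) \<and>
      hnorm (Suc n) (c *\<^sub>C x + d *\<^sub>C y) \<le> cmod c * hnorm (Suc n) x + cmod d * hnorm (Suc n) y"
    using Hoelder_SucI[of "c *\<^sub>C x + d *\<^sub>C y", OF outside deriv conjunct1[OF IH] conjunct2[OF IH] bound]
    by (simp add: hnorm_Suc algebra_simps)
qed

sublocale H: normed_subspace "H n" "hnorm n" for n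
proof
  fix x y and c :: complex assume x: "x \<in> H n"
  show "c *\<^sub>C x \<in> H n" "hnorm n (c *\<^sub>C x) \<le> cmod c * hnorm n x"
    using Hoelder_lincomb[OF x x, of c 0] by auto
  show "x = 0" if "hnorm n x = 0"
    using norm_le_hnorm[OF x] that by (simp add: fun_eq_iff)
  assume y: "y \<in> H n"
  show "x + y \<in> H n" "hnorm n (x + y) \<le> hnorm n x + hnorm n y"
    using Hoelder_lincomb[OF x y, of 1 1] by (auto simp: scaleC_one)
qed (rule Hoelder_zero)

abbreviation "bounded_op n k \<equiv> bounded_operator (H n) (hnorm n) (H k) (hnorm k)"

lemma bounded_opI:
  assumes "\<And>x. x \<in> H n \<Longrightarrow> T x \<in> H k" "\<And>x. x \<in> H n \<Longrightarrow> hnorm k (T x) \<le> c * hnorm n x"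
    and "\<And>x y. x \<in> H n \<Longrightarrow> y \<in> H n \<Longrightarrow> T (x + y) = T x + T y"
    and "\<And>x c. x \<in> H n \<Longrightarrow> T (c *\<^sub>C x) = c *\<^sub>C T x"
  shows "bounded_op n k T"
  using bounded_operatorI[OF H.normed_subspace_axioms H.normed_subspace_axioms] assms by blast

lemma hnorm_D_le: "x \<in> H (Suc n) \<Longrightarrow> hnorm n (D x) \<le> hnorm (Suc n) x"
  using supnorm_nonneg[OF Hoelder_continuous] by (simp add: hnorm_Suc)

lemma D_bounded: "bounded_op (Suc n) n D"
proof (rule bounded_opI)
  show "hnorm n (D x) \<le> 1 * hnorm (Suc n) x" if "x \<in> H (Suc n)" for x
    using hnorm_D_le[OF that] by simp
  show "D (x + y) = D x + D y" if "x \<in> H (Suc n)" "y \<in> H (Suc n)" for x y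
    unfolding plus_fun_def using that
    by (intro D_eqI derivative_intros Hoelder_Suc_deriv) (auto simp: D_outside)
  show "D (c *\<^sub>C x) = c *\<^sub>C D x" if "x \<in> H (Suc n)" for x c
    unfolding scaleC_fun_def scaleC_complex_def using that
    by (intro D_eqI derivative_intros Hoelder_Suc_deriv) (auto simp: D_outside)
qed (rule Hoelder_D)

lemma lipschitz_le_hoelder:
  assumes "0 \<le> C" "a \<le> s" "s < t" "t \<le> b"
  shows "C * (t - s) \<le> C * (b - a) powr (1 - \<alpha>) * (t - s) powr \<alpha>"
proof -
  have "t - s = (t - s) powr (1 - \<alpha>) * (t - s) powr \<alpha>"
    using assms by (simp flip: powr_add)
  also have "\<dots> \<le> (b - a) powr (1 - \<alpha>) * (t - s) powr \<alpha>"
    using assms exponent_le by (intro mult_right_mono powr_mono2) auto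
  finally show ?thesis using assms(1) by (metis mult.assoc mult_left_mono)
qed

lemma Hoelder_0_of_bounded_derivative:
  assumes outside: "\<And>t. t \<notin> {a..b} \<Longrightarrow> x t = 0"
    and deriv: "\<And>t. t \<in> {a..b} \<Longrightarrow> (x has_vector_derivative d t) (at t within {a..b})"
    and d: "\<And>t. t \<in> {a..b} \<Longrightarrow> cmod (d t) \<le> C"
    and bound: "\<And>t. t \<in> {a..b} \<Longrightarrow> cmod (x t) \<le> C1"
  shows "x \<in> H 0" "hnorm 0 x \<le> C1 + C * (b - a) powr (1 - \<alpha>)"
proof -
  have "cmod (x t - x s) \<le> C * (b - a) powr (1 - \<alpha>) * (t - s) powr \<alpha>" if "a \<le> s" "s < t" "t \<le> b" for s t
  proof -
    have "cmod (x t - x s) \<le> C * norm (t - s)"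
    proof (rule differentiable_bound[where S = "{a..b}" and f = x])
      show "(x has_derivative (\<lambda>h. h *\<^sub>R d u)) (at u within {a..b})" if "u \<in> {a..b}" for u
        using deriv[OF that] by (simp add: has_vector_derivative_def)
      show "onorm (\<lambda>h. h *\<^sub>R d u) \<le> C" if "u \<in> {a..b}" for u
        using d[OF that] by (intro onorm_le) (simp add: mult.commute[of C] mult_left_mono)
    qed (use that in auto)
    moreover have "0 \<le> C" using order_trans[OF norm_ge_zero d[of a]] a_less_b by simp
    ultimately show ?thesis using lipschitz_le_hoelder[OF _ that, of C] that by simp
  qed
  from Hoelder_0I[OF outside bound this]
  show "x \<in> H 0" "hnorm 0 x \<le> C1 + C * (b - a) powr (1 - \<alpha>)" by auto
qed

definition embed_const :: real where "embed_const = 1 + (b - a) powr (1 - \<alpha>)"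

lemma embed_const_ge_1: "1 \<le> embed_const"
  by (simp add: embed_const_def)

lemma Hoelder_Suc_subset:
  "x \<in> H (Suc n) \<Longrightarrow> x \<in> H n \<and> hnorm n x \<le> embed_const * hnorm (Suc n) x"
proof (induction n arbitrary: x)
  case 0
  note cont = Hoelder_continuous[OF 0] Hoelder_continuous[OF Hoelder_D[OF 0]]
  have "x \<in> H 0" "hnorm 0 x \<le> supnorm x + hnorm 0 (D x) * (b - a) powr (1 - \<alpha>)"
    using Hoelder_0_of_bounded_derivative[OF Hoelder_outside[OF 0] Hoelder_Suc_deriv[OF 0]
        norm_le_hnorm[OF Hoelder_D[OF 0]] supnorm_upper[OF cont(1)]] by auto
  moreover have "supnorm x + hnorm 0 (D x) * (b - a) powr (1 - \<alpha>) \<le> embed_const * hnorm (Suc 0) x"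
    using supnorm_nonneg[OF cont(1)] H.nrm_nonneg[OF Hoelder_D[OF 0]]
    by (simp add: hnorm_Suc embed_const_def algebra_simps)
  ultimately show ?case by simp
next
  case (Suc n)
  have D: "D x \<in> H n" "hnorm n (D x) \<le> embed_const * hnorm (Suc n) (D x)"
    using Suc.IH[of "D x"] Hoelder_D[OF Suc.prems] by auto
  have "x \<in> H (Suc n)" using Suc.prems D(1) by (auto simp: Hoelder_Suc_iff[of x])
  moreover have "supnorm x \<le> embed_const * supnorm x"
    using embed_const_ge_1 supnorm_nonneg[OF Hoelder_continuous[OF Suc.prems]] mult_right_mono by fastforce
  ultimately show ?case
    using D(2) unfolding hnorm_Suc[of n x] hnorm_Suc[of "Suc n" x] by (simp add: distrib_left)
qed

lemma inclusion_bounded: "n \<le> k \<Longrightarrow> bounded_op k n id"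
proof (induction k rule: dec_induct)
  case base
  show ?case by (rule bounded_operator_id[OF H.normed_subspace_axioms])
next
  case (step k)
  have "bounded_op (Suc k) k id"
    by (rule bounded_opI[where c = embed_const]) (use Hoelder_Suc_subset in auto)
  from bounded_operator_comp[OF this step.IH] show ?case by simp
qed

lemma funpow_D_bounded: "k \<le> j \<Longrightarrow> bounded_op (n + j) n (D ^^ k)"
proof (induction k arbitrary: j)
  case 0
  then show ?case using inclusion_bounded[of n "n + j"] by (simp add: id_def)
next
  case (Suc k)
  then obtain i where i: "j = Suc i" "k \<le> i" by (metis Suc_le_D Suc_le_mono)
  show ?case
    unfolding i(1) add_Suc_right funpow_Suc_right
    by (rule bounded_operator_comp[OF D_bounded Suc.IH[OF i(2)]])
qed

primrec mult_const :: "nat \<Rightarrow> real" where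
  "mult_const 0 = 1"
| "mult_const (Suc n) = 1 + 2 * mult_const n * embed_const"

lemma mult_const_ge_1: "1 \<le> mult_const n"
  by (induction n) (use embed_const_ge_1 in auto)

lemma Hoelder_0_mult:
  assumes x: "x \<in> H 0" and y: "y \<in> H 0"
  shows "x * y \<in> H 0" "hnorm 0 (x * y) \<le> hnorm 0 x * hnorm 0 y"
proof -
  note sup = supnorm_upper[OF Hoelder_continuous[OF x]] supnorm_upper[OF Hoelder_continuous[OF y]]
  note nonneg = supnorm_nonneg[OF Hoelder_continuous[OF x]] supnorm_nonneg[OF Hoelder_continuous[OF y]]
    seminorm_nonneg[OF x] seminorm_nonneg[OF y]
  have bound: "cmod ((x * y) t) \<le> supnorm x * supnorm y" if "t \<in> {a..b}" for t
    using sup[OF that] nonneg by (auto simp: norm_mult intro!: mult_mono)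
  have hoelder: "cmod ((x * y) t - (x * y) s) \<le>
      (supnorm x * seminorm y + seminorm x * supnorm y) * (t - s) powr \<alpha>"
    if "a \<le> s" "s < t" "t \<le> b" for s t
  proof -
    have "cmod ((x * y) t - (x * y) s) = cmod (x t * (y t - y s) + (x t - x s) * y s)"
      by (simp add: algebra_simps)
    also have "\<dots> \<le> cmod (x t) * cmod (y t - y s) + cmod (x t - x s) * cmod (y s)"
      by (metis norm_mult norm_triangle_ineq)
    also have "\<dots> \<le> supnorm x * (seminorm y * (t - s) powr \<alpha>) + seminorm x * (t - s) powr \<alpha> * supnorm y"
      using that nonneg by (intro add_mono mult_mono seminorm_upper x y sup) auto
    finally show ?thesis by (simp add: algebra_simps)
  qed
  note product = Hoelder_0I[of "x * y", OF _ bound hoelder]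
  show "x * y \<in> H 0" using product(1) Hoelder_outside[OF x] by simp
  have "hnorm 0 (x * y) \<le> supnorm x * supnorm y + (supnorm x * seminorm y + seminorm x * supnorm y)"
    using product(2) Hoelder_outside[OF x] by simp
  also have "\<dots> \<le> hnorm 0 x * hnorm 0 y" using nonneg by (simp add: hnorm_0 algebra_simps)
  finally show "hnorm 0 (x * y) \<le> hnorm 0 x * hnorm 0 y" .
qed

lemma Hoelder_mult:
  assumes "x \<in> H n" "y \<in> H n"
  shows "x * y \<in> H n \<and> hnorm n (x * y) \<le> mult_const n * hnorm n x * hnorm n y"
  using assms
proof (induction n arbitrary: x y)
  case 0
  then show ?case unfolding mult_const.simps mult_1 using Hoelder_0_mult by blast
next
  case (Suc n)
  let ?X = "hnorm (Suc n) x" and ?Y = "hnorm (Suc n) y"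
  note x = Suc.prems(1) and y = Suc.prems(2)
  have deriv: "(x * y has_vector_derivative (x * D y + D x * y) t) (at t within {a..b})" if "t \<in> {a..b}" for t
    unfolding times_fun_def plus_fun_def
    using has_vector_derivative_mult[OF Hoelder_Suc_deriv[OF x that] Hoelder_Suc_deriv[OF y that]] .
  have bound: "cmod ((x * y) t) \<le> ?X * ?Y" for t
    using norm_le_hnorm[OF x, of t] norm_le_hnorm[OF y, of t]
    by (simp add: norm_mult mult_mono H.nrm_nonneg[OF x])
  have factor: "u * v \<in> H n" "hnorm n (u * v) \<le> mult_const n * embed_const * ?X * ?Y"
    if "u \<in> H n" "v \<in> H n" "hnorm n u * hnorm n v \<le> embed_const * (?X * ?Y)" for u v
  proof -
    show "u * v \<in> H n" using Suc.IH that by blast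
    have "hnorm n (u * v) \<le> mult_const n * (hnorm n u * hnorm n v)"
      unfolding mult.assoc[symmetric] using Suc.IH that by blast
    also have "\<dots> \<le> mult_const n * (embed_const * (?X * ?Y))"
      using mult_const_ge_1[of n] by (intro mult_left_mono that(3)) simp
    finally show "hnorm n (u * v) \<le> mult_const n * embed_const * ?X * ?Y" by (simp add: mult.assoc)
  qed
  have mem: "x \<in> H n" "D x \<in> H n" "y \<in> H n" "D y \<in> H n"
    using x y Hoelder_Suc_subset Hoelder_D by auto
  have "hnorm n x * hnorm n (D y) \<le> embed_const * ?X * ?Y"
    "hnorm n (D x) * hnorm n y \<le> ?X * (embed_const * ?Y)"
    using embed_const_ge_1 Hoelder_Suc_subset[OF x] Hoelder_Suc_subset[OF y] hnorm_D_le[OF x] hnorm_D_le[OF y]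
    by (intro mult_mono; simp add: H.nrm_nonneg mem x y)+
  then have terms: "x * D y \<in> H n" "hnorm n (x * D y) \<le> mult_const n * embed_const * ?X * ?Y"
    "D x * y \<in> H n" "hnorm n (D x * y) \<le> mult_const n * embed_const * ?X * ?Y"
    using factor[of x "D y"] factor[of "D x" y] mem by (auto simp: mult_ac)
  have "hnorm n (x * D y + D x * y) \<le> 2 * mult_const n * embed_const * ?X * ?Y"
    using H.nrm_add_le[OF terms(1,3)] terms(2,4) by linarith
  from Hoelder_SucI[OF _ deriv H.add_mem[OF terms(1,3)] this bound] show ?case
    using Hoelder_outside[OF x] by (auto simp: algebra_simps)
qed

subsection \<open>Integration\<close>

definition integ :: "(real \<Rightarrow> complex) \<Rightarrow> real \<Rightarrow> complex" where
  "integ x = (\<lambda>t. if t \<in> {a..b} then integral {a..t} x else 0)"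

lemma integ_outside: "t \<notin> {a..b} \<Longrightarrow> integ x t = 0"
  by (auto simp: integ_def)

lemma integ_start: "integ x a = 0"
  using a_less_b by (simp add: integ_def)

lemma integ_deriv:
  assumes "continuous_on {a..b} x" "t \<in> {a..b}"
  shows "(integ x has_vector_derivative x t) (at t within {a..b})"
  by (rule has_vector_derivative_transform[OF assms(2) _ integral_has_vector_derivative[OF assms]])
     (auto simp: integ_def)

lemma D_integ: "x \<in> H n \<Longrightarrow> D (integ x) = x"
  by (intro D_eqI integ_deriv Hoelder_continuous Hoelder_outside)

lemma integ_bound:
  assumes "continuous_on {a..b} x" "\<And>t. t \<in> {a..b} \<Longrightarrow> cmod (x t) \<le> C" "t \<in> {a..b}"
  shows "cmod (integ x t) \<le> C * (b - a)"
proof -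
  have "0 \<le> C" using order_trans[OF norm_ge_zero assms(2)[of a]] a_less_b by simp
  have "cmod (integral {a..t} x) \<le> C * (t - a)"
    by (rule integral_bound) (use assms in \<open>auto intro: continuous_on_subset\<close>)
  also have "\<dots> \<le> C * (b - a)" using assms(3) \<open>0 \<le> C\<close> by (intro mult_left_mono) auto
  finally show ?thesis using assms(3) by (simp add: integ_def)
qed

lemma integ_Hoelder:
  assumes "x \<in> H n"
  shows "integ x \<in> H (Suc n)" "hnorm (Suc n) (integ x) \<le> (1 + (b - a)) * hnorm n x"
  using Hoelder_SucI[OF integ_outside integ_deriv[OF Hoelder_continuous[OF assms]] assms order_refl
      integ_bound[OF Hoelder_continuous[OF assms] norm_le_hnorm[OF assms]]]
  by (auto simp: algebra_simps)

lemma integ_bounded: "bounded_op n (Suc n) integ"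
proof (rule bounded_opI[OF integ_Hoelder])
  have integrable: "x integrable_on {a..t}" if "x \<in> H n" "t \<in> {a..b}" for x t
    using that Hoelder_continuous
    by (auto intro!: integrable_continuous_real intro: continuous_on_subset[of "{a..b}"])
  show "integ (x + y) = integ x + integ y" if "x \<in> H n" "y \<in> H n" for x y
    using that integrable by (auto simp: integ_def fun_eq_iff integral_add plus_fun_def)
  show "integ (c *\<^sub>C x) = c *\<^sub>C integ x" if "x \<in> H n" for x c
    by (auto simp: integ_def fun_eq_iff scaleC_fun_def scaleC_complex_def)
qed

lemma funpow_integ_bounded: "bounded_op n (n + k) (integ ^^ k)"
proof (induction k)
  case 0
  show ?case using bounded_operator_id[OF H.normed_subspace_axioms, of n] by (simp add: id_def)
next
  case (Suc k)
  show ?case using bounded_operator_comp[OF Suc integ_bounded] by (simp add: o_def)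
qed

lemma integ_smoothing:
  assumes "x \<in> H 0" "\<And>t. t \<in> {a..b} \<Longrightarrow> cmod (x t) \<le> C"
  shows "hnorm 0 (integ x) \<le> C * (b - a + (b - a) powr (1 - \<alpha>))"
  using Hoelder_0_of_bounded_derivative(2)[OF integ_outside integ_deriv[OF Hoelder_continuous[OF assms(1)]]
      assms(2) integ_bound[OF Hoelder_continuous[OF assms(1)] assms(2)]]
  by (simp add: algebra_simps)

lemma integ_exp_bound:
  assumes "continuous_on {a..b} x" "\<And>t. t \<in> {a..b} \<Longrightarrow> cmod (x t) \<le> C * exp (\<kappa> * (t - a))"
    "t \<in> {a..b}" "0 < \<kappa>" "0 \<le> C"
  shows "cmod (integ x t) \<le> C / \<kappa> * exp (\<kappa> * (t - a))"
proof -
  have exp_integral: "((\<lambda>s. C * exp (\<kappa> * (s - a))) has_integral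
      (C / \<kappa> * exp (\<kappa> * (t - a)) - C / \<kappa> * exp (\<kappa> * (a - a)))) {a..t}"
    using assms
    by (intro fundamental_theorem_of_calculus)
       (auto intro!: derivative_eq_intros simp: has_real_derivative_iff_has_vector_derivative[symmetric])
  have "cmod (integral {a..t} x) \<le> integral {a..t} (\<lambda>s. C * exp (\<kappa> * (s - a)))"
    using assms exp_integral by (intro integral_norm_bound_integral integrable_continuous_real)
       (auto intro: continuous_on_subset intro!: continuous_intros)
  also have "\<dots> \<le> C / \<kappa> * exp (\<kappa> * (t - a))"
    unfolding integral_unique[OF exp_integral] using assms by simp
  finally show ?thesis using assms by (simp add: integ_def)
qed

lemma funpow_integ_exp_bound:
  assumes "x \<in> H n" "\<And>t. t \<in> {a..b} \<Longrightarrow> cmod (x t) \<le> C * exp (\<kappa> * (t - a))" "0 < \<kappa>" "0 \<le> C" "t \<in> {a..b}"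
  shows "cmod ((integ ^^ k) x t) \<le> C / \<kappa> ^ k * exp (\<kappa> * (t - a))"
  using assms(5)
proof (induction k arbitrary: t)
  case (Suc k)
  interpret bounded_operator "H n" "hnorm n" "H (n + k)" "hnorm (n + k)" "integ ^^ k"
    by (rule funpow_integ_bounded)
  show ?case
    using integ_exp_bound[OF Hoelder_continuous[OF maps[OF assms(1)]] Suc.IH Suc.prems assms(3)] assms
    by (simp add: mult.commute)
qed (use assms in simp)

text \<open>On \<open>[a, b]\<close> this is the function \<open>(t - a)\<^sup>k / k!\<close>.\<close>

definition monomial :: "nat \<Rightarrow> real \<Rightarrow> complex" where
  "monomial k = (integ ^^ k) (\<lambda>t. if t \<in> {a..b} then 1 else 0)"

lemma monomial_0: "monomial 0 t = (if t \<in> {a..b} then 1 else 0)"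
  by (simp add: monomial_def)

lemma monomial_Suc: "monomial (Suc k) = integ (monomial k)"
  by (simp add: monomial_def)

lemma monomial_start: "monomial k a = (if k = 0 then 1 else 0)"
  using a_less_b by (cases k) (auto simp: monomial_0 monomial_Suc integ_start)

lemma monomial_0_deriv: "t \<in> {a..b} \<Longrightarrow> (monomial 0 has_vector_derivative 0 t) (at t within {a..b})"
  by (rule has_vector_derivative_transform[of _ _ _ "\<lambda>t. 1"]) (auto simp: monomial_0)

lemma monomial_Hoelder: "monomial k \<in> H n"
proof (induction k arbitrary: n)
  case 0
  have "monomial 0 \<in> H (Suc n)"
    by (rule Hoelder_SucI(1)[OF _ monomial_0_deriv Hoelder_zero order_refl, of 1]) (auto simp: monomial_0)
  then show ?case using Hoelder_Suc_subset by blast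
next
  case (Suc k)
  then show ?case using integ_Hoelder(1) Hoelder_Suc_subset unfolding monomial_Suc by blast
qed

lemma D_monomial: "D (monomial k) = (if k = 0 then 0 else monomial (k - 1))"
proof (cases k)
  case 0
  then show ?thesis using D_eqI[of 0 "monomial 0"] monomial_0_deriv by simp
next
  case (Suc j)
  then show ?thesis using D_integ[OF monomial_Hoelder] by (simp add: monomial_Suc)
qed

lemma funpow_D_monomial: "(D ^^ j) (monomial k) = (if j \<le> k then monomial (k - j) else 0)"
proof (induction j)
  case (Suc j)
  have "D 0 = 0" by (rule D_eqI) (auto simp: zero_fun_def)
  then show ?case using Suc by (auto simp: D_monomial Suc_diff_le not_le less_Suc_eq_le)
qed simp

lemma Hoelder_Suc_decomposition:
  assumes "x \<in> H (Suc n)"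
  shows "x = x a *\<^sub>C monomial 0 + integ (D x)"
proof
  fix t
  show "x t = (x a *\<^sub>C monomial 0 + integ (D x)) t"
  proof (cases "t \<in> {a..b}")
    case True
    have "(D x has_integral x t - x a) {a..t}"
      using True by (intro fundamental_theorem_of_calculus)
        (auto intro: has_vector_derivative_within_subset[OF Hoelder_Suc_deriv[OF assms]])
    then show ?thesis using True by (simp add: integ_def integral_unique monomial_0 scaleC_complex_def)
  qed (use Hoelder_outside[OF assms] in \<open>auto simp: integ_def monomial_0 scaleC_complex_def\<close>)
qed

subsection \<open>Completeness\<close>

lemma convergent_pointwise:
  assumes x: "\<And>k. x k \<in> H n" and Cauchy: "\<And>e. 0 < e \<Longrightarrow> \<exists>M. \<forall>k\<ge>M. \<forall>l\<ge>M. hnorm n (x k - x l) < e"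
  shows "convergent (\<lambda>k. x k t)"
  unfolding Cauchy_convergent_iff[symmetric]
proof (rule metric_CauchyI)
  fix e :: real assume "0 < e"
  then obtain M where M: "\<forall>k\<ge>M. \<forall>l\<ge>M. hnorm n (x k - x l) < e" using Cauchy by blast
  have "dist (x k t) (x l t) \<le> hnorm n (x k - x l)" for k l
    using norm_le_hnorm[OF H.diff_mem[OF x x], of k l t] by (simp add: dist_norm)
  then show "\<exists>M. \<forall>k\<ge>M. \<forall>l\<ge>M. dist (x k t) (x l t) < e" using M le_less_trans by blast
qed

lemma hnorm_0_diff_pointwise_limit:
  assumes u: "u \<in> H 0" and x: "\<And>l. x l \<in> H 0" and w: "\<And>t. (\<lambda>l. x l t) \<longlonglongrightarrow> w t"
    and close: "\<And>l. M \<le> l \<Longrightarrow> hnorm 0 (u - x l) \<le> e"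
  shows "u - w \<in> H 0" "hnorm 0 (u - w) \<le> 2 * e"
proof -
  have diff: "u - x l \<in> H 0" for l by (intro H.diff_mem u x)
  have bound: "cmod ((u - w) t) \<le> e" for t
    using norm_le_of_tendsto[OF w[of t], of M "u t" e] order_trans[OF norm_le_hnorm[OF diff] close] by simp
  have hoelder: "cmod ((u - w) t - (u - w) s) \<le> e * (t - s) powr \<alpha>" if st: "a \<le> s" "s < t" "t \<le> b" for s t
  proof -
    have "cmod (u t - u s - (x l t - x l s)) \<le> e * (t - s) powr \<alpha>" if "M \<le> l" for l
    proof -
      have "seminorm (u - x l) \<le> e"
        using close[OF that] supnorm_nonneg[OF Hoelder_continuous[OF diff[of l]]] by (simp add: hnorm_0)
      then have "seminorm (u - x l) * (t - s) powr \<alpha> \<le> e * (t - s) powr \<alpha>" by (rule mult_right_mono) simp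
      then show ?thesis using seminorm_upper[OF diff st, of l] by (simp add: algebra_simps)
    qed
    from norm_le_of_tendsto[OF tendsto_diff[OF w w] this] show ?thesis by (simp add: algebra_simps)
  qed
  have outside: "(u - w) t = 0" if "t \<notin> {a..b}" for t
    using LIMSEQ_unique[OF w[of t], of 0] Hoelder_outside[OF x that] Hoelder_outside[OF u that] by simp
  show "u - w \<in> H 0" "hnorm 0 (u - w) \<le> 2 * e"
    using Hoelder_0I[of "u - w", OF outside bound hoelder] by simp_all
qed

lemma Hoelder_0_complete:
  assumes x: "\<And>k. x k \<in> H 0" and Cauchy: "\<And>e. 0 < e \<Longrightarrow> \<exists>M. \<forall>k\<ge>M. \<forall>l\<ge>M. hnorm 0 (x k - x l) < e"
  shows "\<exists>w\<in>H 0. (\<lambda>k. hnorm 0 (x k - w)) \<longlonglongrightarrow> 0"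
proof -
  have "\<forall>t. \<exists>w. (\<lambda>k. x k t) \<longlonglongrightarrow> w"
    using convergent_pointwise[OF x Cauchy] by (simp add: convergent_def)
  then obtain w where w: "\<And>t. (\<lambda>k. x k t) \<longlonglongrightarrow> w t" by metis
  have close: "\<exists>M. \<forall>k\<ge>M. x k - w \<in> H 0 \<and> hnorm 0 (x k - w) \<le> 2 * e" if e: "0 < e" for e
  proof -
    obtain M where "\<forall>k\<ge>M. \<forall>l\<ge>M. hnorm 0 (x k - x l) < e" using Cauchy[OF e] by blast
    then show ?thesis
      using hnorm_0_diff_pointwise_limit[OF x x w, of M _ e] by (intro exI[of _ M]) (simp add: less_imp_le)
  qed
  obtain k where "x k - w \<in> H 0" using close[of 1] by auto
  from H.diff_mem[OF x[of k] this] have "w \<in> H 0" by simp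
  moreover have "(\<lambda>k. hnorm 0 (x k - w)) \<longlonglongrightarrow> 0"
  proof (rule LIMSEQ_I)
    fix e :: real assume "0 < e"
    then obtain M where "\<forall>k\<ge>M. x k - w \<in> H 0 \<and> hnorm 0 (x k - w) \<le> 2 * (e / 3)"
      using close[of "e / 3"] by auto
    then show "\<exists>M. \<forall>k\<ge>M. norm (hnorm 0 (x k - w) - 0) < e"
      using \<open>0 < e\<close> H.nrm_nonneg by (intro exI[of _ M]) fastforce
  qed
  ultimately show ?thesis by blast
qed

lemma hnorm_Suc_diff_le:
  assumes x: "x \<in> H (Suc n)" and d: "d \<in> H n"
  shows "hnorm (Suc n) (x - (c *\<^sub>C monomial 0 + integ d)) \<le>
    cmod (x a - c) * hnorm (Suc n) (monomial 0) + (1 + (b - a)) * hnorm n (D x - d)"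
proof -
  interpret integ: bounded_operator "H n" "hnorm n" "H (Suc n)" "hnorm (Suc n)" integ by (rule integ_bounded)
  have Dd: "D x - d \<in> H n" by (intro H.diff_mem Hoelder_D x d)
  have "x - (c *\<^sub>C monomial 0 + integ d) = (x a - c) *\<^sub>C monomial 0 + integ (D x - d)"
    using Hoelder_Suc_decomposition[OF x] integ.diff[OF Hoelder_D[OF x] d]
    by (simp add: complex_vector.scale_left_diff_distrib)
  then have "hnorm (Suc n) (x - (c *\<^sub>C monomial 0 + integ d)) \<le>
      hnorm (Suc n) ((x a - c) *\<^sub>C monomial 0) + hnorm (Suc n) (integ (D x - d))"
    using H.nrm_add_le[OF H.scaleC_mem[OF monomial_Hoelder] integ.maps[OF Dd]] by simp
  then show ?thesis using integ_Hoelder(2)[OF Dd] H.nrm_scaleC[OF monomial_Hoelder] by simp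
qed

lemma Hoelder_complete:
  assumes "\<And>k. x k \<in> H n" "\<And>e. 0 < e \<Longrightarrow> \<exists>M. \<forall>k\<ge>M. \<forall>l\<ge>M. hnorm n (x k - x l) < e"
  shows "\<exists>w\<in>H n. (\<lambda>k. hnorm n (x k - w)) \<longlonglongrightarrow> 0"
  using assms
proof (induction n arbitrary: x)
  case 0
  then show ?case by (rule Hoelder_0_complete)
next
  case (Suc n)
  interpret D: bounded_operator "H (Suc n)" "hnorm (Suc n)" "H n" "hnorm n" D by (rule D_bounded)
  note x = Suc.prems(1) and Cauchy = Suc.prems(2)
  have "hnorm n (D (x k) - D (x l)) \<le> hnorm (Suc n) (x k - x l)" for k l
    using hnorm_D_le[OF H.diff_mem[OF x x]] D.diff[OF x x] by simp
  then have "\<exists>M. \<forall>k\<ge>M. \<forall>l\<ge>M. hnorm n (D (x k) - D (x l)) < e" if "0 < e" for e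
    using Cauchy[OF that] by (meson le_less_trans)
  from Suc.IH[OF Hoelder_D[OF x] this] obtain d where
    d: "d \<in> H n" "(\<lambda>k. hnorm n (D (x k) - d)) \<longlonglongrightarrow> 0" by blast
  obtain c where c: "(\<lambda>k. x k a) \<longlonglongrightarrow> c"
    using convergent_pointwise[OF x Cauchy, of a] by (auto simp: convergent_def)
  define w where "w = c *\<^sub>C monomial 0 + integ d"
  have w: "w \<in> H (Suc n)" unfolding w_def by (intro H.add_mem H.scaleC_mem monomial_Hoelder integ_Hoelder d)
  let ?bound = "\<lambda>k. cmod (x k a - c) * hnorm (Suc n) (monomial 0) + (1 + (b - a)) * hnorm n (D (x k) - d)"
  have "?bound \<longlonglongrightarrow> 0 * hnorm (Suc n) (monomial 0) + (1 + (b - a)) * 0"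
    using c by (intro tendsto_intros d tendsto_norm_zero) (simp add: LIM_zero)
  then have "?bound \<longlonglongrightarrow> 0" by simp
  moreover have "norm (hnorm (Suc n) (x k - w)) \<le> ?bound k" for k
    using hnorm_Suc_diff_le[OF x d(1)] H.nrm_nonneg[OF H.diff_mem[OF x w]] by (simp add: w_def)
  ultimately have "(\<lambda>k. hnorm (Suc n) (x k - w)) \<longlonglongrightarrow> 0"
    by (rule Lim_null_comparison[OF always_eventually[OF allI], rotated])
  then show ?case using w by blast
qed

sublocale H: banach_subspace "H n" "hnorm n" for n
  by unfold_locales (rule Hoelder_complete)

end

section \<open>Linear differential systems on vector-valued Hoelder spaces\<close>

lemma VHoelder_eq_tuples: "VHoelder m n \<alpha> a b = tuples m (Hoelder n \<alpha> a b)"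
  by (simp add: VHoelder_def tuples_def zero_fun_def)

lemma vnorm_eq_tuple_norm: "vnorm m n \<alpha> a b = tuple_norm m (hoelder_norm n \<alpha> a b)"
  by (simp add: vnorm_def tuple_norm_def fun_eq_iff)

lemma MHoelder_eq_tuples: "MHoelder m n \<alpha> a b = tuples m (tuples m (Hoelder n \<alpha> a b))"
  by (auto simp: MHoelder_def tuples_def zero_fun_def fun_eq_iff not_less) (metis not_less)+

lemma mnorm_eq_tuple_norm: "mnorm m n \<alpha> a b = tuple_norm m (tuple_norm m (hoelder_norm n \<alpha> a b))"
  by (simp add: mnorm_def tuple_norm_def fun_eq_iff)

lemma geometric_bound_of_Suc:
  fixes x :: "nat \<Rightarrow> real"
  assumes "0 \<le> c" "0 \<le> y" "x 0 \<le> y" and Suc_le: "\<And>j. x (Suc j) \<le> c / 2 ^ j * y"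
  shows "x j \<le> (1 + 2 * c) / 2 ^ j * y"
proof (cases j)
  case 0
  have "1 * y \<le> (1 + 2 * c) * y" using assms(1,2) by (intro mult_right_mono) auto
  then show ?thesis using 0 assms(3) by simp
next
  case (Suc i)
  have "2 * c / 2 ^ Suc i * y \<le> (1 + 2 * c) / 2 ^ Suc i * y"
    using assms(2) by (intro mult_right_mono divide_right_mono) auto
  then show ?thesis using Suc Suc_le[of i] by simp
qed

lemma discrete_gronwall:
  fixes x :: "nat \<Rightarrow> real"
  assumes g: "0 \<le> g" and le: "\<And>j. j < r \<Longrightarrow> x j \<le> C + g * (\<Sum>k<j. x k)" and "j < r"
  shows "x j \<le> C * (1 + g) ^ j"
  using assms(3)
proof (induction j rule: less_induct)
  case (less j)
  have "x j \<le> C + g * (\<Sum>k<j. x k)" by (rule le[OF less.prems])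
  also have "\<dots> \<le> C + g * (\<Sum>k<j. C * (1 + g) ^ k)"
    using less by (intro add_left_mono mult_left_mono sum_mono g) auto
  also have "g * (\<Sum>k<j. C * (1 + g) ^ k) = C * ((1 + g) ^ j - 1)"
    using power_diff_1_eq[of "1 + g" j] by (simp add: sum_distrib_left mult_ac)
  finally show ?case by (simp add: algebra_simps)
qed

type_synonym vec_fun = "nat \<Rightarrow> real \<Rightarrow> complex"
type_synonym mat_fun = "nat \<Rightarrow> nat \<Rightarrow> real \<Rightarrow> complex"

locale hoelder_system = hoelder_interval +
  fixes m r :: nat
begin

abbreviation "VH n \<equiv> tuples m (H n)"
abbreviation "vn n \<equiv> tuple_norm m (hnorm n)"
abbreviation "MH n \<equiv> tuples m (VH n)"
abbreviation "mn n \<equiv> tuple_norm m (vn n)"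

sublocale VH: banach_subspace "VH n" "vn n" for n
  by (rule H.banach_subspace_tuples)

sublocale MH: normed_subspace "MH n" "mn n" for n
  by (rule VH.normed_subspace_tuples)

abbreviation "bounded_vec_op n k \<equiv> bounded_operator (VH n) (vn n) (VH k) (vn k)"

lemma norm_le_vn: "y \<in> VH n \<Longrightarrow> cmod (y i t) \<le> vn n y"
  using norm_le_hnorm[OF H.tuples_component] H.nrm_component_le order_trans by blast

lemma matrix_entry: "M \<in> MH n \<Longrightarrow> M i l \<in> H n"
  using VH.tuples_component H.tuples_component by blast

definition mv :: "mat_fun \<Rightarrow> vec_fun \<Rightarrow> vec_fun" where
  "mv M y = (\<lambda>i. \<Sum>l<m. M i l * y l)"

lemma mv_mem:
  assumes "M \<in> MH n" "y \<in> VH n"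
  shows "mv M y \<in> VH n"
proof (rule tuplesI)
  show "mv M y i \<in> H n" for i
    unfolding mv_def using Hoelder_mult matrix_entry[OF assms(1)] H.tuples_component[OF assms(2)]
    by (intro H.sum_mem) blast
  show "mv M y i = 0" if "m \<le> i" for i
    using tuples_beyond[OF assms(1) that] by (simp add: mv_def)
qed

lemma vn_mv_le:
  assumes M: "M \<in> MH n" and y: "y \<in> VH n"
  shows "vn n (mv M y) \<le> mult_const n * mn n M * vn n y"
proof -
  note entry = matrix_entry[OF M] H.tuples_component[OF y]
  have "hnorm n (mv M y i) \<le> (\<Sum>l<m. mult_const n * hnorm n (M i l) * vn n y)" for i
  proof -
    have "hnorm n (mv M y i) \<le> (\<Sum>l<m. hnorm n (M i l * y l))"
      unfolding mv_def using Hoelder_mult entry by (intro H.nrm_sum_le) blast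
    also have "\<dots> \<le> (\<Sum>l<m. mult_const n * hnorm n (M i l) * hnorm n (y l))"
      using Hoelder_mult entry by (intro sum_mono) blast
    also have "\<dots> \<le> (\<Sum>l<m. mult_const n * hnorm n (M i l) * vn n y)"
      using mult_const_ge_1[of n]
      by (intro sum_mono mult_left_mono H.nrm_component_le y mult_nonneg_nonneg H.nrm_nonneg entry) simp
    finally show ?thesis .
  qed
  then have "vn n (mv M y) \<le> (\<Sum>i<m. \<Sum>l<m. mult_const n * hnorm n (M i l) * vn n y)"
    unfolding tuple_norm_def[of m "hnorm n" "mv M y"] by (intro sum_mono)
  also have "\<dots> = mult_const n * mn n M * vn n y"
    by (simp add: tuple_norm_def[of m _ M] tuple_norm_def[of m _ "M _"] sum_distrib_left
        sum_distrib_right mult_ac)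
  finally show ?thesis .
qed

lemma norm_mv_le:
  assumes M: "M \<in> MH n" and "\<And>l. cmod (y l t) \<le> C"
  shows "cmod (mv M y i t) \<le> mn n M * C"
proof -
  have C: "0 \<le> C" using order_trans[OF norm_ge_zero assms(2)] .
  have "cmod (mv M y i t) \<le> (\<Sum>l<m. cmod (M i l t * y l t))"
    by (simp add: mv_def sum_fun_apply norm_sum)
  also have "\<dots> \<le> (\<Sum>l<m. hnorm n (M i l) * C)"
    unfolding norm_mult
    by (intro sum_mono mult_mono norm_le_hnorm matrix_entry[OF M] assms(2) H.nrm_nonneg) auto
  also have "\<dots> = vn n (M i) * C" by (simp add: tuple_norm_def sum_distrib_right)
  also have "\<dots> \<le> mn n M * C" by (intro mult_right_mono VH.nrm_component_le M C)
  finally show ?thesis .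
qed

lemma mv_bounded:
  assumes "M \<in> MH n"
  shows "bounded_vec_op n n (mv M)"
proof (rule bounded_operatorI[OF VH.normed_subspace_axioms VH.normed_subspace_axioms])
  show "mv M (x + y) = mv M x + mv M y" for x y
    by (simp add: mv_def fun_eq_iff sum_fun_apply distrib_left sum.distrib)
  show "mv M (c *\<^sub>C x) = c *\<^sub>C mv M x" for x c
    by (simp add: mv_def fun_eq_iff sum_fun_apply scaleC_complex_def sum_distrib_left mult_ac)
qed (use assms in \<open>auto intro: mv_mem vn_mv_le\<close>)

lemma mv_comp_bounded:
  assumes M: "M \<in> MH n" and T: "bounded_op k n T"
  shows "bounded_vec_op k n (\<lambda>y. mv M (T \<circ> y))"
  using bounded_operator_comp[OF bounded_operator_tuples[OF T] mv_bounded[OF M]]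
  unfolding comp_def[of "mv M" "(\<circ>) T"] .

subsection \<open>The differential operator\<close>

definition lower_order :: "(nat \<Rightarrow> mat_fun) \<Rightarrow> vec_fun \<Rightarrow> vec_fun" where
  "lower_order A y = (\<Sum>k<r. mv (A k) ((D ^^ k) \<circ> y))"

definition L :: "(nat \<Rightarrow> mat_fun) \<Rightarrow> vec_fun \<Rightarrow> vec_fun" where
  "L A y = ((D ^^ r) \<circ> y) + lower_order A y"

abbreviation "coefficients n A \<equiv> \<forall>k<r. A k \<in> MH n"

lemma lower_order_bounded: "coefficients n A \<Longrightarrow> bounded_vec_op (n + r) n (lower_order A)"
  unfolding lower_order_def
  by (intro bounded_operator_sum VH.normed_subspace_axioms mv_comp_bounded funpow_D_bounded) auto

lemma L_bounded: "coefficients n A \<Longrightarrow> bounded_vec_op (n + r) n (L A)"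
  unfolding L_def
  by (intro bounded_operator_add bounded_operator_tuples funpow_D_bounded lower_order_bounded order_refl)

lemma L_diff_eq_lower_order: "L A y - L A' y = lower_order (\<lambda>k. A k - A' k) y"
  by (simp add: L_def lower_order_def mv_def fun_eq_iff sum_fun_apply left_diff_distrib sum_subtractf)

lemma vn_funpow_D_le:
  obtains c where "0 < c"
    "\<And>k y. k < r \<Longrightarrow> y \<in> VH (n + r) \<Longrightarrow> (D ^^ k) \<circ> y \<in> VH n \<and> vn n ((D ^^ k) \<circ> y) \<le> c * vn (n + r) y"
proof -
  have "\<exists>c\<ge>0. \<forall>y\<in>VH (n + r). (D ^^ k) \<circ> y \<in> VH n \<and> vn n ((D ^^ k) \<circ> y) \<le> c * vn (n + r) y"
    if "k < r" for k
  proof -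
    interpret bounded_operator "VH (n + r)" "vn (n + r)" "VH n" "vn n" "(\<circ>) (D ^^ k)"
      using that by (intro bounded_operator_tuples funpow_D_bounded) simp
    show ?thesis by (rule nonneg_bound) (use maps in blast)
  qed
  then obtain c where c: "\<And>k. k < r \<Longrightarrow> 0 \<le> c k" "\<And>k y. k < r \<Longrightarrow> y \<in> VH (n + r) \<Longrightarrow>
      (D ^^ k) \<circ> y \<in> VH n \<and> vn n ((D ^^ k) \<circ> y) \<le> c k * vn (n + r) y" by metis
  show thesis
  proof (rule that[of "1 + (\<Sum>k<r. c k)"])
    fix k y assume k: "k < r" and y: "y \<in> VH (n + r)"
    have "c k \<le> (\<Sum>k<r. c k)" using k c(1) by (intro member_le_sum) auto
    then have "c k * vn (n + r) y \<le> (1 + (\<Sum>k<r. c k)) * vn (n + r) y"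
      by (intro mult_right_mono VH.nrm_nonneg y) simp
    then show "(D ^^ k) \<circ> y \<in> VH n \<and> vn n ((D ^^ k) \<circ> y) \<le> (1 + (\<Sum>k<r. c k)) * vn (n + r) y"
      using c(2)[OF k y] by auto
  qed (use c(1) in \<open>intro add_pos_nonneg sum_nonneg, auto\<close>)
qed

lemma vn_lower_order_le:
  obtains c where "0 < c" "\<And>A y. coefficients n A \<Longrightarrow> y \<in> VH (n + r) \<Longrightarrow>
    vn n (lower_order A y) \<le> c * (\<Sum>k<r. mn n (A k)) * vn (n + r) y"
proof -
  obtain c where c: "0 < c" "\<And>k y. k < r \<Longrightarrow> y \<in> VH (n + r) \<Longrightarrow>
      (D ^^ k) \<circ> y \<in> VH n \<and> vn n ((D ^^ k) \<circ> y) \<le> c * vn (n + r) y"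
    by (rule vn_funpow_D_le[of n]) blast
  have "vn n (lower_order A y) \<le> mult_const n * c * (\<Sum>k<r. mn n (A k)) * vn (n + r) y"
    if A: "coefficients n A" and y: "y \<in> VH (n + r)" for A y
  proof -
    have "vn n (lower_order A y) \<le> (\<Sum>k<r. vn n (mv (A k) ((D ^^ k) \<circ> y)))"
      unfolding lower_order_def using A c(2) y by (intro VH.nrm_sum_le mv_mem) auto
    also have "\<dots> \<le> (\<Sum>k<r. mult_const n * mn n (A k) * (c * vn (n + r) y))"
    proof (rule sum_mono)
      fix k assume "k \<in> {..<r}"
      then have Ak: "A k \<in> MH n" and Dy: "(D ^^ k) \<circ> y \<in> VH n" "vn n ((D ^^ k) \<circ> y) \<le> c * vn (n + r) y"
        using A c(2) y by auto
      have "vn n (mv (A k) ((D ^^ k) \<circ> y)) \<le> mult_const n * mn n (A k) * vn n ((D ^^ k) \<circ> y)"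
        by (rule vn_mv_le[OF Ak Dy(1)])
      also have "\<dots> \<le> mult_const n * mn n (A k) * (c * vn (n + r) y)"
        using mult_const_ge_1[of n] by (intro mult_left_mono Dy(2) mult_nonneg_nonneg MH.nrm_nonneg Ak) simp
      finally show "vn n (mv (A k) ((D ^^ k) \<circ> y)) \<le> mult_const n * mn n (A k) * (c * vn (n + r) y)" .
    qed
    finally show ?thesis by (simp add: sum_distrib_left sum_distrib_right mult_ac)
  qed
  moreover have "0 < mult_const n * c" using c(1) mult_const_ge_1[of n] by simp
  ultimately show thesis by (rule that[rotated])
qed

lemma Lop_eq_L:
  assumes A: "coefficients n (\<lambda>k. A k \<epsilon>)" and y: "y \<in> VH (n + r)"
  shows "Lop a b m r A \<epsilon> y = L (\<lambda>k. A k \<epsilon>) y"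
proof (intro ext)
  fix i t
  interpret bounded_operator "VH (n + r)" "vn (n + r)" "VH n" "vn n" "L (\<lambda>k. A k \<epsilon>)" by (rule L_bounded[OF A])
  have outside: "L (\<lambda>k. A k \<epsilon>) y i t = 0" if "\<not> (i < m \<and> t \<in> {a..b})"
    using tuples_beyond[OF maps[OF y], of i]
      Hoelder_outside[OF H.tuples_component[OF maps[OF y]], of t i] that
    by (cases "i < m") auto
  have "(\<Sum>j\<in>{1..r}. f (r - j)) = (\<Sum>k<r. f k)" for f :: "nat \<Rightarrow> complex"
    by (rule sum.reindex_bij_witness[of _ "\<lambda>k. r - k" "\<lambda>j. r - j"]) auto
  from this[of "\<lambda>k. \<Sum>l<m. A k \<epsilon> i l t * (D ^^ k) (y l) t"]
  show "Lop a b m r A \<epsilon> y i t = L (\<lambda>k. A k \<epsilon>) y i t"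
    using outside by (auto simp: Lop_def L_def lower_order_def mv_def sum_fun_apply dern_eq_funpow)
qed

subsection \<open>The Volterra equation for the highest derivative\<close>

text \<open>Each term of the Volterra operator contains at least one integration. Splitting it off shows that
  the operator gains one derivative.\<close>

definition lower_order_integral :: "(nat \<Rightarrow> mat_fun) \<Rightarrow> vec_fun \<Rightarrow> vec_fun" where
  "lower_order_integral A w = (\<Sum>k<r. mv (A k) ((integ ^^ (r - Suc k)) \<circ> w))"

definition volterra :: "(nat \<Rightarrow> mat_fun) \<Rightarrow> vec_fun \<Rightarrow> vec_fun" where
  "volterra A v = - lower_order_integral A (integ \<circ> v)"

lemma volterra_apply: "volterra A v i t = - (\<Sum>k<r. mv (A k) ((integ ^^ (r - k)) \<circ> v) i t)"
proof -
  have "(integ ^^ (r - Suc k)) \<circ> (integ \<circ> v) = (integ ^^ (r - k)) \<circ> v" if "k < r" for k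
  proof -
    have "r - k = Suc (r - Suc k)" using that by simp
    then show ?thesis by (simp add: fun_eq_iff funpow_swap1)
  qed
  then show ?thesis by (simp add: volterra_def lower_order_integral_def sum_fun_apply)
qed

lemma lower_order_integral_bounded:
  assumes "coefficients n A"
  shows "bounded_vec_op n n (lower_order_integral A)"
proof -
  have "bounded_op n n (integ ^^ k)" for k
    using bounded_operator_comp[OF funpow_integ_bounded inclusion_bounded[of n "n + k"]] by (simp add: o_def)
  then show ?thesis
    unfolding lower_order_integral_def using assms
    by (intro bounded_operator_sum VH.normed_subspace_axioms mv_comp_bounded) auto
qed

lemma volterra_regularizing:
  assumes "coefficients (Suc n) A"
  shows "bounded_vec_op n (Suc n) (volterra A)"
  using bounded_operator_uminus[OF bounded_operator_comp[OF bounded_operator_tuples[OF integ_bounded]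
        lower_order_integral_bounded[OF assms]]]
  unfolding volterra_def[abs_def] o_apply .

lemma vec_inclusion_bounded:
  assumes "n \<le> k"
  shows "bounded_vec_op k n id"
proof -
  have "(\<circ>) (id :: (real \<Rightarrow> complex) \<Rightarrow> _) = (id :: (nat \<Rightarrow> real \<Rightarrow> complex) \<Rightarrow> _)"
    by (simp add: fun_eq_iff)
  with bounded_operator_tuples[OF inclusion_bounded[OF assms], of m] show ?thesis by (simp only:)
qed

lemma coefficients_Suc: "coefficients (Suc n) A \<Longrightarrow> coefficients n A"
  using Hoelder_Suc_subset by (auto simp: tuples_def)

lemma volterra_bounded:
  assumes "coefficients n A"
  shows "bounded_vec_op n n (volterra A)"
proof -
  have "bounded_op n n integ"
    using bounded_operator_comp[OF integ_bounded inclusion_bounded[of n "Suc n"]] by (simp add: o_def)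
  from bounded_operator_uminus[OF bounded_operator_comp[OF bounded_operator_tuples[OF this]
        lower_order_integral_bounded[OF assms]]]
  show ?thesis unfolding volterra_def[abs_def] o_apply .
qed

text \<open>A bound in the sup norm with weight \<open>exp (- \<kappa> (t - a))\<close>: each integration gains a factor \<open>1 / \<kappa>\<close>.\<close>

definition exp_bounded :: "real \<Rightarrow> real \<Rightarrow> vec_fun \<Rightarrow> bool" where
  "exp_bounded \<kappa> C v \<longleftrightarrow> (\<forall>i. \<forall>t\<in>{a..b}. cmod (v i t) \<le> C * exp (\<kappa> * (t - a)))"

lemma volterra_exp_bounded:
  assumes A: "coefficients 0 A"
  obtains \<kappa> where "0 < \<kappa>"
    "\<And>v C. v \<in> VH 0 \<Longrightarrow> 0 \<le> C \<Longrightarrow> exp_bounded \<kappa> C v \<Longrightarrow> exp_bounded \<kappa> (C / 2) (volterra A v)"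
proof
  define S where "S = (\<Sum>k<r. mn 0 (A k))"
  define \<kappa> where "\<kappa> = 1 + 2 * S"
  have S: "0 \<le> S" unfolding S_def using A by (intro sum_nonneg MH.nrm_nonneg) auto
  then show "0 < \<kappa>" by (simp add: \<kappa>_def)
  fix v C assume v: "v \<in> VH 0" "0 \<le> C" and bound: "exp_bounded \<kappa> C v"
  show "exp_bounded \<kappa> (C / 2) (volterra A v)"
    unfolding exp_bounded_def
  proof (intro allI ballI)
    fix i t assume t: "t \<in> {a..b}"
    let ?e = "exp (\<kappa> * (t - a))"
    have integral_le: "cmod ((integ ^^ (r - k)) (v l) t) \<le> C / \<kappa> * ?e" if "k < r" for k l
    proof -
      have "\<kappa> ^ 1 \<le> \<kappa> ^ (r - k)" using that S by (intro power_increasing) (auto simp: \<kappa>_def)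
      then have "C / \<kappa> ^ (r - k) \<le> C / \<kappa>" using \<open>0 < \<kappa>\<close> v by (intro divide_left_mono) auto
      then have "C / \<kappa> ^ (r - k) * ?e \<le> C / \<kappa> * ?e" by (rule mult_right_mono) simp
      moreover have "cmod ((integ ^^ (r - k)) (v l) t) \<le> C / \<kappa> ^ (r - k) * ?e"
        using bound by (intro funpow_integ_exp_bound[OF H.tuples_component[OF v(1)] _ \<open>0 < \<kappa>\<close> v(2) t])
          (simp add: exp_bounded_def)
      ultimately show ?thesis by linarith
    qed
    have "cmod (volterra A v i t) \<le> (\<Sum>k<r. cmod (mv (A k) ((integ ^^ (r - k)) \<circ> v) i t))"
      by (simp add: volterra_apply norm_sum)
    also have "\<dots> \<le> (\<Sum>k<r. mn 0 (A k) * (C / \<kappa> * ?e))"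
      using A integral_le by (intro sum_mono norm_mv_le) auto
    also have "\<dots> = S / \<kappa> * (C * ?e)" by (simp add: S_def sum_distrib_right sum_divide_distrib)
    also have "\<dots> \<le> 1 / 2 * (C * ?e)"
      using S v by (intro mult_right_mono) (auto simp: \<kappa>_def divide_simps)
    finally show "cmod (volterra A v i t) \<le> C / 2 * ?e" by simp
  qed
qed

lemma vn_integ_le:
  assumes v: "v \<in> VH 0" and bound: "\<And>i t. t \<in> {a..b} \<Longrightarrow> cmod (v i t) \<le> C"
  shows "vn 0 (integ \<circ> v) \<le> m * (C * (b - a + (b - a) powr (1 - \<alpha>)))"
proof -
  have "vn 0 (integ \<circ> v) \<le> (\<Sum>i<m. C * (b - a + (b - a) powr (1 - \<alpha>)))"
    unfolding tuple_norm_def o_apply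
    by (intro sum_mono integ_smoothing H.tuples_component[OF v] bound)
  then show ?thesis by simp
qed

lemma vn_volterra_le:
  assumes A: "coefficients 0 A"
  obtains c where "0 \<le> c" "\<And>v C. v \<in> VH 0 \<Longrightarrow> (\<And>i t. t \<in> {a..b} \<Longrightarrow> cmod (v i t) \<le> C) \<Longrightarrow>
    vn 0 (volterra A v) \<le> c * C"
proof -
  interpret G: bounded_operator "VH 0" "vn 0" "VH 0" "vn 0" "lower_order_integral A"
    by (rule lower_order_integral_bounded[OF A])
  interpret integ: bounded_operator "VH 0" "vn 0" "VH (Suc 0)" "vn (Suc 0)" "(\<circ>) integ"
    by (rule bounded_operator_tuples[OF integ_bounded])
  interpret incl: bounded_operator "VH (Suc 0)" "vn (Suc 0)" "VH 0" "vn 0" id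
    by (rule vec_inclusion_bounded) simp
  obtain g where g: "0 \<le> g" "\<And>w. w \<in> VH 0 \<Longrightarrow> vn 0 (lower_order_integral A w) \<le> g * vn 0 w"
    using G.nonneg_bound by blast
  define s where "s = b - a + (b - a) powr (1 - \<alpha>)"
  have "vn 0 (volterra A v) \<le> g * m * s * C"
    if v: "v \<in> VH 0" and bound: "\<And>i t. t \<in> {a..b} \<Longrightarrow> cmod (v i t) \<le> C" for v C
  proof -
    have mem: "integ \<circ> v \<in> VH 0" using incl.maps[OF integ.maps[OF v]] by simp
    have "vn 0 (volterra A v) = vn 0 (lower_order_integral A (integ \<circ> v))"
      unfolding volterra_def by (rule VH.nrm_uminus[OF G.maps[OF mem]])
    also have "\<dots> \<le> g * vn 0 (integ \<circ> v)" by (rule g(2)[OF mem])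
    also have "\<dots> \<le> g * (m * (C * s))"
      unfolding s_def by (intro mult_left_mono vn_integ_le v bound g(1))
    finally show ?thesis by (simp add: mult_ac)
  qed
  moreover have "0 \<le> g * m * s" using g(1) a_less_b by (simp add: s_def)
  ultimately show thesis by (rule that[rotated])
qed

lemma funpow_volterra_exp_bounded:
  assumes A: "coefficients 0 A"
  obtains \<kappa> where "0 < \<kappa>" "\<And>v j. v \<in> VH 0 \<Longrightarrow> exp_bounded \<kappa> (vn 0 v / 2 ^ j) ((volterra A ^^ j) v)"
proof -
  obtain \<kappa> where \<kappa>: "0 < \<kappa>" and contraction:
    "\<And>v C. v \<in> VH 0 \<Longrightarrow> 0 \<le> C \<Longrightarrow> exp_bounded \<kappa> C v \<Longrightarrow> exp_bounded \<kappa> (C / 2) (volterra A v)"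
    using volterra_exp_bounded[OF A] by blast
  interpret pow: bounded_operator "VH 0" "vn 0" "VH 0" "vn 0" "volterra A ^^ j" for j
    by (rule bounded_operator_funpow[OF volterra_bounded[OF A]])
  have "exp_bounded \<kappa> (vn 0 v / 2 ^ j) ((volterra A ^^ j) v)" if v: "v \<in> VH 0" for v j
  proof (induction j)
    case 0
    have "cmod (v i t) \<le> vn 0 v * exp (\<kappa> * (t - a))" if "t \<in> {a..b}" for i t
      using norm_le_vn[OF v, of i t] mult_left_mono[OF _ VH.nrm_nonneg[OF v], of 1 "exp (\<kappa> * (t - a))"]
        that \<kappa> by simp
    then show ?case by (simp add: exp_bounded_def)
  next
    case (Suc j)
    then show ?case
      using contraction[OF pow.maps[OF v] _ Suc] VH.nrm_nonneg[OF v] by (simp add: mult.commute)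
  qed
  with \<kappa> show thesis by (rule that)
qed

lemma funpow_volterra_decay_0:
  assumes A: "coefficients 0 A"
  shows "\<exists>c\<ge>0. \<forall>v\<in>VH 0. \<forall>j. vn 0 ((volterra A ^^ j) v) \<le> c / 2 ^ j * vn 0 v"
proof -
  obtain \<kappa> where \<kappa>: "0 < \<kappa>" "\<And>v j. v \<in> VH 0 \<Longrightarrow> exp_bounded \<kappa> (vn 0 v / 2 ^ j) ((volterra A ^^ j) v)"
    using funpow_volterra_exp_bounded[OF A] by blast
  obtain c where c: "0 \<le> c"
    "\<And>v C. v \<in> VH 0 \<Longrightarrow> (\<And>i t. t \<in> {a..b} \<Longrightarrow> cmod (v i t) \<le> C) \<Longrightarrow> vn 0 (volterra A v) \<le> c * C"
    using vn_volterra_le[OF A] by blast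
  interpret pow: bounded_operator "VH 0" "vn 0" "VH 0" "vn 0" "volterra A ^^ j" for j
    by (rule bounded_operator_funpow[OF volterra_bounded[OF A]])
  define E where "E = exp (\<kappa> * (b - a))"
  have "vn 0 ((volterra A ^^ Suc j) v) \<le> c * E / 2 ^ j * vn 0 v" if v: "v \<in> VH 0" for v j
  proof -
    have "cmod ((volterra A ^^ j) v i t) \<le> vn 0 v / 2 ^ j * E" if t: "t \<in> {a..b}" for i t
    proof -
      have "vn 0 v / 2 ^ j * exp (\<kappa> * (t - a)) \<le> vn 0 v / 2 ^ j * E"
        unfolding E_def using t \<kappa>(1) VH.nrm_nonneg[OF v] by (intro mult_left_mono) auto
      moreover have "cmod ((volterra A ^^ j) v i t) \<le> vn 0 v / 2 ^ j * exp (\<kappa> * (t - a))"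
        using \<kappa>(2)[OF v, of j] t by (simp add: exp_bounded_def)
      ultimately show ?thesis by linarith
    qed
    from c(2)[OF pow.maps[OF v] this] show ?thesis by (simp add: mult_ac)
  qed
  then have "vn 0 ((volterra A ^^ j) v) \<le> (1 + 2 * (c * E)) / 2 ^ j * vn 0 v" if "v \<in> VH 0" for v j
    using that c(1) VH.nrm_nonneg[OF that]
    by (intro geometric_bound_of_Suc[of _ _ "\<lambda>j. vn 0 ((volterra A ^^ j) v)"]) (auto simp: E_def)
  moreover have "0 \<le> 1 + 2 * (c * E)" using c(1) by (simp add: E_def)
  ultimately show ?thesis by blast
qed

lemma funpow_volterra_decay:
  "coefficients n A \<Longrightarrow> \<exists>c\<ge>0. \<forall>v\<in>VH n. \<forall>j. vn n ((volterra A ^^ j) v) \<le> c / 2 ^ j * vn n v"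
proof (induction n)
  case 0
  then show ?case by (rule funpow_volterra_decay_0)
next
  case (Suc n)
  have A: "coefficients n A" using coefficients_Suc[OF Suc.prems] .
  obtain c where c: "0 \<le> c" "\<And>v j. v \<in> VH n \<Longrightarrow> vn n ((volterra A ^^ j) v) \<le> c / 2 ^ j * vn n v"
    using Suc.IH[OF A] by blast
  interpret reg: bounded_operator "VH n" "vn n" "VH (Suc n)" "vn (Suc n)" "volterra A"
    by (rule volterra_regularizing[OF Suc.prems])
  interpret pow: bounded_operator "VH n" "vn n" "VH n" "vn n" "volterra A ^^ j" for j
    by (rule bounded_operator_funpow[OF volterra_bounded[OF A]])
  interpret incl: bounded_operator "VH (Suc n)" "vn (Suc n)" "VH n" "vn n" id
    by (rule vec_inclusion_bounded) simp
  obtain d where d: "0 \<le> d" "\<And>v. v \<in> VH n \<Longrightarrow> vn (Suc n) (volterra A v) \<le> d * vn n v"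
    using reg.nonneg_bound by blast
  obtain e where e: "0 \<le> e" "\<And>v. v \<in> VH (Suc n) \<Longrightarrow> vn n (id v) \<le> e * vn (Suc n) v"
    using incl.nonneg_bound by blast
  have "vn (Suc n) ((volterra A ^^ Suc j) v) \<le> d * c * e / 2 ^ j * vn (Suc n) v"
    if v: "v \<in> VH (Suc n)" for v j
  proof -
    have v': "v \<in> VH n" using incl.maps[OF v] by simp
    have "vn (Suc n) ((volterra A ^^ Suc j) v) \<le> d * vn n ((volterra A ^^ j) v)"
      using d(2)[OF pow.maps[OF v']] by simp
    also have "\<dots> \<le> d * (c / 2 ^ j * (e * vn (Suc n) v))"
      using c(1) d(1) e(2)[OF v] by (intro mult_left_mono order_trans[OF c(2)[OF v']]) auto
    finally show ?thesis by simp
  qed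
  then have "vn (Suc n) ((volterra A ^^ j) v) \<le> (1 + 2 * (d * c * e)) / 2 ^ j * vn (Suc n) v"
    if "v \<in> VH (Suc n)" for v j
    using that c(1) d(1) e(1) VH.nrm_nonneg[OF that]
    by (intro geometric_bound_of_Suc[of _ _ "\<lambda>j. vn (Suc n) ((volterra A ^^ j) v)"]) auto
  moreover have "0 \<le> 1 + 2 * (d * c * e)" using c(1) d(1) e(1) by simp
  ultimately show ?case by blast
qed

lemma funpow_volterra_contraction:
  assumes "coefficients n A"
  obtains j \<kappa> where "\<kappa> < 1" "\<And>v. v \<in> VH n \<Longrightarrow> vn n ((volterra A ^^ j) v) \<le> \<kappa> * vn n v"
proof -
  obtain c where c: "\<And>v j. v \<in> VH n \<Longrightarrow> vn n ((volterra A ^^ j) v) \<le> c / 2 ^ j * vn n v"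
    using funpow_volterra_decay[OF assms] by blast
  obtain j where "c < 2 ^ j" using real_arch_pow[of 2 c] by auto
  then have "c / 2 ^ j < 1" by simp
  then show thesis using c by (rule that)
qed

subsection \<open>The Cauchy problem\<close>

lemma funpow_D_funpow_integ:
  assumes x: "x \<in> H n" and "k \<le> j"
  shows "(D ^^ k) ((integ ^^ j) x) = (integ ^^ (j - k)) x"
  using assms(2)
proof (induction k)
  case (Suc k)
  interpret bounded_operator "H n" "hnorm n" "H (n + i)" "hnorm (n + i)" "integ ^^ i" for i
    by (rule funpow_integ_bounded)
  have "j - k = Suc (j - Suc k)" using Suc.prems by simp
  then have "D ((integ ^^ (j - k)) x) = (integ ^^ (j - Suc k)) x"
    using D_integ[OF maps[OF x]] by simp
  then show ?case using Suc by simp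
qed simp

lemma funpow_integ_funpow_D:
  assumes x: "x \<in> H (n + k)" and "\<And>j. j < k \<Longrightarrow> (D ^^ j) x a = 0"
  shows "(integ ^^ k) ((D ^^ k) x) = x"
  using assms
proof (induction k arbitrary: n)
  case (Suc k)
  interpret bounded_operator "H (Suc n + k)" "hnorm (Suc n + k)" "H (Suc n)" "hnorm (Suc n)" "D ^^ k"
    by (rule funpow_D_bounded) simp
  have "(D ^^ k) x \<in> H (Suc n)" using maps[of x] Suc.prems(1) by simp
  then have "integ (D ((D ^^ k) x)) = (D ^^ k) x"
    using Hoelder_Suc_decomposition[of "(D ^^ k) x" n] Suc.prems(2)[of k] by simp
  then show ?case using Suc.IH[of "Suc n"] Suc.prems by (simp add: funpow_swap1)
qed simp

lemma L_funpow_integ: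
  assumes "v \<in> VH n"
  shows "L A ((integ ^^ r) \<circ> v) = v - volterra A v"
proof -
  have derivs: "(D ^^ k) \<circ> ((integ ^^ r) \<circ> v) = (integ ^^ (r - k)) \<circ> v" if "k \<le> r" for k
    using funpow_D_funpow_integ[OF H.tuples_component[OF assms] that] by (simp add: fun_eq_iff)
  have "L A ((integ ^^ r) \<circ> v) = v + (\<Sum>k<r. mv (A k) ((integ ^^ (r - k)) \<circ> v))"
    using derivs[of r] by (simp add: L_def lower_order_def derivs)
  then show ?thesis by (simp add: fun_eq_iff volterra_apply sum_fun_apply)
qed

text \<open>The Cauchy data at \<open>a\<close> are stored as a vector of length \<open>r * m\<close>,
  the k-th derivative of the l-th component having index \<open>k * m + l\<close>.\<close>

definition cauchy_data :: "vec_fun \<Rightarrow> nat \<Rightarrow> complex" where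
  "cauchy_data y = (\<lambda>s. if s < r * m then (D ^^ (s div m)) (y (s mod m)) a else 0)"

definition vec_monomial :: "nat \<Rightarrow> vec_fun" where
  "vec_monomial s = (\<lambda>i. if i = s mod m then monomial (s div m) else 0)"

lemma index_less: "k < r \<Longrightarrow> l < m \<Longrightarrow> k * m + l < r * m"
  using mult_le_mono1[of "Suc k" r m] by simp

lemma index_div_mod: "s < r * m \<Longrightarrow> s div m < r \<and> s mod m < m"
  by (metis less_mult_imp_div_less mod_less_divisor mult_0_right gr0I not_less0)

lemma cauchy_data_linear:
  "linear_operator (VH (n + r)) (vn (n + r)) (cvec (r * m)) (cnorm (r * m)) cauchy_data"
proof
  fix x y assume x: "x \<in> VH (n + r)"
  show "cauchy_data x \<in> cvec (r * m)" by (simp add: cauchy_data_def cvec_def)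
  have D_operator: "bounded_op (n + r) n (D ^^ (s div m))" if "s < r * m" for s
    using index_div_mod[OF that] by (intro funpow_D_bounded) simp
  note D_linear = bounded_operator.axioms(1)[OF D_operator]
  show "cauchy_data (x + y) = cauchy_data x + cauchy_data y" if y: "y \<in> VH (n + r)"
    using linear_operator.add[OF D_linear H.tuples_component[OF x] H.tuples_component[OF y]]
    by (auto simp: cauchy_data_def fun_eq_iff)
  show "cauchy_data (c *\<^sub>C x) = c *\<^sub>C cauchy_data x" for c
    using linear_operator.scaleC[OF D_linear H.tuples_component[OF x]]
    by (auto simp: cauchy_data_def fun_eq_iff)
qed

lemma funpow_D_zero: "(D ^^ k) 0 = 0"
  using linear_operator.zero[OF bounded_operator.axioms(1)[OF funpow_D_bounded[OF order_refl]]] .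

lemma cauchy_data_eq_0D:
  assumes y: "y \<in> VH (n + r)" and zero: "cauchy_data y = 0" and "k < r"
  shows "(D ^^ k) (y l) a = 0"
proof (cases "l < m")
  case True
  then show ?thesis
    using fun_cong[OF zero, of "k * m + l"] index_less[OF assms(3) True] by (simp add: cauchy_data_def)
qed (use tuples_beyond[OF y, of l] funpow_D_zero in simp)

lemma vec_monomial_mem: "s < r * m \<Longrightarrow> vec_monomial s \<in> VH n"
  using index_div_mod[of s] by (intro tuplesI) (auto simp: vec_monomial_def monomial_Hoelder Hoelder_zero)

lemma cauchy_data_vec_monomial:
  assumes "s < r * m"
  shows "cauchy_data (vec_monomial s) = std_basis s"
proof
  fix s'
  have "s' = s \<longleftrightarrow> s' div m = s div m \<and> s' mod m = s mod m"
    by (metis div_mult_mod_eq)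
  then show "cauchy_data (vec_monomial s) s' = std_basis s s'"
    using assms by (auto simp: cauchy_data_def vec_monomial_def std_basis_def funpow_D_monomial
        funpow_D_zero monomial_start)
qed

lemma zero_data_solvable_L:
  assumes A: "coefficients n A" and f: "f \<in> VH n"
  shows "\<exists>u\<in>VH (n + r). L A u = f \<and> cauchy_data u = 0"
proof -
  interpret I: bounded_operator "VH n" "vn n" "VH (n + r)" "vn (n + r)" "(\<circ>) (integ ^^ r)"
    by (rule bounded_operator_tuples[OF funpow_integ_bounded])
  obtain j \<kappa> where "\<kappa> < 1" "\<And>v. v \<in> VH n \<Longrightarrow> vn n ((volterra A ^^ j) v) \<le> \<kappa> * vn n v"
    using funpow_volterra_contraction[OF A] by metis
  from VH.identity_minus_surj[OF volterra_bounded[OF A] this f]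
  obtain v where v: "v \<in> VH n" "v - volterra A v = f" by blast
  have "(D ^^ k) ((integ ^^ r) (v l)) a = 0" if k: "k < r" for k l
  proof -
    obtain i where "r - k = Suc i" using Suc_diff_Suc[OF k] by metis
    then show ?thesis
      using funpow_D_funpow_integ[OF H.tuples_component[OF v(1)], of k r] k by (simp add: integ_start)
  qed
  then have "cauchy_data ((integ ^^ r) \<circ> v) = 0"
    using index_div_mod by (auto simp: cauchy_data_def fun_eq_iff)
  then show ?thesis
    using I.maps[OF v(1)] L_funpow_integ[OF v(1), of A] v(2) by (intro bexI[of _ "(integ ^^ r) \<circ> v"]) simp_all
qed

lemma zero_data_stable_L:
  assumes A: "coefficients n A"
  shows "\<exists>c. \<forall>u\<in>VH (n + r). cauchy_data u = 0 \<longrightarrow> vn (n + r) u \<le> c * vn n (L A u)"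
proof -
  interpret I: bounded_operator "VH n" "vn n" "VH (n + r)" "vn (n + r)" "(\<circ>) (integ ^^ r)"
    by (rule bounded_operator_tuples[OF funpow_integ_bounded])
  interpret D: bounded_operator "VH (n + r)" "vn (n + r)" "VH n" "vn n" "(\<circ>) (D ^^ r)"
    by (rule bounded_operator_tuples[OF funpow_D_bounded]) simp
  obtain j \<kappa> where "\<kappa> < 1" "\<And>v. v \<in> VH n \<Longrightarrow> vn n ((volterra A ^^ j) v) \<le> \<kappa> * vn n v"
    using funpow_volterra_contraction[OF A] by metis
  from VH.identity_minus_bounded_below[OF volterra_bounded[OF A] this]
  obtain c where c: "\<And>v. v \<in> VH n \<Longrightarrow> vn n v \<le> c * vn n (v - volterra A v)" by blast
  obtain d where d: "0 \<le> d" "\<And>v. v \<in> VH n \<Longrightarrow> vn (n + r) ((integ ^^ r) \<circ> v) \<le> d * vn n v"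
    by (rule I.nonneg_bound) blast
  have "vn (n + r) u \<le> d * c * vn n (L A u)" if u: "u \<in> VH (n + r)" "cauchy_data u = 0" for u
  proof -
    define v where "v = (D ^^ r) \<circ> u"
    have v: "v \<in> VH n" unfolding v_def by (rule D.maps[OF u(1)])
    have "(integ ^^ r) \<circ> v = u"
      using funpow_integ_funpow_D[OF H.tuples_component[OF u(1)] cauchy_data_eq_0D[OF u]]
      by (simp add: v_def fun_eq_iff)
    then show ?thesis
      using d(2)[OF v] mult_left_mono[OF c[OF v] d(1)] L_funpow_integ[OF v, of A] by (simp add: mult.assoc)
  qed
  then show ?thesis by blast
qed

lemma initial_value_operator_L:
  assumes "coefficients n A"
  shows "initial_value_operator (VH (n + r)) (vn (n + r)) (VH n) (vn n) (L A) (r * m)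
    cauchy_data vec_monomial"
  using L_bounded[OF assms] cauchy_data_linear zero_data_solvable_L[OF assms] zero_data_stable_L[OF assms]
  by (intro initial_value_operator.intro initial_value_operator_axioms.intro)
    (auto simp: vec_monomial_mem cauchy_data_vec_monomial)

subsection \<open>Recovering the coefficients\<close>

lemma lower_order_vec_monomial:
  assumes "j < r" "l < m"
  shows "lower_order A (vec_monomial (j * m + l)) i = (\<Sum>k\<le>j. A k i l * monomial (j - k))"
proof -
  have "lower_order A (vec_monomial (j * m + l)) i =
      (\<Sum>k<r. \<Sum>l'<m. A k i l' * (D ^^ k) (vec_monomial (j * m + l) l'))"
    by (simp add: lower_order_def mv_def sum_fun_apply)
  also have "\<dots> = (\<Sum>k<r. \<Sum>l'<m. if l' = l then A k i l' * (D ^^ k) (monomial j) else 0)"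
    using assms(2) by (intro sum.cong refl) (auto simp: vec_monomial_def funpow_D_zero)
  also have "\<dots> = (\<Sum>k<r. A k i l * (D ^^ k) (monomial j))" using assms(2) by simp
  also have "\<dots> = (\<Sum>k\<le>j. A k i l * monomial (j - k))"
    using assms(1) by (intro sum.mono_neutral_cong_right) (auto simp: funpow_D_monomial)
  finally show ?thesis .
qed

lemma hnorm_coefficient_le:
  assumes A: "coefficients n A" and j: "j < r" and l: "l < m"
  shows "hnorm n (A j i l) \<le> vn n (lower_order A (vec_monomial (j * m + l))) +
    mult_const n * (\<Sum>k\<le>r. hnorm n (monomial k)) * (\<Sum>k<j. hnorm n (A k i l))"
proof -
  interpret P: bounded_operator "VH (n + r)" "vn (n + r)" "VH n" "vn n" "lower_order A"
    by (rule lower_order_bounded[OF A])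
  let ?f = "lower_order A (vec_monomial (j * m + l))"
  let ?g = "mult_const n * (\<Sum>k\<le>r. hnorm n (monomial k))"
  have entry: "A k i l \<in> H n" if "k < r" for k using A that matrix_entry by blast
  have f: "?f \<in> VH n" by (intro P.maps vec_monomial_mem index_less j l)
  have product: "A k i l * monomial (j - k) \<in> H n"
    "hnorm n (A k i l * monomial (j - k)) \<le> ?g * hnorm n (A k i l)"
    if "k < j" for k
  proof -
    note mult = Hoelder_mult[OF entry monomial_Hoelder[of "j - k"], of k]
    have "hnorm n (monomial (j - k)) \<le> (\<Sum>k\<le>r. hnorm n (monomial k))"
      using j by (intro member_le_sum H.nrm_nonneg monomial_Hoelder) auto
    then have "mult_const n * hnorm n (A k i l) * hnorm n (monomial (j - k)) \<le> ?g * hnorm n (A k i l)"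
      using mult_const_ge_1[of n] H.nrm_nonneg[OF entry, of k] that j
      by (simp add: mult.assoc mult.commute[of "hnorm n (A k i l)"] mult_left_mono mult_right_mono)
    then show "A k i l * monomial (j - k) \<in> H n"
      "hnorm n (A k i l * monomial (j - k)) \<le> ?g * hnorm n (A k i l)"
      using mult that j by auto
  qed
  have "A j i l * monomial 0 = A j i l"
    using Hoelder_outside[OF entry[OF j]] by (auto simp: fun_eq_iff monomial_0)
  then have "?f i = (\<Sum>k<j. A k i l * monomial (j - k)) + A j i l"
    by (simp add: lower_order_vec_monomial[OF j l] flip: lessThan_Suc_atMost)
  then have "A j i l = ?f i - (\<Sum>k<j. A k i l * monomial (j - k))" by simp
  moreover have "(\<Sum>k<j. A k i l * monomial (j - k)) \<in> H n" using product(1) by (intro H.sum_mem) simp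
  ultimately have "hnorm n (A j i l) \<le> hnorm n (?f i) + hnorm n (\<Sum>k<j. A k i l * monomial (j - k))"
    using H.nrm_diff_le[OF H.tuples_component[OF f]] by metis
  also have "\<dots> \<le> vn n ?f + (\<Sum>k<j. hnorm n (A k i l * monomial (j - k)))"
    using product(1) by (intro add_mono H.nrm_component_le f H.nrm_sum_le) auto
  also have "\<dots> \<le> vn n ?f + (\<Sum>k<j. ?g * hnorm n (A k i l))"
    using product(2) by (intro add_left_mono sum_mono) auto
  finally show ?thesis by (simp add: sum_distrib_left)
qed

lemma mn_le_lower_order_vec_monomials:
  "\<exists>c. \<forall>A. coefficients n A \<longrightarrow> (\<Sum>k<r. mn n (A k)) \<le> c * (\<Sum>s<r * m. vn n (lower_order A (vec_monomial s)))"
proof -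
  define g where "g = mult_const n * (\<Sum>k\<le>r. hnorm n (monomial k))"
  have g: "0 \<le> g" unfolding g_def
    using mult_const_ge_1[of n] by (intro mult_nonneg_nonneg sum_nonneg H.nrm_nonneg monomial_Hoelder) auto
  have "(\<Sum>k<r. mn n (A k)) \<le>
      (\<Sum>k<r. real m * (real m * (1 + g) ^ k)) * (\<Sum>s<r * m. vn n (lower_order A (vec_monomial s)))"
    if A: "coefficients n A" for A
  proof -
    interpret P: bounded_operator "VH (n + r)" "vn (n + r)" "VH n" "vn n" "lower_order A"
      by (rule lower_order_bounded[OF A])
    define R where "R = (\<Sum>s<r * m. vn n (lower_order A (vec_monomial s)))"
    have "vn n (lower_order A (vec_monomial s)) \<le> R" if "s < r * m" for s
      unfolding R_def using that by (intro member_le_sum VH.nrm_nonneg P.maps vec_monomial_mem) auto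
    then have "hnorm n (A j i l) \<le> R + g * (\<Sum>k<j. hnorm n (A k i l))" if "j < r" "l < m" for j i l
      unfolding g_def using hnorm_coefficient_le[OF A that, of i] index_less[OF that] by fastforce
    then have entry_le: "hnorm n (A k i l) \<le> R * (1 + g) ^ k" if "k < r" "l < m" for k i l
      using that by (intro discrete_gronwall[OF g])
    have "mn n (A k) \<le> real m * (real m * (1 + g) ^ k) * R" if "k < r" for k
    proof -
      have "mn n (A k) \<le> (\<Sum>i<m. \<Sum>l<m. R * (1 + g) ^ k)"
        unfolding tuple_norm_def[of m _ "A k"] tuple_norm_def[of m _ "A k _"]
        by (intro sum_mono entry_le that) simp
      then show ?thesis by (simp add: mult_ac)
    qed
    then show ?thesis unfolding R_def[symmetric] sum_distrib_right by (intro sum_mono) simp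
  qed
  then show ?thesis by blast
qed

end

section \<open>The parameter-dependent boundary-value problem\<close>

lemma (in initial_value_operator) initial_value_operator_cong:
  assumes eq: "\<And>y. y \<in> V \<Longrightarrow> L' y = L y"
  shows "initial_value_operator V p W q L' N \<Lambda> z"
proof -
  obtain c where c: "\<And>y. y \<in> V \<Longrightarrow> q (L y) \<le> c * p y" using L.bounded by blast
  interpret L': bounded_operator V p W q L'
    by (rule bounded_operatorI[OF L.dom.normed_subspace_axioms L.cod.normed_subspace_axioms, where c = c])
       (auto simp: eq c L.maps L.add L.scaleC L.dom.add_mem L.dom.scaleC_mem)
  show ?thesis
    by unfold_locales
       (use z_mem initial_data_z zero_data_solvable zero_data_stable in \<open>auto simp: eq\<close>)
qed

context hoelder_system
begin

lemma bounded_operator_of_cont_lin_op: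
  assumes "cont_lin_op m n \<alpha> a b N T"
  shows "bounded_operator (VH n) (vn n) (cvec N) (cnorm N) T"
proof -
  note cont_lin = assms[unfolded cont_lin_op_def VHoelder_eq_tuples vnorm_eq_tuple_norm]
  have lincomb: "T (c *\<^sub>C y + d *\<^sub>C z) = c *\<^sub>C T y + d *\<^sub>C T z" if "y \<in> VH n" "z \<in> VH n" for c d y z
    using cont_lin that by (simp add: plus_fun_def scaleC_fun_def scaleC_complex_def)
  interpret linear_operator "VH n" "vn n" "cvec N" "cnorm N" T
  proof
    show "T (y + z) = T y + T z" if "y \<in> VH n" "z \<in> VH n" for y z
      using lincomb[OF that, of 1 1] by (simp add: scaleC_one)
    show "T (c *\<^sub>C y) = c *\<^sub>C T y" if "y \<in> VH n" for y c
      using lincomb[OF that that, of c 0] by simp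
  qed (use cont_lin in blast)
  have "\<forall>y\<in>VH n. \<forall>e>0. \<exists>d>0. \<forall>z\<in>VH n. vn n (z - y) < d \<longrightarrow> cnorm N (T z - T y) < e"
    using cont_lin by (simp add: fun_diff_def)
  from this[rule_format, of 0 1]
  obtain d where d: "0 < d" "\<And>z. z \<in> VH n \<Longrightarrow> vn n z < d \<Longrightarrow> cnorm N (T z) < 1"
    by (auto simp: zero VH.zero_mem)
  have "cnorm N (T y) \<le> 2 * 1 / d * vn n y" if "y \<in> VH n" for y
    using d(2) by (intro bound_of_bound_on_ball[OF d(1) _ that]) (simp add: less_imp_le)
  then show ?thesis by unfold_locales blast
qed

lemma initial_value_operator_Lop:
  assumes "coefficients n (\<lambda>k. A k \<epsilon>)"
  shows "initial_value_operator (VH (n + r)) (vn (n + r)) (VH n) (vn n) (Lop a b m r A \<epsilon>) (r * m)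
    cauchy_data vec_monomial"
  using initial_value_operator.initial_value_operator_cong[OF initial_value_operator_L[OF assms]]
    Lop_eq_L[where A = A, OF assms] by blast

lemma parametric_boundary_problem_Lop:
  assumes \<epsilon>0: "0 < \<epsilon>0" and A: "\<And>\<epsilon>. \<epsilon> \<in> {0..<\<epsilon>0} \<Longrightarrow> coefficients n (\<lambda>k. A k \<epsilon>)"
    and B: "\<And>\<epsilon>. \<epsilon> \<in> {0..<\<epsilon>0} \<Longrightarrow> cont_lin_op m (n + r) \<alpha> a b (r * m) (B \<epsilon>)"
  obtains C where "0 < C" "parametric_boundary_problem (VH (n + r)) (vn (n + r)) (VH n) (vn n) \<epsilon>0 (r * m)
    (Lop a b m r A) B cauchy_data vec_monomial (\<lambda>\<epsilon>. C * (\<Sum>k<r. mn n (A k \<epsilon> - A k 0)))"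
proof -
  have diff: "coefficients n (\<lambda>k. A k \<epsilon> - A k 0)" if "\<epsilon> \<in> {0..<\<epsilon>0}" for \<epsilon>
    using A[OF that] A[of 0] \<epsilon>0 by (auto intro: MH.diff_mem)
  have Lop_diff: "Lop a b m r A \<epsilon> y - Lop a b m r A 0 y = lower_order (\<lambda>k. A k \<epsilon> - A k 0) y"
    if "\<epsilon> \<in> {0..<\<epsilon>0}" "y \<in> VH (n + r)" for \<epsilon> y
    using Lop_eq_L[where A = A, OF A] that \<epsilon>0 by (simp add: L_diff_eq_lower_order)
  have sum_nonneg: "0 \<le> (\<Sum>k<r. mn n (A k \<epsilon> - A k 0))" if "\<epsilon> \<in> {0..<\<epsilon>0}" for \<epsilon>
    using diff[OF that] by (intro sum_nonneg MH.nrm_nonneg) auto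
  obtain C where C: "0 < C" "\<And>A y. coefficients n A \<Longrightarrow> y \<in> VH (n + r) \<Longrightarrow>
      vn n (lower_order A y) \<le> C * (\<Sum>k<r. mn n (A k)) * vn (n + r) y"
    by (rule vn_lower_order_le[of n]) blast
  obtain c where c: "\<And>A. coefficients n A \<Longrightarrow>
      (\<Sum>k<r. mn n (A k)) \<le> c * (\<Sum>s<r * m. vn n (lower_order A (vec_monomial s)))"
    using mn_le_lower_order_vec_monomials[of n] by blast
  have "vn n (Lop a b m r A \<epsilon> y - Lop a b m r A 0 y) \<le> C * (\<Sum>k<r. mn n (A k \<epsilon> - A k 0)) * vn (n + r) y"
    if "\<epsilon> \<in> {0..<\<epsilon>0}" "y \<in> VH (n + r)" for \<epsilon> y
    using C(2)[OF diff[OF that(1)] that(2)] Lop_diff[OF that] by simp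
  moreover have "C * (\<Sum>k<r. mn n (A k \<epsilon> - A k 0)) \<le>
      C * c * (\<Sum>s<r * m. vn n (Lop a b m r A \<epsilon> (vec_monomial s) - Lop a b m r A 0 (vec_monomial s)))"
    if "\<epsilon> \<in> {0..<\<epsilon>0}" for \<epsilon>
    using mult_left_mono[OF c[OF diff[OF that]], of C] C(1) Lop_diff[OF that vec_monomial_mem]
    by (simp add: mult.assoc)
  ultimately have "parametric_boundary_problem (VH (n + r)) (vn (n + r)) (VH n) (vn n) \<epsilon>0 (r * m)
    (Lop a b m r A) B cauchy_data vec_monomial (\<lambda>\<epsilon>. C * (\<Sum>k<r. mn n (A k \<epsilon> - A k 0)))"
    using \<epsilon>0 A B less_imp_le[OF C(1)] sum_nonneg
    by (intro parametric_boundary_problem.intro parametric_boundary_problem_axioms.intro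
        VH.banach_subspace_axioms VH.normed_subspace_axioms initial_value_operator_Lop
        bounded_operator_of_cont_lin_op) (blast | simp)+
  with C(1) show thesis by (rule that)
qed

end

lemma tendsto_zero_mult_sum_iff:
  fixes f :: "nat \<Rightarrow> 'c \<Rightarrow> real"
  assumes "0 < C" and nonneg: "\<And>k. k < r \<Longrightarrow> \<forall>\<^sub>F x in F. 0 \<le> f k x"
  shows "((\<lambda>x. C * (\<Sum>k<r. f k x)) \<longlongrightarrow> 0) F \<longleftrightarrow> (\<forall>k<r. (f k \<longlongrightarrow> 0) F)"
proof (intro iffI allI impI)
  assume "\<forall>k<r. (f k \<longlongrightarrow> 0) F"
  then have "((\<lambda>x. C * (\<Sum>k<r. f k x)) \<longlongrightarrow> C * (\<Sum>k<r. 0)) F" by (intro tendsto_intros) auto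
  then show "((\<lambda>x. C * (\<Sum>k<r. f k x)) \<longlongrightarrow> 0) F" by simp
next
  fix k assume lim: "((\<lambda>x. C * (\<Sum>k<r. f k x)) \<longlongrightarrow> 0) F" and k: "k < r"
  have "((\<lambda>x. \<Sum>k<r. f k x) \<longlongrightarrow> 0) F" using tendsto_mult_right_zero[OF lim, of "1 / C"] \<open>0 < C\<close> by simp
  moreover have "\<forall>\<^sub>F x in F. \<forall>k\<in>{..<r}. 0 \<le> f k x" using nonneg by (intro eventually_ball_finite) auto
  then have "\<forall>\<^sub>F x in F. norm (f k x) \<le> (\<Sum>k<r. f k x)"
    by eventually_elim (use k in \<open>auto intro: member_le_sum\<close>)
  ultimately show "(f k \<longlongrightarrow> 0) F" by (rule Lim_null_comparison[rotated])
qed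

theorem mainTheorem1:
  fixes a b \<alpha> \<epsilon>0 :: real
    and m r n :: nat
    and A :: "nat \<Rightarrow> real \<Rightarrow> nat \<Rightarrow> nat \<Rightarrow> real \<Rightarrow> complex"
    and B :: "real \<Rightarrow> (nat \<Rightarrow> real \<Rightarrow> complex) \<Rightarrow> (nat \<Rightarrow> complex)"
  assumes "a < b" and "1 \<le> m" and "2 \<le> r" and "0 < \<alpha>" and "\<alpha> \<le> 1" and "0 < \<epsilon>0"
    and "\<forall>\<epsilon>\<in>{0..<\<epsilon>0}. \<forall>k<r. A k \<epsilon> \<in> MHoelder m n \<alpha> a b"
    and "\<forall>\<epsilon>\<in>{0..<\<epsilon>0}. cont_lin_op m (n + r) \<alpha> a b (r * m) (B \<epsilon>)"
  shows "cont_dep a b m r n \<alpha> \<epsilon>0 A B \<longleftrightarrow>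
    ((\<forall>y\<in>VHoelder m (n + r) \<alpha> a b.
        Lop a b m r A 0 y = (\<lambda>i t. 0) \<and> B 0 y = (\<lambda>i. 0) \<longrightarrow> y = (\<lambda>i t. 0)) \<and>
     (\<forall>k<r. ((\<lambda>\<epsilon>. mnorm m n \<alpha> a b (\<lambda>i l t. A k \<epsilon> i l t - A k 0 i l t)) \<longlongrightarrow> 0) (at_right 0)) \<and>
     (\<forall>y\<in>VHoelder m (n + r) \<alpha> a b.
        ((\<lambda>\<epsilon>. cnorm (r * m) (\<lambda>i. B \<epsilon> y i - B 0 y i)) \<longlongrightarrow> 0) (at_right 0)))"
proof -
  interpret hoelder_system a b \<alpha> m r by unfold_locales (use assms in auto)
  have coeff: "coefficients n (\<lambda>k. A k \<epsilon>)" if "\<epsilon> \<in> {0..<\<epsilon>0}" for \<epsilon>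
    using assms(7) that by (simp add: MHoelder_eq_tuples)
  obtain C where "0 < C"
    and problem: "parametric_boundary_problem (VH (n + r)) (vn (n + r)) (VH n) (vn n) \<epsilon>0 (r * m)
      (Lop a b m r A) B cauchy_data vec_monomial (\<lambda>\<epsilon>. C * (\<Sum>k<r. mn n (A k \<epsilon> - A k 0)))"
    using parametric_boundary_problem_Lop[where A = A, OF assms(6) coeff] assms(8) by blast
  interpret parametric_boundary_problem "VH (n + r)" "vn (n + r)" "VH n" "vn n" \<epsilon>0 "r * m"
    "Lop a b m r A" B cauchy_data vec_monomial "\<lambda>\<epsilon>. C * (\<Sum>k<r. mn n (A k \<epsilon> - A k 0))" by (rule problem)
  have "\<forall>\<^sub>F \<epsilon> in at_right 0. 0 \<le> mn n (A k \<epsilon> - A k 0)" if "k < r" for k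
    using eventually_admissible
    by eventually_elim (use coeff zero_admissible that in \<open>blast intro: MH.nrm_nonneg MH.diff_mem\<close>)
  with \<open>0 < C\<close> have "((\<lambda>\<epsilon>. C * (\<Sum>k<r. mn n (A k \<epsilon> - A k 0))) \<longlongrightarrow> 0) (at_right 0) \<longleftrightarrow>
      (\<forall>k<r. ((\<lambda>\<epsilon>. mn n (A k \<epsilon> - A k 0)) \<longlongrightarrow> 0) (at_right 0))"
    by (rule tendsto_zero_mult_sum_iff)
  from continuous_dependence_iff[unfolded this] show ?thesis
    unfolding cont_dep_def continuous_dependence_def uniquely_solvable_def trivial_kernel_def
      boundary_strongly_continuous_def VHoelder_eq_tuples vnorm_eq_tuple_norm mnorm_eq_tuple_norm
      fun_diff_def zero_fun_def .
qed

end
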